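(* Let $R$ be an admissible ring, let $\mathcal{J}$ be a canonical ideal of $R$, let $\mathcal{I}$ be a regular fractional ideal of $R$ and let $\alpha\in\mathbb{Z}^r$. Then $\alpha$ is a maximal point of $E(\mathcal{I})$ if and only if $\mathfrak{f}(\mathcal{J})-\alpha$ is a maximal point of $E(\mathcal{J}:\mathcal{I})$. Moreover, $\alpha$ is a maximal point of $E(\mathcal{I})$ of type $(p,q)$ if and only if $\mathfrak{f}(\mathcal{J})-\alpha$ is a maximal point of $E(\mathcal{J}:\mathcal{I})$ of type $(r+1-q,\,r+1-p)$.
   Context: Admissible rings: a noetherian, Cohen–Macaulay, one-dimensional local ring $(R,\mathfrak{M})$ with total ring of fractions $Q$ is admissible if it is analytically reduced (its $\mathfrak{M}$-adic completion is reduced), residually rational (each valuation ring of $Q$ over $R$ has residue field equal to $R/\mathfrak{M}$), and $\#(R/\mathfrak{M})\geq r$, where $r$ is the number of valuation rings of $Q$ over $R$. All these valuation rings are discrete (they correspond to the maximal ideals of the integral closure of $R$ in $Q$); let $v_1,\ldots,v_r$ be the associated valuations. Put $I=\{1,\ldots,r\}$, let $Q^{reg}$ be the set of regular elements of $Q$, and define $v:Q^{reg}\to\mathbb{Z}^r$ by $v(h)=(v_1(h),\ldots,v_r(h))$. $\mathbb{Z}^r$ has the componentwise partial order $\leq$. A fractional ideal is an $R$-submodule $\mathcal{I}$ of $Q$ such that $d\,\mathcal{I}\subset R$ for some regular $d\in R$; it is regular if it contains a regular element of $Q$. For regular fractional ideals, $\mathcal{J}:\mathcal{I}=\{x\in Q:\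 x\mathcal{I}\subset\mathcal{J}\}$, which is again a regular fractional ideal. A regular fractional ideal $\mathcal{J}$ is a canonical ideal if $\mathcal{J}:(\mathcal{J}:\mathcal{I})=\mathcal{I}$ for every regular fractional ideal $\mathcal{I}$. The value set of a regular fractional ideal $\mathcal{I}$ is $E(\mathcal{I})=v(\mathcal{I}\cap Q^{reg})\subset\mathbb{Z}^r$. Its conductor $c(\mathcal{I})$ is the unique least element $\gamma\in E(\mathcal{I})$ such that $\gamma+\mathbb{N}^r\subset E(\mathcal{I})$ (with $0\in\mathbb{N}$; such an element exists), and its Frobenius vector is $\mathfrak{f}(\mathcal{I})=c(\mathcal{I})-e$ with $e=(1,\ldots,1)$. Fibers: for $E\subset\mathbb{Z}^r$, $\alpha\in\mathbb{Z}^r$ and $\emptyset\neq K\subset I$ ($K=I$ allowed), $F_K(E,\alpha)=\{\beta\in E:\ \beta_k=\alpha_k\ \forall k\in K,\ \beta_i>\alpha_i\ \forall i\in I\setminus K\}$, and $F(E,\alpha)=\bigcup_{i=1}^r F_{\{i\}}(E,\alpha)$. Put $$p(E,\alpha)=\max\{n:\ F_K(E,\alpha)=\emptyset\ \ \forall K\subset I,\ \#K\leq n\},\quad q(E,\alpha)=\min\{n:\ F_K(E,\alpha)\neq\emptyset\ \ \forall K\subset I,\ \#K\geq n\},$$ where $K$ is nonempty, $n$ ranges over $0,\ldots,r$ in the first formula and over $1,\ldots,r+1$ in the second (the conditions being vacuous for $n=0$, respectively $n=r+1$). A point $\alpha\in E$ is a maximal point of $E$ if $F(E,\alpha)=\emptyset$;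 a maximal point $\alpha$ of $E$ is of type $(p,q)$ if $p=p(E,\alpha)\geq1$ and $q=q(E,\alpha)\leq r$. *)

theory Defs
  imports
    "HOL-Algebra.Algebra"
    "HOL-Analysis.Finite_Cartesian_Product"
    "HOL-Library.Extended"
    "HOL-Library.Extended_Nat"
    "HOL-Library.Equipollence"
begin

text \<open>
  Rings are in the style of HOL-Algebra. A ring \<open>R\<close> is identified with a subset of (the carrier of)
  its total ring of fractions \<open>Q\<close>; as a ring in its own right it is \<open>Q\<lparr>carrier := R\<rparr>\<close>.
  Vectors in $\mathbb{Z}^r$ have type \<open>int ^ 'n\<close> where \<open>CARD('n) = r\<close>; their order \<open>\<le>\<close> is componentwise,
  and \<open>1\<close> is the vector $(1,\dots,1)$.
\<close>

section \<open>Commutative algebra\<close>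

definition regular_elements :: "('a, 'b) ring_scheme \<Rightarrow> 'a set" where
  "regular_elements A =
    {x \<in> carrier A. \<forall>y \<in> carrier A. x \<otimes>\<^bsub>A\<^esub> y = \<zero>\<^bsub>A\<^esub> \<longrightarrow> y = \<zero>\<^bsub>A\<^esub>}"

definition total_ring_of_fractions :: "('a, 'b) ring_scheme \<Rightarrow> 'a set \<Rightarrow> bool" where
  "total_ring_of_fractions Q R \<longleftrightarrow>
    cring Q \<and> subcring R Q \<and>
    regular_elements (Q\<lparr>carrier := R\<rparr>) \<subseteq> Units Q \<and>
    (\<forall>q \<in> carrier Q. \<exists>a \<in> R. \<exists>b \<in> regular_elements (Q\<lparr>carrier := R\<rparr>). q = a \<otimes>\<^bsub>Q\<^esub> inv\<^bsub>Q\<^esub> b)"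

definition local_ring :: "('a, 'b) ring_scheme \<Rightarrow> 'a set \<Rightarrow> bool" where
  "local_ring A M \<longleftrightarrow> cring A \<and> {N. maximalideal N A} = {M}"

definition krull_dim :: "('a, 'b) ring_scheme \<Rightarrow> enat" where
  "krull_dim A =
    (SUP n \<in> {n. \<exists>P. (\<forall>i\<le>n. primeideal (P i) A) \<and> (\<forall>i<n. P i \<subset> P (Suc i))}. enat n)"

definition regular_sequence :: "('a, 'b) ring_scheme \<Rightarrow> 'a list \<Rightarrow> bool" where
  "regular_sequence A xs \<longleftrightarrow>
    set xs \<subseteq> carrier A \<and>
    (\<forall>i < length xs. \<forall>a \<in> carrier A.
       xs ! i \<otimes>\<^bsub>A\<^esub> a \<in> Idl\<^bsub>A\<^esub> (set (take i xs)) \<longrightarrow> a \<in> Idl\<^bsub>A\<^esub> (set (take i xs))) \<and>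
    Idl\<^bsub>A\<^esub> (set xs) \<noteq> carrier A"

definition depth :: "('a, 'b) ring_scheme \<Rightarrow> 'a set \<Rightarrow> enat" where
  "depth A M = (SUP xs \<in> {xs. set xs \<subseteq> M \<and> regular_sequence A xs}. enat (length xs))"

text \<open>Only used for noetherian local rings \<open>(A, M)\<close>.\<close>

definition cohen_macaulay :: "('a, 'b) ring_scheme \<Rightarrow> 'a set \<Rightarrow> bool" where
  "cohen_macaulay A M \<longleftrightarrow> depth A M = krull_dim A"

text \<open>
  The inverse limit of the rings $A/M^n$. The transition map sends a coset of $M^{n+1}$ to the
  unique coset of $M^n$ containing it, so compatibility of a sequence of cosets is inclusion.
\<close>

definition adic_completion :: "('a, 'b) ring_scheme \<Rightarrow> 'a set \<Rightarrow> (nat \<Rightarrow> 'a set) ring" where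
  "adic_completion A M =
    (let B = (\<lambda>n::nat. A Quot (M [^]\<^bsub>ideals_set A\<^esub> n)) in
      \<lparr>carrier = {x. (\<forall>n. x n \<in> carrier (B n)) \<and> (\<forall>n. x (Suc n) \<subseteq> x n)},
       monoid.mult = (\<lambda>x y n. x n \<otimes>\<^bsub>B n\<^esub> y n), monoid.one = (\<lambda>n. \<one>\<^bsub>B n\<^esub>),
       ring.zero = (\<lambda>n. \<zero>\<^bsub>B n\<^esub>), ring.add = (\<lambda>x y n. x n \<oplus>\<^bsub>B n\<^esub> y n)\<rparr>)"

definition reduced_ring :: "('a, 'b) ring_scheme \<Rightarrow> bool" where
  "reduced_ring A \<longleftrightarrow> (\<forall>x \<in> carrier A. \<forall>n::nat. x [^]\<^bsub>A\<^esub> n = \<zero>\<^bsub>A\<^esub> \<longrightarrow> x = \<zero>\<^bsub>A\<^esub>)"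

section \<open>Valuation rings and admissible rings\<close>

text \<open>
  \<open>Q\<close> need not be a field: a valuation ring of \<open>Q\<close> is a proper subring whose complement is
  multiplicatively closed.
\<close>

definition valuation_rings :: "('a, 'b) ring_scheme \<Rightarrow> 'a set \<Rightarrow> 'a set set" where
  "valuation_rings Q R =
    {V. subcring V Q \<and> V \<noteq> carrier Q \<and> R \<subseteq> V \<and>
        (\<forall>x \<in> carrier Q - V. \<forall>y \<in> carrier Q - V. x \<otimes>\<^bsub>Q\<^esub> y \<in> carrier Q - V)}"

text \<open>
  A valuation ring \<open>V\<close> of \<open>Q\<close> may have several maximal ideals (if \<open>Q\<close> is not a field), but only one
  containing a regular element; the residue field is taken with respect to that one. The function
  \<open>C \<mapsto> N + C\<close> on cosets \<open>C\<close> of \<open>M\<close> is the canonical map $R/M \to V/N$.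
\<close>

definition residually_rational :: "('a, 'b) ring_scheme \<Rightarrow> 'a set \<Rightarrow> 'a set \<Rightarrow> bool" where
  "residually_rational Q R M \<longleftrightarrow>
    (\<forall>V \<in> valuation_rings Q R. \<forall>N.
       maximalideal N (Q\<lparr>carrier := V\<rparr>) \<and> N \<inter> regular_elements Q \<noteq> {} \<longrightarrow>
       (\<lambda>C. N <+>\<^bsub>Q\<^esub> C) \<in> ring_iso (Q\<lparr>carrier := R\<rparr> Quot M) (Q\<lparr>carrier := V\<rparr> Quot N))"

definition admissible_ring :: "('a, 'b) ring_scheme \<Rightarrow> 'a set \<Rightarrow> 'a set \<Rightarrow> bool" where
  "admissible_ring Q R M \<longleftrightarrow>
    total_ring_of_fractions Q R \<and>
    local_ring (Q\<lparr>carrier := R\<rparr>) M \<and>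
    noetherian_ring (Q\<lparr>carrier := R\<rparr>) \<and>
    krull_dim (Q\<lparr>carrier := R\<rparr>) = 1 \<and>
    cohen_macaulay (Q\<lparr>carrier := R\<rparr>) M \<and>
    reduced_ring (adic_completion (Q\<lparr>carrier := R\<rparr>) M) \<and>
    residually_rational Q R M \<and>
    valuation_rings Q R \<lesssim> carrier (Q\<lparr>carrier := R\<rparr> Quot M)"

text \<open>Normalized discrete valuations $Q \to \mathbb{Z} \cup \{\infty\}$; the constructor \<open>Minf\<close> is not attained.\<close>

definition discrete_valuation :: "('a, 'b) ring_scheme \<Rightarrow> ('a \<Rightarrow> int extended) \<Rightarrow> bool" where
  "discrete_valuation Q w \<longleftrightarrow>
    w ` carrier Q = insert Pinf (range Fin) \<and>
    (\<forall>x \<in> carrier Q. \<forall>y \<in> carrier Q. w (x \<otimes>\<^bsub>Q\<^esub> y) = w x + w y) \<and>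
    (\<forall>x \<in> carrier Q. \<forall>y \<in> carrier Q. min (w x) (w y) \<le> w (x \<oplus>\<^bsub>Q\<^esub> y))"

text \<open>
  \<open>v\<close> lists, without repetition, the valuations associated with all valuation rings of \<open>Q\<close> over \<open>R\<close>.
  In particular \<open>CARD('n)\<close> is the number of these valuation rings.
\<close>

definition associated_valuations ::
  "('a, 'b) ring_scheme \<Rightarrow> 'a set \<Rightarrow> ('n::finite \<Rightarrow> 'a \<Rightarrow> int extended) \<Rightarrow> bool" where
  "associated_valuations Q R v \<longleftrightarrow>
    (\<forall>i. discrete_valuation Q (v i)) \<and>
    bij_betw (\<lambda>i. {x \<in> carrier Q. 0 \<le> v i x}) UNIV (valuation_rings Q R)"

section \<open>Fractional ideals\<close>

definition fractional_ideal :: "('a, 'b) ring_scheme \<Rightarrow> 'a set \<Rightarrow> 'a set \<Rightarrow> bool" where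
  "fractional_ideal Q R I \<longleftrightarrow>
    additive_subgroup I Q \<and> (\<forall>a \<in> R. \<forall>x \<in> I. a \<otimes>\<^bsub>Q\<^esub> x \<in> I) \<and>
    (\<exists>d \<in> regular_elements (Q\<lparr>carrier := R\<rparr>). \<forall>x \<in> I. d \<otimes>\<^bsub>Q\<^esub> x \<in> R)"

definition regular_fractional_ideal :: "('a, 'b) ring_scheme \<Rightarrow> 'a set \<Rightarrow> 'a set \<Rightarrow> bool" where
  "regular_fractional_ideal Q R I \<longleftrightarrow> fractional_ideal Q R I \<and> I \<inter> regular_elements Q \<noteq> {}"

definition ideal_quotient :: "('a, 'b) ring_scheme \<Rightarrow> 'a set \<Rightarrow> 'a set \<Rightarrow> 'a set" where
  "ideal_quotient Q J I = {x \<in> carrier Q. \<forall>y \<in> I. x \<otimes>\<^bsub>Q\<^esub> y \<in> J}"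

definition canonical_ideal :: "('a, 'b) ring_scheme \<Rightarrow> 'a set \<Rightarrow> 'a set \<Rightarrow> bool" where
  "canonical_ideal Q R J \<longleftrightarrow>
    regular_fractional_ideal Q R J \<and>
    (\<forall>I. regular_fractional_ideal Q R I \<longrightarrow> ideal_quotient Q J (ideal_quotient Q J I) = I)"

section \<open>Value sets\<close>

text \<open>Regular elements of \<open>Q\<close> have finite values.\<close>

definition value_vector :: "('n::finite \<Rightarrow> 'a \<Rightarrow> int extended) \<Rightarrow> 'a \<Rightarrow> int ^ 'n" where
  "value_vector v h = (\<chi> i. THE n. v i h = Fin n)"

definition value_set ::
  "('a, 'b) ring_scheme \<Rightarrow> ('n::finite \<Rightarrow> 'a \<Rightarrow> int extended) \<Rightarrow> 'a set \<Rightarrow> (int ^ 'n) set" where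
  "value_set Q v I = value_vector v ` (I \<inter> regular_elements Q)"

definition conductor :: "(int ^ 'n::finite) set \<Rightarrow> int ^ 'n" where
  "conductor E = (LEAST \<gamma>. \<gamma> \<in> E \<and> {\<gamma> + \<beta> | \<beta>. 0 \<le> \<beta>} \<subseteq> E)"

definition frobenius_vector :: "(int ^ 'n::finite) set \<Rightarrow> int ^ 'n" where
  "frobenius_vector E = conductor E - 1"

definition fiber :: "'n set \<Rightarrow> (int ^ 'n::finite) set \<Rightarrow> int ^ 'n \<Rightarrow> (int ^ 'n) set" where
  "fiber K E \<alpha> = {\<beta> \<in> E. (\<forall>k \<in> K. \<beta> $ k = \<alpha> $ k) \<and> (\<forall>i. i \<notin> K \<longrightarrow> \<beta> $ i > \<alpha> $ i)}"

definition fibers :: "(int ^ 'n::finite) set \<Rightarrow> int ^ 'n \<Rightarrow> (int ^ 'n) set" where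
  "fibers E \<alpha> = (\<Union>i. fiber {i} E \<alpha>)"

definition p_number :: "(int ^ 'n::finite) set \<Rightarrow> int ^ 'n \<Rightarrow> nat" where
  "p_number E \<alpha> =
    Max {n \<in> {0..CARD('n)}. \<forall>K. K \<noteq> {} \<and> card K \<le> n \<longrightarrow> fiber K E \<alpha> = {}}"

definition q_number :: "(int ^ 'n::finite) set \<Rightarrow> int ^ 'n \<Rightarrow> nat" where
  "q_number E \<alpha> =
    Min {n \<in> {1..CARD('n) + 1}. \<forall>K. K \<noteq> {} \<and> card K \<ge> n \<longrightarrow> fiber K E \<alpha> \<noteq> {}}"

definition maximal_point :: "(int ^ 'n::finite) set \<Rightarrow> int ^ 'n \<Rightarrow> bool" where
  "maximal_point E \<alpha> \<longleftrightarrow> \<alpha> \<in> E \<and> fibers E \<alpha> = {}"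

text \<open>Types are pairs of integers, so that $r + 1 - q$ and $r + 1 - p$ involve no truncation.\<close>

definition maximal_point_of_type :: "(int ^ 'n::finite) set \<Rightarrow> int ^ 'n \<Rightarrow> int \<times> int \<Rightarrow> bool" where
  "maximal_point_of_type E \<alpha> = (\<lambda>(p, q).
    maximal_point E \<alpha> \<and>
    p = int (p_number E \<alpha>) \<and> p \<ge> 1 \<and>
    q = int (q_number E \<alpha>) \<and> q \<le> int CARD('n))"

end

theory Submission
  imports Defs
begin

text \<open>
  Write \<open>V(a)\<close> for the set of \<open>x \<in> Q\<close> with \<open>v\<^sub>i(x) \<ge> a\<^sub>i\<close> for all \<open>i\<close>, and \<open>c\<close> for the conductor of
  \<open>E(J)\<close>. Because \<open>J : V(a) \<subseteq> V(c - a)\<close> and \<open>J\<close> is reflexive, \<open>J : (I \<inter> V(a)) \<subseteq> (J : I) + V(c - a)\<close>. So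
  for every \<open>i\<close> and every \<open>A\<close> with \<open>i \<notin> A\<close> exactly one of the following holds: \<open>I\<close> has an element with value
  \<open>\<alpha>\<^sub>i\<close> at \<open>i\<close>, greater than \<open>\<alpha>\<close> on \<open>A\<close> and at least \<open>\<alpha>\<close> elsewhere; or \<open>J : I\<close> has an element with value
  \<open>\<beta>\<^sub>i\<close> at \<open>i\<close>, greater than \<open>\<beta>\<close> outside \<open>A \<union> {i}\<close> and at least \<open>\<beta>\<close> on \<open>A\<close>, where \<open>\<beta> = c - 1 - \<alpha>\<close>. The rest is
  combinatorics of fibers, using that the sets \<open>K\<close> with nonempty fiber are closed under union because
  the residue field is large.

  The main input is that \<open>R\<close> contains some \<open>V(a)\<close>. Fix a regular \<open>t \<in> M\<close>. By Samuel's theorem \<open>x \<in> V(0)\<close>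
  is integral over \<open>R\<close>, and a length count bounds the degree of the equation by a constant that does not
  depend on \<open>x\<close>. If the ideals \<open>R \<inter> V(k)\<close> were not eventually inside \<open>t R\<close>, a compactness argument would give a
  nonzero element of the completion that is congruent modulo \<open>t\<^sup>n\<close> to some \<open>w \<in> t\<^sup>n V(0)\<close>, for every \<open>n\<close>. A fixed
  power of every such \<open>w\<close> lies in \<open>t\<^sup>n R\<close>, so that element would be nilpotent.
\<close>

section \<open>Integrality and valuation rings\<close>

text \<open>\<open>Q\<close> need not be a field, so \<open>v i\<close> can be \<open>Pinf\<close>
  on nonzero elements, and an element of finite value at one place is invertible only modulo
  elements of infinite value there. That regular means finite value at every place is therefore
  available only after the conductor has been found. The constant bounding the degrees is a bound
  \<open>e\<close> for the length of \<open>R/tR\<close>: for \<open>F = R[x]\<close> the module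
  \<open>F/tF\<close> has length at most \<open>e\<close>. Uniformity matters because the elements
  \<open>w/t^n\<close> change with \<open>n\<close>, whereas nilpotency in the completion asks for
  one exponent that serves all \<open>n\<close>. For fibers, the two alternatives exclude each other
  because no element of \<open>J\<close> has value \<open>c_i - 1\<close> at \<open>i\<close> and at
  least \<open>c_j\<close> at all other \<open>j\<close>; one of them holds because reflexivity
  makes \<open>J : _\<close> turn intersections into sums, so that a test element splits into a part
  in \<open>J : I\<close> and a part of large value. The bound on the residue field acts as a
  pigeonhole: at most \<open>r - 1\<close> places each forbid one of \<open>r\<close> residue
  classes.\<close>

context cring
begin

text \<open>Closure under negation comes from multiplication by \<open>-1\<close> once
  \<open>A\<close> is a subring (\<open>submodule_minus\<close>).\<close>

definition submodule_over :: "'a set \<Rightarrow> 'a set \<Rightarrow> bool" where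
  "submodule_over A W \<longleftrightarrow> W \<subseteq> carrier R \<and> \<zero> \<in> W \<and> (\<forall>x\<in>W. \<forall>y\<in>W. x \<oplus> y \<in> W) \<and>
    (\<forall>a\<in>A. \<forall>x\<in>W. a \<otimes> x \<in> W)"

lemma submodule_overI:
  assumes "W \<subseteq> carrier R" "\<zero> \<in> W" "\<And>x y. x \<in> W \<Longrightarrow> y \<in> W \<Longrightarrow> x \<oplus> y \<in> W"
    "\<And>a x. a \<in> A \<Longrightarrow> x \<in> W \<Longrightarrow> a \<otimes> x \<in> W"
  shows "submodule_over A W"
  using assms by (auto simp: submodule_over_def)

lemma submodule_overD:
  assumes "submodule_over A W"
  shows "W \<subseteq> carrier R" "\<zero> \<in> W" "\<And>x y. x \<in> W \<Longrightarrow> y \<in> W \<Longrightarrow> x \<oplus> y \<in> W"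
    "\<And>a x. a \<in> A \<Longrightarrow> x \<in> W \<Longrightarrow> a \<otimes> x \<in> W" "\<And>x. x \<in> W \<Longrightarrow> x \<in> carrier R"
  using assms by (auto simp: submodule_over_def)

text \<open>The span is built one term at a time. Each element involves finitely many scalars and
  generators, so membership descends from the union of a chain to a single member by
  induction.\<close>

inductive_set lspan :: "'a set \<Rightarrow> 'a set \<Rightarrow> 'a set" for A G where
  zero: "\<zero> \<in> lspan A G"
| step: "a \<in> A \<Longrightarrow> g \<in> G \<Longrightarrow> y \<in> lspan A G \<Longrightarrow> a \<otimes> g \<oplus> y \<in> lspan A G"

lemma lspan_mono:
  assumes "A \<subseteq> B" "G \<subseteq> H"
  shows "lspan A G \<subseteq> lspan B H"
proof
  fix x assume "x \<in> lspan A G"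
  then show "x \<in> lspan B H"
    by induction (use assms in \<open>auto intro: lspan.intros\<close>)
qed

lemma lspan_submodule:
  assumes A: "subcring A R" and G: "G \<subseteq> carrier R"
  shows "submodule_over A (lspan A G)"
proof -
  have AR: "A \<subseteq> carrier R" using subcringE(1)[OF A] .
  have sub: "x \<in> carrier R" if "x \<in> lspan A G" for x
    using that by induction (use AR G in auto)
  have add: "x \<oplus> y \<in> lspan A G" if "x \<in> lspan A G" "y \<in> lspan A G" for x y
    using that
  proof induction
    case zero
    then show ?case using sub by simp
  next
    case (step a g z)
    then have "(a \<otimes> g \<oplus> z) \<oplus> y = a \<otimes> g \<oplus> (z \<oplus> y)"
      using sub AR G by (intro a_assoc) auto
    then show ?case using step by (auto intro: lspan.step)
  qed
  have smult: "b \<otimes> x \<in> lspan A G" if "b \<in> A" "x \<in> lspan A G" for b x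
    using that(2)
  proof induction
    case zero
    then show ?case using that AR lspan.zero by auto
  next
    case (step a g z)
    then have "b \<otimes> (a \<otimes> g \<oplus> z) = (b \<otimes> a) \<otimes> g \<oplus> b \<otimes> z"
      using sub AR G that by (simp add: r_distr m_assoc subset_iff)
    then show ?case using step that subcringE(6)[OF A] by (auto intro: lspan.step)
  qed
  show ?thesis
    by (rule submodule_overI) (use sub add smult lspan.zero in auto)
qed

lemma lspan_base:
  assumes A: "subcring A R" and G: "G \<subseteq> carrier R" and "g \<in> G"
  shows "g \<in> lspan A G"
  using lspan.step[OF subcringE(3)[OF A] \<open>g \<in> G\<close> lspan.zero] G \<open>g \<in> G\<close> by auto

text \<open>Multiplication by \<open>u\<close> is \<open>A\<close>-linear, so it is enough to test
  generators. Most later statements about products of polynomials in \<open>x\<close> are reduced to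
  monomials this way.\<close>

lemma lspan_mult_left:
  assumes u: "u \<in> carrier R" and A: "A \<subseteq> carrier R" and G: "G \<subseteq> carrier R"
    and W: "submodule_over A W" and prod: "\<And>g. g \<in> G \<Longrightarrow> u \<otimes> g \<in> W" and y: "y \<in> lspan A G"
  shows "u \<otimes> y \<in> W"
proof -
  have "y \<in> carrier R \<and> u \<otimes> y \<in> W" using y
  proof induction
    case zero
    then show ?case using u submodule_overD(2)[OF W] by auto
  next
    case (step a g z)
    moreover have "a \<in> carrier R" "g \<in> carrier R" using step A G by auto
    moreover have "u \<otimes> (a \<otimes> g \<oplus> z) = a \<otimes> (u \<otimes> g) \<oplus> u \<otimes> z"
      using u calculation by algebra
    ultimately show ?case
      using submodule_overD(3,4)[OF W] prod[of g] by auto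
  qed
  then show ?thesis by simp
qed

lemma lspan_least:
  assumes "A \<subseteq> carrier R" "submodule_over A W" "G \<subseteq> W"
  shows "lspan A G \<subseteq> W"
proof
  fix y assume y: "y \<in> lspan A G"
  have G: "G \<subseteq> carrier R" using assms submodule_overD(1) by blast
  have "\<one> \<otimes> y \<in> W"
    by (rule lspan_mult_left[OF _ assms(1) G assms(2) _ y]) (use assms(3) G in \<open>auto simp: subset_iff\<close>)
  moreover have "y \<in> carrier R" using y
    by induction (use assms G in \<open>auto simp: subset_iff\<close>)
  ultimately show "y \<in> W" by simp
qed

lemma lspan_mult:
  assumes A: "subcring A R" and G: "G \<subseteq> carrier R" and H: "H \<subseteq> carrier R"
    and W: "submodule_over A W" and prod: "\<And>g h. g \<in> G \<Longrightarrow> h \<in> H \<Longrightarrow> g \<otimes> h \<in> W"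
    and x: "x \<in> lspan A G" and y: "y \<in> lspan A H"
  shows "x \<otimes> y \<in> W"
proof -
  have AR: "A \<subseteq> carrier R" using subcringE(1)[OF A] .
  note car = submodule_overD(5)[OF lspan_submodule[OF A G]] submodule_overD(5)[OF lspan_submodule[OF A H]]
  have "g \<otimes> y \<in> W" if "g \<in> G" for g
    by (rule lspan_mult_left[OF _ AR H W _ y]) (use that G prod in auto)
  then have "y \<otimes> x \<in> W"
    by (intro lspan_mult_left[OF _ AR G W _ x]) (use G car y m_comm in auto)
  then show ?thesis using car x y m_comm by auto
qed

lemma lspan_Union_chain:
  assumes "subset.chain S C" "C \<noteq> {}" "x \<in> lspan (\<Union>C) G"
  shows "\<exists>A\<in>C. x \<in> lspan A G"
  using assms(3)
proof induction
  case zero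
  then show ?case using assms(2) by (auto intro: lspan.zero)
next
  case (step a g y)
  then obtain A B where AB: "a \<in> A" "A \<in> C" "y \<in> lspan B G" "B \<in> C" by auto
  then consider "A \<subseteq> B" | "B \<subseteq> A" using assms(1) by (meson subset_chain_def)
  then show ?case
    by cases (use AB step lspan_mono[of A B G G] lspan_mono[of B A G G] in \<open>blast intro: lspan.step\<close>)+
qed

lemma lspan_Union_mono:
  fixes H :: "nat \<Rightarrow> 'a set"
  assumes "mono H" "x \<in> lspan A (\<Union>d. H d)"
  shows "\<exists>d. x \<in> lspan A (H d)"
  using assms(2)
proof induction
  case zero
  then show ?case by (auto intro: lspan.zero)
next
  case (step a g y)
  then obtain d e where *: "g \<in> H d" "y \<in> lspan A (H e)" by auto
  have "H d \<subseteq> H (max d e)" "H e \<subseteq> H (max d e)" using assms(1) by (simp_all add: monoD)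
  then have "a \<otimes> g \<oplus> y \<in> lspan A (H (max d e))"
    using * step lspan_mono[of A A "H e" "H (max d e)"] by (blast intro: lspan.step)
  then show ?case ..
qed

lemma finite_lspan_Union_mono:
  fixes H :: "nat \<Rightarrow> 'a set"
  assumes "mono H" "finite Y" "Y \<subseteq> lspan A (\<Union>d. H d)"
  shows "\<exists>d. Y \<subseteq> lspan A (H d)"
proof -
  have "\<forall>y\<in>Y. \<exists>d. y \<in> lspan A (H d)" using assms lspan_Union_mono by blast
  then obtain d where d: "\<And>y. y \<in> Y \<Longrightarrow> y \<in> lspan A (H (d y))" by metis
  define D where "D = Max (insert 0 (d ` Y))"
  have "H (d y) \<subseteq> H D" if "y \<in> Y" for y
    using assms(1,2) that by (auto simp: D_def intro!: monoD[OF assms(1)])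
  then have "Y \<subseteq> lspan A (H D)" using d lspan_mono[of A A] by blast
  then show ?thesis ..
qed

definition adjoin :: "'a set \<Rightarrow> 'a \<Rightarrow> 'a set" where
  "adjoin A a = lspan A (range (\<lambda>j::nat. a [^] j))"

lemma adjoin_subcring:
  assumes A: "subcring A R" and a: "a \<in> carrier R"
  shows "subcring (adjoin A a) R" "A \<subseteq> adjoin A a" "a \<in> adjoin A a"
proof -
  let ?G = "range (\<lambda>j::nat. a [^] j)"
  have G: "?G \<subseteq> carrier R" using a by auto
  note S = lspan_submodule[OF A G] and base = lspan_base[OF A G]
  have one: "\<one> \<in> adjoin A a" using base[OF rangeI[of _ 0]] by (simp add: adjoin_def)
  show sub: "A \<subseteq> adjoin A a"
  proof
    fix x assume "x \<in> A"
    then show "x \<in> adjoin A a"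
      using submodule_overD(4)[OF S] one subcringE(1)[OF A] by (force simp: adjoin_def)
  qed
  show "a \<in> adjoin A a"
    using base[OF rangeI[of _ 1]] a unfolding adjoin_def by simp
  have mult: "x \<otimes> y \<in> adjoin A a" if "x \<in> adjoin A a" "y \<in> adjoin A a" for x y
    using that unfolding adjoin_def
  proof (rule lspan_mult[OF A G G S, rotated])
    fix g h assume "g \<in> ?G" "h \<in> ?G"
    then obtain i j :: nat where "g = a [^] i" "h = a [^] j" by auto
    then have "g \<otimes> h = a [^] (i + j)" using a by (simp add: nat_pow_mult)
    then show "g \<otimes> h \<in> lspan A ?G" using base by auto
  qed
  have neg: "\<ominus> x \<in> adjoin A a" if x: "x \<in> adjoin A a" for x
  proof -
    have xc: "x \<in> carrier R" using x submodule_overD(5)[OF S] unfolding adjoin_def by auto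
    have "\<ominus> \<one> \<in> A" using subcringE(3,5)[OF A] by auto
    moreover have "\<ominus> x = (\<ominus> \<one>) \<otimes> x" using xc by algebra
    ultimately show ?thesis using x submodule_overD(4)[OF S] unfolding adjoin_def by auto
  qed
  show "subcring (adjoin A a) R"
    by (rule subcringI', rule subringI)
      (use submodule_overD[OF S] one mult neg in \<open>auto simp: adjoin_def\<close>)
qed

text \<open>Integrality by a finitely generated module that contains \<open>\<one>\<close> and is
  mapped to itself by \<open>x\<close>, instead of by a monic equation. The finite generating sets
  can be merged, restricted to a member of a chain, and cleared of denominators all at once.\<close>

definition integral_over :: "'a set \<Rightarrow> 'a \<Rightarrow> bool" where
  "integral_over A x \<longleftrightarrow> (\<exists>G. finite G \<and> G \<subseteq> carrier R \<and> \<one> \<in> lspan A G \<and>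
     (\<forall>g\<in>G. x \<otimes> g \<in> lspan A G))"

lemma integral_over_self:
  assumes A: "subcring A R" and x: "x \<in> A"
  shows "integral_over A x"
proof -
  have "\<one> \<in> lspan A {\<one>}" by (rule lspan_base[OF A]) auto
  moreover have "x \<otimes> \<one> \<in> lspan A {\<one>}"
    using submodule_overD(4)[OF lspan_submodule[OF A], of "{\<one>}"] calculation x by auto
  ultimately show ?thesis unfolding integral_over_def by (intro exI[of _ "{\<one>}"]) auto
qed

text \<open>A witness consists of finitely many relations, each over some member of the chain; the
  largest of these members carries all of them. This gives the upper bounds for Zorn's lemma
  below.\<close>

lemma integral_over_Union_chain:
  assumes C: "subset.chain S C" "C \<noteq> {}" and x: "integral_over (\<Union>C) x"
  shows "\<exists>A\<in>C. integral_over A x"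
proof -
  obtain G where G: "finite G" "G \<subseteq> carrier R" "\<one> \<in> lspan (\<Union>C) G"
    "\<forall>g\<in>G. x \<otimes> g \<in> lspan (\<Union>C) G"
    using x unfolding integral_over_def by auto
  define Y where "Y = insert \<one> ((\<otimes>) x ` G)"
  have "\<forall>y\<in>Y. \<exists>A\<in>C. y \<in> lspan A G"
    using G lspan_Union_chain[OF C] unfolding Y_def by auto
  then obtain f where f: "\<And>y. y \<in> Y \<Longrightarrow> f y \<in> C" "\<And>y. y \<in> Y \<Longrightarrow> y \<in> lspan (f y) G" by metis
  have "finite (f ` Y)" "f ` Y \<noteq> {}" using G by (auto simp: Y_def)
  moreover have "subset.chain S (f ` Y)"
    using C f(1) by (auto simp: subset_chain_def image_subset_iff)
  ultimately have U: "\<Union>(f ` Y) \<in> f ` Y" by (rule Union_in_chain)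
  have "Y \<subseteq> lspan (\<Union>(f ` Y)) G"
    using f(2) lspan_mono[of _ "\<Union>(f ` Y)" G G] by blast
  then have "integral_over (\<Union>(f ` Y)) x"
    using G unfolding integral_over_def Y_def by (intro exI[of _ G]) auto
  then show ?thesis using U f(1) by (metis imageE)
qed


text \<open>
  Products \<open>a\<^sup>j \<otimes> b\<^sup>k\<close> collapse to a single power of \<open>a\<close> or of \<open>b\<close>, because \<open>a \<otimes> b\<close> is a scalar. So
  generators for \<open>A[a]\<close> and for \<open>A[b]\<close> combine to finitely many generators over \<open>A\<close>.
\<close>

lemma integral_over_adjoin_both:
  assumes A: "subcring A R" and a: "a \<in> carrier R" and b: "b \<in> carrier R" and ab: "a \<otimes> b \<in> A"
    and x: "x \<in> carrier R" and xa: "integral_over (adjoin A a) x"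
    and xb: "integral_over (adjoin A b) x"
  shows "integral_over A x"
proof -
  have AR: "A \<subseteq> carrier R" using subcringE(1)[OF A] .
  define P where "P u G d = {u [^] j \<otimes> g | j g. j \<le> d \<and> g \<in> G}" for u G and d :: nat
  have generators: "\<exists>G d. finite G \<and> G \<subseteq> carrier R \<and> \<one> \<in> lspan A (P u G d) \<and>
      (\<forall>g\<in>G. x \<otimes> g \<in> lspan A (P u G d))"
    if u: "u \<in> carrier R" and xu: "integral_over (adjoin A u) x" for u
  proof -
    obtain G where G: "finite G" "G \<subseteq> carrier R" "\<one> \<in> lspan (adjoin A u) G"
      "\<forall>g\<in>G. x \<otimes> g \<in> lspan (adjoin A u) G"
      using xu unfolding integral_over_def by auto
    have PR: "(\<Union>d. P u G d) \<subseteq> carrier R" using G(2) u by (auto simp: P_def)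
    note S = lspan_submodule[OF A PR]
    have "y \<in> lspan A (\<Union>d. P u G d)" if "y \<in> lspan (adjoin A u) G" for y
      using that
    proof induction
      case zero
      then show ?case by (rule lspan.zero)
    next
      case (step v g y)
      have "v \<otimes> g \<in> lspan A (\<Union>d. P u G d)"
      proof (rule lspan_mult[OF A _ _ S])
        show "v \<in> lspan A (range (\<lambda>j::nat. u [^] j))" using step by (simp add: adjoin_def)
        show "g \<in> lspan A {g}" using G(2) step by (intro lspan_base[OF A]) auto
        show "h \<otimes> g' \<in> lspan A (\<Union>d. P u G d)"
          if h: "h \<in> range (\<lambda>j::nat. u [^] j)" and "g' \<in> {g}" for h g'
        proof (rule lspan_base[OF A PR])
          show "h \<otimes> g' \<in> (\<Union>d. P u G d)" using that step by (auto simp: P_def)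
        qed
      qed (use u G(2) step in auto)
      then show ?case using submodule_overD(3)[OF S] step by auto
    qed
    then have "insert \<one> ((\<otimes>) x ` G) \<subseteq> lspan A (\<Union>d. P u G d)" using G by auto
    moreover have "mono (P u G)" by (rule monoI) (auto simp: P_def intro: order_trans)
    ultimately obtain d where "insert \<one> ((\<otimes>) x ` G) \<subseteq> lspan A (P u G d)"
      using finite_lspan_Union_mono[of "P u G" "insert \<one> ((\<otimes>) x ` G)" A] G(1) by auto
    then show ?thesis using G by (intro exI[of _ G] exI[of _ d]) auto
  qed
  obtain G d where G: "finite G" "G \<subseteq> carrier R" "\<one> \<in> lspan A (P a G d)"
    "\<And>g. g \<in> G \<Longrightarrow> x \<otimes> g \<in> lspan A (P a G d)"
    using generators[OF a xa] by blast
  obtain H e where H: "finite H" "H \<subseteq> carrier R" "\<one> \<in> lspan A (P b H e)"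
    "\<And>h. h \<in> H \<Longrightarrow> x \<otimes> h \<in> lspan A (P b H e)"
    using generators[OF b xb] by blast
  define D where "D = max d e"
  define f where "f u = (\<lambda>(j::nat, g, h). u [^] j \<otimes> (g \<otimes> h))" for u
  \<comment> \<open>Pure powers of \<open>a\<close> or of \<open>b\<close> up to a common degree
    suffice: a mixed product loses the scalar \<open>(a \<otimes> b)^min j k\<close> and keeps an
    exponent at most \<open>D\<close>.\<close>
  define T where "T = f a ` ({..D} \<times> G \<times> H) \<union> f b ` ({..D} \<times> G \<times> H)"
  have T: "finite T" "T \<subseteq> carrier R"
    using G(1,2) H(1,2) a b by (auto simp: T_def f_def subset_iff)
  note S = lspan_submodule[OF A T(2)] and base = lspan_base[OF A T(2)]
  have PR: "P a G d \<subseteq> carrier R" "P b H e \<subseteq> carrier R"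
    using G(2) H(2) a b by (auto simp: P_def)
  have inT: "u [^] j \<otimes> (g \<otimes> h) \<in> lspan A T"
    if "u = a \<or> u = b" "j \<le> D" "g \<in> G" "h \<in> H" for u j g h
    using that by (intro base) (force simp: T_def f_def)
  have c: "(a \<otimes> b) [^] n \<in> A" for n :: nat
    by (induction n) (use subcringE(3,6)[OF A] ab in auto)
  have collapse: "a [^] j \<otimes> b [^] k \<otimes> (g \<otimes> h) \<in> lspan A T"
    if jk: "j \<le> D" "k \<le> D" and gh: "g \<in> G" "h \<in> H" for j k :: nat and g h
  proof (cases "j \<le> k")
    case True
    then have "b [^] k = b [^] j \<otimes> b [^] (k - j)" using b by (simp add: nat_pow_mult)
    then have "a [^] j \<otimes> b [^] k = (a \<otimes> b) [^] j \<otimes> b [^] (k - j)"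
      using a b by (simp add: nat_pow_distrib m_assoc)
    moreover have "b [^] (k - j) \<otimes> (g \<otimes> h) \<in> lspan A T"
      by (rule inT) (use jk gh in auto)
    ultimately show ?thesis
      using submodule_overD(4)[OF S c[of j]] a b gh G(2) H(2) by (simp add: m_assoc subset_iff)
  next
    case False
    then have "a [^] j = a [^] (j - k) \<otimes> a [^] k" using a by (simp add: nat_pow_mult)
    then have "a [^] j \<otimes> b [^] k = (a \<otimes> b) [^] k \<otimes> a [^] (j - k)"
      using a b by (simp add: nat_pow_distrib m_ac)
    moreover have "a [^] (j - k) \<otimes> (g \<otimes> h) \<in> lspan A T"
      by (rule inT) (use jk gh in auto)
    ultimately show ?thesis
      using submodule_overD(4)[OF S c[of k]] a b gh G(2) H(2) by (simp add: m_assoc subset_iff)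
  qed
  have "\<one> \<otimes> \<one> \<in> lspan A T"
  proof (rule lspan_mult[OF A PR S _ G(3) H(3)])
    fix p q assume "p \<in> P a G d" "q \<in> P b H e"
    then obtain j k :: nat and g h where *: "p = a [^] j \<otimes> g" "q = b [^] k \<otimes> h"
      "j \<le> d" "k \<le> e" "g \<in> G" "h \<in> H" by (auto simp: P_def)
    then have "g \<in> carrier R" "h \<in> carrier R" using G(2) H(2) by auto
    then have "p \<otimes> q = a [^] j \<otimes> b [^] k \<otimes> (g \<otimes> h)" using * a b by (simp add: m_ac)
    then show "p \<otimes> q \<in> lspan A T" using collapse[of j k g h] * by (simp add: D_def)
  qed
  then have one: "\<one> \<in> lspan A T" by simp
  have "x \<otimes> t \<in> lspan A T" if tT: "t \<in> T" for t
  proof -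
    consider (a) j g h where "t = a [^] j \<otimes> (g \<otimes> h)" "j \<le> D" "g \<in> G" "h \<in> H"
      | (b) k g h where "t = b [^] k \<otimes> (g \<otimes> h)" "k \<le> D" "g \<in> G" "h \<in> H"
      using tT by (auto simp: T_def f_def)
    then show ?thesis
    proof cases
      case a: (a j g h)
      then have gh: "g \<in> carrier R" "h \<in> carrier R" using G(2) H(2) by auto
      \<comment> \<open>\<open>x\<close> is moved to \<open>h\<close>, the generator over
        \<open>A[b]\<close>: this creates powers of \<open>b\<close>, which cancel against
        \<open>a^j\<close>. Moved to \<open>g\<close> it would create further powers of
        \<open>a\<close>, possibly beyond the degree bound.\<close>
      have "(a [^] j \<otimes> g) \<otimes> (x \<otimes> h) \<in> lspan A T"
      proof (rule lspan_mult_left[OF _ AR PR(2) S _ H(4)[OF a(4)]])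
        fix p assume "p \<in> P b H e"
        then obtain k :: nat and h' where *: "p = b [^] k \<otimes> h'" "k \<le> e" "h' \<in> H" by (auto simp: P_def)
        then have "h' \<in> carrier R" using H(2) by auto
        then have "a [^] j \<otimes> g \<otimes> p = a [^] j \<otimes> b [^] k \<otimes> (g \<otimes> h')"
          using * \<open>a \<in> carrier R\<close> b gh by (simp add: m_ac)
        then show "a [^] j \<otimes> g \<otimes> p \<in> lspan A T" using collapse[of j k g h'] * a by (simp add: D_def)
      qed (use gh \<open>a \<in> carrier R\<close> in auto)
      then show ?thesis using a gh x \<open>a \<in> carrier R\<close> by (simp add: m_ac)
    next
      case b: (b k g h)
      then have gh: "g \<in> carrier R" "h \<in> carrier R" using G(2) H(2) by auto
      have "(b [^] k \<otimes> h) \<otimes> (x \<otimes> g) \<in> lspan A T"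
      proof (rule lspan_mult_left[OF _ AR PR(1) S _ G(4)[OF b(3)]])
        fix p assume "p \<in> P a G d"
        then obtain j :: nat and g' where *: "p = a [^] j \<otimes> g'" "j \<le> d" "g' \<in> G" by (auto simp: P_def)
        then have "g' \<in> carrier R" using G(2) by auto
        then have "b [^] k \<otimes> h \<otimes> p = a [^] j \<otimes> b [^] k \<otimes> (g' \<otimes> h)"
          using * \<open>b \<in> carrier R\<close> a gh by (simp add: m_ac)
        then show "b [^] k \<otimes> h \<otimes> p \<in> lspan A T" using collapse[of j k g' h] * b by (simp add: D_def)
      qed (use gh \<open>b \<in> carrier R\<close> in auto)
      then show ?thesis using b gh x \<open>b \<in> carrier R\<close> by (simp add: m_ac)
    qed
  qed
  then show ?thesis unfolding integral_over_def using T one by (intro exI[of _ T]) auto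
qed

lemma subcring_Union_chain:
  assumes "subset.chain {A. subcring A R} C" "C \<noteq> {}"
  shows "subcring (\<Union>C) R"
proof -
  have sub: "subcring A R" if "A \<in> C" for A using assms(1) that by (auto simp: subset_chain_def)
  have both: "\<exists>A\<in>C. x \<in> A \<and> y \<in> A" if "x \<in> \<Union>C" "y \<in> \<Union>C" for x y
  proof -
    obtain B D where BD: "B \<in> C" "D \<in> C" "x \<in> B" "y \<in> D" using \<open>x \<in> \<Union>C\<close> \<open>y \<in> \<Union>C\<close> by auto
    then have "B \<subseteq> D \<or> D \<subseteq> B" using assms(1) unfolding subset_chain_def by blast
    then show ?thesis using BD by blast
  qed
  show ?thesis
  proof (rule subcringI', rule subringI)
    show "\<Union>C \<subseteq> carrier R" using subcringE(1)[OF sub] by auto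
    show "\<one> \<in> \<Union>C" using subcringE(3)[OF sub] assms(2) by auto
    show "\<ominus> x \<in> \<Union>C" if "x \<in> \<Union>C" for x using subcringE(5)[OF sub] that by auto
    show "x \<otimes> y \<in> \<Union>C" if "x \<in> \<Union>C" "y \<in> \<Union>C" for x y
      using both[OF that] subcringE(6)[OF sub] by auto
    show "x \<oplus> y \<in> \<Union>C" if "x \<in> \<Union>C" "y \<in> \<Union>C" for x y
      using both[OF that] subcringE(7)[OF sub] by auto
  qed
qed

text \<open>
  Samuel's theorem: a subring maximal among those over which \<open>x\<close> is not integral has a
  multiplicatively closed complement.
\<close>

lemma exists_valuation_ring:
  assumes A: "subcring A R" and x: "x \<in> carrier R" and not_integral: "\<not> integral_over A x"
  shows "\<exists>V. subcring V R \<and> A \<subseteq> V \<and> x \<notin> V \<and>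
    (\<forall>y\<in>carrier R - V. \<forall>z\<in>carrier R - V. y \<otimes> z \<in> carrier R - V)"
proof -
  define S where "S = {V. subcring V R \<and> A \<subseteq> V \<and> \<not> integral_over V x}"
  have "\<exists>V\<in>S. \<forall>W\<in>S. V \<subseteq> W \<longrightarrow> W = V"
  proof (rule subset_Zorn_nonempty)
    show "S \<noteq> {}" using assms by (auto simp: S_def)
    fix C assume "C \<noteq> {}" and C: "subset.chain S C"
    show "\<Union>C \<in> S"
      unfolding S_def
    proof (intro CollectI conjI)
      show "subcring (\<Union>C) R"
        by (rule subcring_Union_chain) (use C \<open>C \<noteq> {}\<close> in \<open>auto simp: S_def subset_chain_def\<close>)
      show "A \<subseteq> \<Union>C" 
        using C \<open>C \<noteq> {}\<close> unfolding S_def subset_chain_def by blast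
      show "\<not> integral_over (\<Union>C) x"
        using integral_over_Union_chain[OF C \<open>C \<noteq> {}\<close>] C by (auto simp: S_def subset_chain_def)
    qed
  qed
  then obtain V where VS: "V \<in> S" and V_max: "\<forall>W\<in>S. V \<subseteq> W \<longrightarrow> W = V" by (elim bexE)
  have V: "subcring V R" "A \<subseteq> V" "\<not> integral_over V x" using VS by (simp_all add: S_def)
  have max: "W = V" if "subcring W R" "V \<subseteq> W" "\<not> integral_over W x" for W
    using V_max that V(2) by (simp add: S_def)
  \<comment> \<open>By maximality \<open>x\<close> becomes integral as soon as any \<open>y\<close>
    outside \<open>V\<close> is adjoined. If \<open>y\<close> and \<open>z\<close> outside
    \<open>V\<close> had a product inside, the two adjunctions would make \<open>x\<close> integral
    over \<open>V\<close> itself.\<close>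
  have adj: "integral_over (adjoin V y) x" if "y \<in> carrier R - V" for y
    using adjoin_subcring[OF V(1), of y] max[of "adjoin V y"] that by auto
  have "y \<otimes> z \<in> carrier R - V" if "y \<in> carrier R - V" "z \<in> carrier R - V" for y z
    using integral_over_adjoin_both[OF V(1), of y z x] adj[of y] adj[of z] that x V(3) by auto
  moreover have "x \<notin> V" using V integral_over_self by auto
  ultimately show ?thesis using V by auto
qed

end

section \<open>Bounded length and uniform integral equations\<close>

context cring begin

lemma submodule_minus:
  assumes A: "subcring A R" and W: "submodule_over A W" and x: "x \<in> W" and y: "y \<in> W"
  shows "x \<ominus> y \<in> W"
proof -
  have "\<ominus> \<one> \<in> A" using subcringE(3,5)[OF A] by auto
  moreover have "y \<in> carrier R" using submodule_overD(5)[OF W y] .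
  then have "\<ominus> y = (\<ominus> \<one>) \<otimes> y" by algebra
  ultimately have "\<ominus> y \<in> W" using submodule_overD(4)[OF W] y by simp
  then show ?thesis using submodule_overD(3)[OF W x] by (simp add: a_minus_def)
qed

lemma mem_set_add: "z \<in> U <+>\<^bsub>R\<^esub> W \<longleftrightarrow> (\<exists>x\<in>U. \<exists>y\<in>W. z = x \<oplus> y)"
  by (auto simp: set_add_def')

lemma submodule_set_add:
  assumes A: "A \<subseteq> carrier R" and U: "submodule_over A U" and W: "submodule_over A W"
  shows "submodule_over A (U <+>\<^bsub>R\<^esub> W)" "U \<subseteq> U <+>\<^bsub>R\<^esub> W" "W \<subseteq> U <+>\<^bsub>R\<^esub> W"
proof -
  note Uc = submodule_overD(5)[OF U] and Wc = submodule_overD(5)[OF W]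
  show "submodule_over A (U <+>\<^bsub>R\<^esub> W)"
  proof (rule submodule_overI)
    show "U <+>\<^bsub>R\<^esub> W \<subseteq> carrier R" using Uc Wc by (auto simp: mem_set_add)
    have "\<zero> = \<zero> \<oplus> \<zero>" by simp
    then show "\<zero> \<in> U <+>\<^bsub>R\<^esub> W" using submodule_overD(2)[OF U] submodule_overD(2)[OF W] mem_set_add by blast
  next
    fix x y assume "x \<in> U <+>\<^bsub>R\<^esub> W" "y \<in> U <+>\<^bsub>R\<^esub> W"
    then obtain u v w z where *: "x = u \<oplus> w" "y = v \<oplus> z" "u \<in> U" "v \<in> U" "w \<in> W" "z \<in> W"
      by (auto simp: mem_set_add)
    then have c: "u \<in> carrier R" "v \<in> carrier R" "w \<in> carrier R" "z \<in> carrier R" using Uc Wc by auto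
    have "x \<oplus> y = (u \<oplus> v) \<oplus> (w \<oplus> z)" unfolding * using c by algebra
    then show "x \<oplus> y \<in> U <+>\<^bsub>R\<^esub> W"
      using submodule_overD(3)[OF U *(3,4)] submodule_overD(3)[OF W *(5,6)] mem_set_add by blast
  next
    fix a x assume "a \<in> A" "x \<in> U <+>\<^bsub>R\<^esub> W"
    then obtain u w where *: "x = u \<oplus> w" "u \<in> U" "w \<in> W" by (auto simp: mem_set_add)
    then have c: "u \<in> carrier R" "w \<in> carrier R" "a \<in> carrier R" using Uc Wc A \<open>a \<in> A\<close> by auto
    have "a \<otimes> x = a \<otimes> u \<oplus> a \<otimes> w" unfolding * using c by algebra
    then show "a \<otimes> x \<in> U <+>\<^bsub>R\<^esub> W"
      using submodule_overD(4)[OF U \<open>a \<in> A\<close> *(2)] submodule_overD(4)[OF W \<open>a \<in> A\<close> *(3)] mem_set_add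
      by blast
  qed
  show "U \<subseteq> U <+>\<^bsub>R\<^esub> W"
  proof
    fix x assume "x \<in> U"
    then have "x = x \<oplus> \<zero>" using Uc by simp
    then show "x \<in> U <+>\<^bsub>R\<^esub> W" using \<open>x \<in> U\<close> submodule_overD(2)[OF W] mem_set_add by blast
  qed
  show "W \<subseteq> U <+>\<^bsub>R\<^esub> W"
  proof
    fix x assume "x \<in> W"
    then have "x = \<zero> \<oplus> x" using Wc by simp
    then show "x \<in> U <+>\<^bsub>R\<^esub> W" using \<open>x \<in> W\<close> submodule_overD(2)[OF U] mem_set_add by blast
  qed
qed

lemma set_add_least:
  assumes "submodule_over A Z" "U \<subseteq> Z" "W \<subseteq> Z"
  shows "U <+>\<^bsub>R\<^esub> W \<subseteq> Z"
  using submodule_overD(3)[OF assms(1)] assms(2,3) by (auto simp: mem_set_add subset_iff)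

lemma submodule_Int:
  "submodule_over A U \<Longrightarrow> submodule_over A W \<Longrightarrow> submodule_over A (U \<inter> W)"
  unfolding submodule_over_def by blast

lemma submodule_image:
  assumes A: "A \<subseteq> carrier R" and W: "submodule_over A W" and u: "u \<in> carrier R"
  shows "submodule_over A ((\<otimes>) u ` W)"
proof (rule submodule_overI)
  note Wc = submodule_overD(5)[OF W]
  show "(\<otimes>) u ` W \<subseteq> carrier R" using u Wc by auto
  show "\<zero> \<in> (\<otimes>) u ` W" using submodule_overD(2)[OF W] u by (auto simp: image_iff intro!: bexI[of _ \<zero>])
  show "x \<oplus> y \<in> (\<otimes>) u ` W" if xy: "x \<in> (\<otimes>) u ` W" "y \<in> (\<otimes>) u ` W" for x y
  proof -
    obtain x' y' where *: "x' \<in> W" "y' \<in> W" "x = u \<otimes> x'" "y = u \<otimes> y'" using xy by auto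
    then have "x \<oplus> y = u \<otimes> (x' \<oplus> y')" using u Wc by (simp add: r_distr)
    then show ?thesis using submodule_overD(3)[OF W *(1,2)] by auto
  qed
  show "a \<otimes> x \<in> (\<otimes>) u ` W" if ax: "a \<in> A" "x \<in> (\<otimes>) u ` W" for a x
  proof -
    obtain x' where *: "x' \<in> W" "x = u \<otimes> x'" using ax by auto
    then have "a \<otimes> x = u \<otimes> (a \<otimes> x')" using u Wc A ax by (simp add: m_lcomm subset_iff)
    then show ?thesis using submodule_overD(4)[OF W ax(1) *(1)] by auto
  qed
qed

text \<open>The modular law, the source of strictness in counting lengths: \<open>w = u + v\<close>
  gives \<open>v = w - u\<close> in \<open>W \<inter> V = U \<inter> V\<close>.\<close>

lemma submodule_modular:
  assumes A: "subcring A R" and V: "submodule_over A V" and U: "submodule_over A U"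
    and W: "submodule_over A W" and UW: "U \<subseteq> W" and eq: "U \<inter> V = W \<inter> V" "U <+>\<^bsub>R\<^esub> V = W <+>\<^bsub>R\<^esub> V"
  shows "U = W"
proof
  show "W \<subseteq> U"
  proof
    fix w assume w: "w \<in> W"
    have "w \<in> U <+>\<^bsub>R\<^esub> V" using w submodule_set_add(2)[OF subcringE(1)[OF A] W V] eq by auto
    then obtain u v where uv: "u \<in> U" "v \<in> V" "w = u \<oplus> v" by (auto simp: mem_set_add)
    have c: "u \<in> carrier R" "v \<in> carrier R"
      using uv submodule_overD(5)[OF U] submodule_overD(5)[OF V] by auto
    have "v = w \<ominus> u" unfolding uv using c by algebra
    then have "v \<in> W" using submodule_minus[OF A W w] uv(1) UW by auto
    then have "v \<in> U" using uv(2) eq by auto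
    then show "w \<in> U" using uv submodule_overD(3)[OF U] by auto
  qed
qed (rule UW)

text \<open>The length of the module \<open>W/U\<close> is at most \<open>n\<close>, witnessed by a strictly monotone rank.\<close>

definition rank_function :: "'a set \<Rightarrow> 'a set \<Rightarrow> 'a set \<Rightarrow> nat \<Rightarrow> ('a set \<Rightarrow> nat) \<Rightarrow> bool" where
  "rank_function A U W n rk \<longleftrightarrow>
     (\<forall>Y Z. submodule_over A Y \<and> submodule_over A Z \<and> U \<subseteq> Y \<and> Y \<subset> Z \<and> Z \<subseteq> W \<longrightarrow> rk Y < rk Z) \<and>
     (\<forall>Y. submodule_over A Y \<and> U \<subseteq> Y \<and> Y \<subseteq> W \<longrightarrow> rk Y \<le> n)"

definition length_le :: "'a set \<Rightarrow> 'a set \<Rightarrow> 'a set \<Rightarrow> nat \<Rightarrow> bool" where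
  "length_le A U W n \<longleftrightarrow> (\<exists>rk. rank_function A U W n rk)"

lemma rank_functionD:
  assumes "rank_function A U W n rk"
  shows "submodule_over A Y \<Longrightarrow> submodule_over A Z \<Longrightarrow> U \<subseteq> Y \<Longrightarrow> Y \<subset> Z \<Longrightarrow> Z \<subseteq> W \<Longrightarrow> rk Y < rk Z"
    "submodule_over A Y \<Longrightarrow> U \<subseteq> Y \<Longrightarrow> Y \<subseteq> W \<Longrightarrow> rk Y \<le> n"
  using assms by (simp_all add: rank_function_def)

lemma length_leI:
  assumes "\<And>Y Z. submodule_over A Y \<Longrightarrow> submodule_over A Z \<Longrightarrow> U \<subseteq> Y \<Longrightarrow> Y \<subset> Z \<Longrightarrow> Z \<subseteq> W \<Longrightarrow> rk Y < rk Z"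
    "\<And>Y. submodule_over A Y \<Longrightarrow> U \<subseteq> Y \<Longrightarrow> Y \<subseteq> W \<Longrightarrow> rk Y \<le> n"
  shows "length_le A U W n"
proof -
  have "rank_function A U W n rk"
    unfolding rank_function_def by (intro conjI allI impI; elim conjE; (rule assms; assumption))
  then show ?thesis by (auto simp: length_le_def)
qed

text \<open>The rank of \<open>Y\<close> is the sum of the ranks of \<open>Y \<inter> V\<close> and
  \<open>Y + V\<close>. If \<open>Y\<close> grows, neither shrinks, and by the modular law one of
  them grows.\<close>

lemma length_le_trans:
  assumes A: "subcring A R" and V: "submodule_over A V" and UV: "U \<subseteq> V" and VW: "V \<subseteq> W"
    and W: "submodule_over A W" and 1: "length_le A U V m" and 2: "length_le A V W n"
  shows "length_le A U W (m + n)"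
proof -
  note AR = subcringE(1)[OF A]
  obtain f where "rank_function A U V m f" using 1 by (auto simp: length_le_def)
  note f = rank_functionD[OF this]
  obtain g where "rank_function A V W n g" using 2 by (auto simp: length_le_def)
  note g = rank_functionD[OF this]
  have Y: "submodule_over A (Y \<inter> V)" "submodule_over A (Y <+>\<^bsub>R\<^esub> V)" "U \<subseteq> Y \<inter> V" "Y \<inter> V \<subseteq> V"
    "V \<subseteq> Y <+>\<^bsub>R\<^esub> V" "Y <+>\<^bsub>R\<^esub> V \<subseteq> W" if "submodule_over A Y" "U \<subseteq> Y" "Y \<subseteq> W" for Y
    using submodule_Int[OF that(1) V] submodule_set_add[OF AR that(1) V] UV that
      set_add_least[OF W that(3) VW] by auto
  have "f (Y \<inter> V) + g (Y <+>\<^bsub>R\<^esub> V) < f (Z \<inter> V) + g (Z <+>\<^bsub>R\<^esub> V)"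
    if *: "submodule_over A Y" "submodule_over A Z" "U \<subseteq> Y" "Y \<subset> Z" "Z \<subseteq> W" for Y Z
  proof -
    have YW: "Y \<subseteq> W" and UZ: "U \<subseteq> Z" using * by auto
    note Y = Y[OF *(1,3) YW] and Z = Y[OF *(2) UZ *(5)]
    have sub: "Y \<inter> V \<subseteq> Z \<inter> V" "Y <+>\<^bsub>R\<^esub> V \<subseteq> Z <+>\<^bsub>R\<^esub> V"
      using * by (blast, simp add: subset_iff mem_set_add, blast)
    then have le: "f (Y \<inter> V) \<le> f (Z \<inter> V)" "g (Y <+>\<^bsub>R\<^esub> V) \<le> g (Z <+>\<^bsub>R\<^esub> V)"
      using f(1)[OF Y(1) Z(1) Y(3) _ Z(4)] g(1)[OF Y(2) Z(2) Y(5) _ Z(6)]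
      by (metis less_imp_le order_refl psubsetI)+
    have "Y \<inter> V \<noteq> Z \<inter> V \<or> Y <+>\<^bsub>R\<^esub> V \<noteq> Z <+>\<^bsub>R\<^esub> V"
      using submodule_modular[OF A V *(1,2)] * by auto
    then have "f (Y \<inter> V) < f (Z \<inter> V) \<or> g (Y <+>\<^bsub>R\<^esub> V) < g (Z <+>\<^bsub>R\<^esub> V)"
      using f(1)[OF Y(1) Z(1) Y(3) _ Z(4)] g(1)[OF Y(2) Z(2) Y(5) _ Z(6)] sub by blast
    then show ?thesis using le by linarith
  qed
  moreover have "f (Y \<inter> V) + g (Y <+>\<^bsub>R\<^esub> V) \<le> m + n" if *: "submodule_over A Y" "U \<subseteq> Y" "Y \<subseteq> W" for Y
    using f(2)[of "Y \<inter> V"] g(2)[of "Y <+>\<^bsub>R\<^esub> V"] Y[OF *] by (intro add_mono) auto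
  ultimately show ?thesis by (intro length_leI[where rk = "\<lambda>Y. f (Y \<inter> V) + g (Y <+>\<^bsub>R\<^esub> V)"])
qed

lemma Units_cancel:
  assumes "u \<in> Units R" "x \<in> carrier R"
  shows "inv u \<otimes> (u \<otimes> x) = x" "u \<otimes> (inv u \<otimes> x) = x" "(x \<otimes> inv u) \<otimes> u = x"
proof -
  have c: "u \<in> carrier R" "inv u \<in> carrier R" "inv u \<otimes> u = \<one>" "u \<otimes> inv u = \<one>" using assms(1) by auto
  then show "inv u \<otimes> (u \<otimes> x) = x" "u \<otimes> (inv u \<otimes> x) = x"
    using assms(2) by (simp_all add: m_assoc[symmetric] del: Units_l_inv Units_r_inv)
  show "(x \<otimes> inv u) \<otimes> u = x" using m_assoc[OF assms(2) c(2,1)] c(3) assms(2) by simp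
qed

lemma image_mult_inv:
  assumes "u \<in> Units R" "W \<subseteq> carrier R"
  shows "(\<otimes>) (inv u) ` (\<otimes>) u ` W = W"
  using Units_cancel(1)[OF assms(1)] assms(2) by (force simp: image_image image_iff subset_iff)

lemma image_mult_psubset:
  assumes u: "u \<in> Units R" and "Y \<subset> Z" "Z \<subseteq> carrier R"
  shows "(\<otimes>) u ` Y \<subset> (\<otimes>) u ` Z"
proof (rule image_strict_mono)
  show "inj_on ((\<otimes>) u) Z" using assms by (intro inj_onI) (auto simp: subset_iff)
qed (rule assms)

lemma length_le_scale:
  assumes A: "A \<subseteq> carrier R" and u: "u \<in> Units R" and U: "U \<subseteq> carrier R" and W: "W \<subseteq> carrier R"
    and n: "length_le A U W n"
  shows "length_le A ((\<otimes>) u ` U) ((\<otimes>) u ` W) n"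
proof -
  obtain f where "rank_function A U W n f" using n by (auto simp: length_le_def)
  note f = rank_functionD[OF this]
  let ?s = "\<lambda>Y. (\<otimes>) (inv u) ` Y"
  have s: "submodule_over A (?s Y)" if "submodule_over A Y" for Y
    using submodule_image[OF A that, of "inv u"] u by auto
  have sU: "U \<subseteq> ?s Y" if "(\<otimes>) u ` U \<subseteq> Y" for Y
    using image_mono[OF that, of "(\<otimes>) (inv u)"] image_mult_inv[OF u U] by auto
  have sW: "?s Y \<subseteq> W" if "Y \<subseteq> (\<otimes>) u ` W" for Y
    using image_mono[OF that, of "(\<otimes>) (inv u)"] image_mult_inv[OF u W] by auto
  have strict: "?s Y \<subset> ?s Z" if "Y \<subset> Z" "submodule_over A Y" "submodule_over A Z" for Y Z
    by (rule image_mult_psubset[OF Units_inv_Units[OF u] that(1) submodule_overD(1)[OF that(3)]])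
  show ?thesis
  proof (rule length_leI[where rk = "\<lambda>Y. f (?s Y)"])
    show "f (?s Y) < f (?s Z)" if "submodule_over A Y" "submodule_over A Z"
      "(\<otimes>) u ` U \<subseteq> Y" "Y \<subset> Z" "Z \<subseteq> (\<otimes>) u ` W" for Y Z
      by (rule f(1)[OF s[OF that(1)] s[OF that(2)] sU[OF that(3)] strict[OF that(4,1,2)] sW[OF that(5)]])
    show "f (?s Y) \<le> n" if "submodule_over A Y" "(\<otimes>) u ` U \<subseteq> Y" "Y \<subseteq> (\<otimes>) u ` W" for Y
      by (rule f(2)[OF s[OF that(1)] sU[OF that(2)] sW[OF that(3)]])
  qed
qed

lemma submodule_self: "subcring A R \<Longrightarrow> submodule_over A A"
  using subcringE[of A R] by (intro submodule_overI) auto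

lemma image_mult_subset:
  assumes "subcring A R" "u \<in> A" "submodule_over A W"
  shows "(\<otimes>) u ` W \<subseteq> W"
  using assms submodule_overD(4) by auto

lemma subcring_nat_pow:
  assumes "subcring A R" "a \<in> A"
  shows "a [^] (n::nat) \<in> A"
  by (induction n) (use subcringE(3,6)[OF assms(1)] assms(2) in auto)

lemma image_mult_image:
  assumes "u \<in> carrier R" "v \<in> carrier R" "W \<subseteq> carrier R"
  shows "(\<otimes>) u ` (\<otimes>) v ` W = (\<otimes>) (u \<otimes> v) ` W"
  using assms by (auto simp: image_image m_assoc subset_iff intro!: image_cong)

text \<open>The quotients \<open>t^i A / t^(i+1) A\<close> in the filtration of
  \<open>A / t^n A\<close> are all copies of \<open>A / t A\<close>.\<close>

lemma length_le_pow:
  assumes A: "subcring A R" and t: "t \<in> A" "t \<in> Units R" and e: "length_le A ((\<otimes>) t ` A) A e"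
  shows "length_le A ((\<otimes>) (t [^] (n::nat)) ` A) A (n * e)"
proof (induction n)
  case 0
  have "(\<otimes>) \<one> ` A = A" using subcringE(1)[OF A] by (force simp: image_iff)
  then show ?case by (intro length_leI[where rk = "\<lambda>_. 0"]) auto
next
  case (Suc n)
  note AR = subcringE(1)[OF A]
  have tn: "t [^] n \<in> Units R" by (rule Units_pow_closed[OF t(2)])
  have S: "submodule_over A ((\<otimes>) (t [^] n) ` A)"
    using submodule_image[OF AR submodule_self[OF A]] tn by auto
  have "(\<otimes>) (t [^] n) ` (\<otimes>) t ` A = (\<otimes>) (t [^] Suc n) ` A"
    using image_mult_image[of "t [^] n" t A] tn t AR by auto
  then have "length_le A ((\<otimes>) (t [^] Suc n) ` A) ((\<otimes>) (t [^] n) ` A) e"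
    using length_le_scale[OF AR tn _ AR e] t AR by auto
  moreover have "(\<otimes>) (t [^] Suc n) ` A \<subseteq> (\<otimes>) (t [^] n) ` A"
    using \<open>(\<otimes>) (t [^] n) ` (\<otimes>) t ` A = (\<otimes>) (t [^] Suc n) ` A\<close>
      image_mult_subset[OF A t(1) submodule_self[OF A]] by blast
  moreover have "(\<otimes>) (t [^] n) ` A \<subseteq> A"
    using image_mult_subset[OF A subcring_nat_pow[OF A t(1)] submodule_self[OF A]] .
  ultimately show ?case
    using length_le_trans[OF A S _ _ submodule_self[OF A] _ Suc] by (simp add: add.commute)
qed

text \<open>
  The chain repeats in each \<open>t\<^sup>iF/t\<^sup>i\<^sup>+\<^sup>1F\<close>, so \<open>n d\<close> is at most \<open>(n + m) e\<close> for all \<open>n\<close>.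
\<close>

lemma chain_length_le:
  assumes A: "subcring A R" and t: "t \<in> A" "t \<in> Units R" and e: "length_le A ((\<otimes>) t ` A) A e"
    and F: "submodule_over A F" "F \<subseteq> A" "(\<otimes>) (t [^] (m::nat)) ` A \<subseteq> F"
    and L: "\<And>j. submodule_over A (L j)" "\<And>j. (\<otimes>) t ` F \<subseteq> L j" "\<And>j. L j \<subseteq> F"
    and strict: "\<And>j. j < d \<Longrightarrow> L j \<subset> L (Suc j)"
  shows "d \<le> e"
proof -
  note AR = subcringE(1)[OF A]
  \<comment> \<open>With \<open>d \<ge> e + 1\<close> the count below would give
    \<open>n (e + 1) \<le> (n + m) e\<close>, that is \<open>n \<le> m e\<close>, which this choice
    excludes.\<close>
  define n where "n = m * e + 1"
  have tc: "t \<in> carrier R" using t by auto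
  let ?U = "(\<otimes>) (t [^] (n + m)) ` A"
  obtain f where "rank_function A ?U A ((n + m) * e) f"
    using length_le_pow[OF A t e, of "n + m"] by (auto simp: length_le_def)
  note f = rank_functionD[OF this]
  let ?T = "\<lambda>i Y. (\<otimes>) (t [^] (i::nat)) ` Y"
  have sub: "submodule_over A (?T i Y)" if "submodule_over A Y" for i Y
    using submodule_image[OF AR that] tc by auto
  have TA: "?T i Y \<subseteq> A" if "Y \<subseteq> F" for i Y
    using that F(2) image_mult_subset[OF A subcring_nat_pow[OF A t(1)] submodule_self[OF A]] by blast
  \<comment> \<open>Keeps all scaled copies of the chain above \<open>t^(n + m) A\<close>, so that
    one rank function counts them all.\<close>
  have UT: "?U \<subseteq> ?T i F" if "i \<le> n" for i
  proof safe
    fix a assume a: "a \<in> A"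
    have "t [^] (n + m) = t [^] i \<otimes> (t [^] m \<otimes> t [^] (n - i))"
      using tc that by (simp add: nat_pow_mult add.commute)
    then have "t [^] (n + m) \<otimes> a = t [^] i \<otimes> (t [^] m \<otimes> (t [^] (n - i) \<otimes> a))"
      using tc a AR by (simp add: m_assoc subset_iff)
    moreover have "t [^] m \<otimes> (t [^] (n - i) \<otimes> a) \<in> F"
      using F(3) subcringE(6)[OF A subcring_nat_pow[OF A t(1)] a] by blast
    ultimately show "t [^] (n + m) \<otimes> a \<in> ?T i F" by auto
  qed
  have TF: "?T (Suc i) F \<subseteq> ?T i (L j)" for i j
    using image_mono[OF L(2)[of j], of "(\<otimes>) (t [^] i)"] image_mult_image[of "t [^] i" t F]
      tc submodule_overD(1)[OF F(1)] by auto
  have step: "f (?T (Suc i) F) + d \<le> f (?T i F)" if "i < n" for i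
  proof -
    have U: "?U \<subseteq> ?T (Suc i) F" using UT[of "Suc i"] that by simp
    have T_strict: "?T i (L j) \<subset> ?T i (L (Suc j))" if "j < d" for j
      by (rule image_mult_psubset[OF Units_pow_closed[OF t(2)] strict[OF that] submodule_overD(1)[OF L(1)]])
    have "j \<le> d \<Longrightarrow> f (?T (Suc i) F) + j \<le> f (?T i (L j))" for j
    proof (induction j)
      case 0
      have "?T (Suc i) F = ?T i (L 0) \<or> f (?T (Suc i) F) < f (?T i (L 0))"
        using f(1)[OF sub[OF F(1)] sub[OF L(1)] U _ TA[OF L(3)]] TF[of i 0] by blast
      then show ?case by auto
    next
      case (Suc j)
      have "f (?T i (L j)) < f (?T i (L (Suc j)))"
        using Suc.prems U TF[of i j] by (intro f(1) sub L T_strict TA) auto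
      then show ?case using Suc by auto
    qed
    from this[of d] have "f (?T (Suc i) F) + d \<le> f (?T i (L d))" by simp
    also have "\<dots> \<le> f (?T i F)"
    proof (cases "L d = F")
      case False
      then have "?T i (L d) \<subseteq> ?T i F" using L(3) by (intro image_mono)
      then have "?T i (L d) = ?T i F \<or> f (?T i (L d)) < f (?T i F)"
        using f(1)[OF sub[OF L(1)] sub[OF F(1)] _ _ TA] U TF[of i d] by blast
      then show ?thesis by auto
    qed auto
    finally show ?thesis .
  qed
  have "k \<le> n \<Longrightarrow> k * d \<le> f (?T (n - k) F)" for k
  proof (induction k)
    case (Suc k)
    then show ?case using step[of "n - Suc k"] by (auto simp: Suc_diff_Suc)
  qed auto
  from this[of n] have "n * d \<le> f (?T 0 F)" by simp
  also have "\<dots> \<le> (n + m) * e" using UT[of 0] by (intro f(2) sub F TA) auto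
  finally have *: "n * d \<le> n * e + m * e" by (simp add: algebra_simps)
  show ?thesis
  proof (rule ccontr)
    assume "\<not> d \<le> e"
    then have "n * (e + 1) \<le> n * d" by (intro mult_left_mono) auto
    then show False using * by (simp add: n_def algebra_simps)
  qed
qed


text \<open>Put \<open>F = A[x]\<close> and let \<open>L k\<close> be spanned by the powers below
  \<open>k\<close>. Since \<open>F / t F\<close> has length at most \<open>e\<close>, the chain of
  the \<open>L k + t F\<close> stops at some \<open>j \<le> e\<close>, and then
  \<open>F = L j + t F\<close>. Iterating gives \<open>F = L j + t^k F\<close> for every
  \<open>k\<close>, and \<open>t^m F \<subseteq> A\<close> absorbs the rest. The exponent
  \<open>m\<close> clears denominators; the degree \<open>e + 1\<close> is independent of
  it.\<close>

lemma integral_equation_uniform_degree: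
  assumes A: "subcring A R" and t: "t \<in> A" "t \<in> Units R" and e: "length_le A ((\<otimes>) t ` A) A e"
    and x: "x \<in> carrier R" and m: "\<And>j::nat. t [^] (m::nat) \<otimes> x [^] j \<in> A"
  shows "x [^] Suc e \<in> lspan A ((\<lambda>i::nat. x [^] i) ` {..<Suc e})"
proof -
  note AR = subcringE(1)[OF A]
  have tc: "t \<in> carrier R" using t by auto
  define T where "T k W = (\<otimes>) (t [^] (k::nat)) ` W" for k W
  define L where "L k = lspan A ((\<lambda>i::nat. x [^] i) ` {..<k})" for k
  define F where "F = lspan A (range (\<lambda>i::nat. x [^] i))"
  have L: "submodule_over A (L k)" for k unfolding L_def using x by (intro lspan_submodule[OF A]) auto
  have F: "submodule_over A F" unfolding F_def using x by (intro lspan_submodule[OF A]) auto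
  note Lc = submodule_overD(5)[OF L] and Fc = submodule_overD(5)[OF F]
  have T: "submodule_over A (T k W)" if "submodule_over A W" for k W
    unfolding T_def using submodule_image[OF AR that] tc by auto
  have LF: "L k \<subseteq> F" for k unfolding L_def F_def by (rule lspan_mono) auto
  have L_mono: "L k \<subseteq> L l" if "k \<le> l" for k l unfolding L_def using that by (intro lspan_mono) auto
  have xF: "x [^] i \<in> F" for i :: nat unfolding F_def using x by (intro lspan_base[OF A]) auto
  have xL: "x [^] i \<in> L k" if "i < k" for i k :: nat
    unfolding L_def using x that by (intro lspan_base[OF A]) auto
  have AL: "A \<subseteq> L k" if "k > 0" for k
  proof
    fix a assume "a \<in> A"
    then show "a \<in> L k" using submodule_overD(4)[OF L \<open>a \<in> A\<close> xL[OF that]] AR by auto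
  qed
  have TF: "T m F \<subseteq> A"
  proof -
    have "t [^] m \<otimes> y \<in> A" if "y \<in> F" for y
      by (rule lspan_mult_left[OF _ AR _ submodule_self[OF A] _ that[unfolded F_def]]) (use tc x m in auto)
    then show ?thesis by (auto simp: T_def)
  qed
  have "\<exists>j\<le>e. x [^] j \<in> L j <+>\<^bsub>R\<^esub> T 1 F"
  proof (rule ccontr)
    assume neg: "\<not> ?thesis"
    \<comment> \<open>The chain is multiplied by \<open>t^m\<close> so that it lies inside
      \<open>A\<close>, as \<open>chain_length_le\<close> requires.\<close>
    let ?Z = "\<lambda>j. T m (L j) <+>\<^bsub>R\<^esub> (\<otimes>) t ` T m F"
    have tTF: "submodule_over A ((\<otimes>) t ` T m F)" using submodule_image[OF AR T[OF F] tc] .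
    note Z = submodule_set_add[OF AR T[OF L] tTF]
    have "Suc e \<le> e"
    proof (rule chain_length_le[OF A t e T[OF F] TF, where L = ?Z and m = m])
      show "(\<otimes>) (t [^] m) ` A \<subseteq> T m F"
        using AL[of 1] LF[of 1] by (auto simp: T_def)
      show "submodule_over A (?Z j)" "(\<otimes>) t ` T m F \<subseteq> ?Z j" for j by (rule Z)+
      show "?Z j \<subseteq> T m F" for j
        by (rule set_add_least[OF T[OF F] _ image_mult_subset[OF A t(1) T[OF F]]])
          (use LF in \<open>auto simp: T_def\<close>)
      show "?Z j \<subset> ?Z (Suc j)" if "j < Suc e" for j
      proof
        have "T m (L j) \<subseteq> T m (L (Suc j))" using L_mono[of j "Suc j"] by (auto simp: T_def)
        then show "?Z j \<subseteq> ?Z (Suc j)" by (simp add: subset_iff mem_set_add) blast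
        have "t [^] m \<otimes> x [^] j \<in> ?Z (Suc j)"
          using Z(2)[of m "Suc j"] xL[of j "Suc j"] by (auto simp: T_def)
        moreover have "t [^] m \<otimes> x [^] j \<notin> ?Z j"
        proof
          assume "t [^] m \<otimes> x [^] j \<in> ?Z j"
          then obtain y z where yz: "y \<in> L j" "z \<in> F"
            "t [^] m \<otimes> x [^] j = t [^] m \<otimes> y \<oplus> t \<otimes> (t [^] m \<otimes> z)"
            by (auto simp: mem_set_add T_def)
          have c: "y \<in> carrier R" "z \<in> carrier R" using yz Lc Fc by auto
          have "t [^] m \<otimes> y \<oplus> t \<otimes> (t [^] m \<otimes> z) = t [^] m \<otimes> (y \<oplus> t \<otimes> z)"
            using c tc by (simp add: r_distr m_lcomm)
          then have "x [^] j = y \<oplus> t \<otimes> z"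
            using yz(3) c tc x Units_l_cancel[OF Units_pow_closed[OF t(2)]] by auto
          moreover have "t \<otimes> z \<in> T 1 F" using yz tc by (auto simp: T_def)
          ultimately show False using neg yz(1) that by (auto simp: mem_set_add)
        qed
        ultimately show "?Z j \<noteq> ?Z (Suc j)" by auto
      qed
    qed
    then show False by simp
  qed
  then obtain j where j: "j \<le> e" "x [^] j \<in> L j <+>\<^bsub>R\<^esub> T 1 F" by auto
  have T1: "T 1 F = (\<otimes>) t ` F" using tc by (simp add: T_def)
  note j = j[unfolded T1]
  \<comment> \<open>\<open>H\<close> is stable under \<open>x\<close>: the top power
    \<open>x^(j-1)\<close> is sent to \<open>x^j\<close>, which lies in \<open>H\<close> by the
    choice of \<open>j\<close>. As \<open>H\<close> contains \<open>\<one>\<close>, it contains all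
    of \<open>F\<close>.\<close>
  define H where "H = L j <+>\<^bsub>R\<^esub> (\<otimes>) t ` F"
  note H = submodule_set_add[OF AR L[of j] T[OF F, of 1, unfolded T1], folded H_def]
  have xH: "x \<otimes> h \<in> H" if h: "h \<in> H" for h
  proof -
    obtain y z where yz: "y \<in> L j" "z \<in> F" "h = y \<oplus> t \<otimes> z"
      using h by (auto simp: H_def mem_set_add)
    have c: "y \<in> carrier R" "z \<in> carrier R" using yz Lc Fc by auto
    have "x \<otimes> y \<in> H"
    proof (rule lspan_mult_left[OF x AR _ H(1) _ yz(1)[unfolded L_def]])
      fix g assume "g \<in> (\<lambda>i::nat. x [^] i) ` {..<j}"
      then obtain i where i: "i < j" "g = x [^] i" by auto
      then have "x \<otimes> g = x [^] Suc i" using x by (simp add: m_comm)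
      then show "x \<otimes> g \<in> H" using i xL[of "Suc i" j] j(2) H(2) by (cases "Suc i = j") (auto simp: H_def)
    qed (use x in auto)
    moreover have "x \<otimes> z \<in> F"
    proof (rule lspan_mult_left[OF x AR _ F _ yz(2)[unfolded F_def]])
      fix g assume "g \<in> range (\<lambda>i::nat. x [^] i)"
      then obtain i :: nat where i: "g = x [^] i" by auto
      then have "x \<otimes> g = x [^] Suc i" using x by (simp add: m_comm)
      then show "x \<otimes> g \<in> F" using xF[of "Suc i"] by simp
    qed (use x in auto)
    then have "t \<otimes> (x \<otimes> z) \<in> H" using H(3) by auto
    moreover have "x \<otimes> h = x \<otimes> y \<oplus> t \<otimes> (x \<otimes> z)" unfolding yz using c x tc by algebra
    ultimately show ?thesis using submodule_overD(3)[OF H(1)] by auto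
  qed
  have one: "\<one> \<in> H" using j(2) xL[of 0 j] H(2) by (cases j) (auto simp: H_def)
  have "x [^] i \<in> H" for i :: nat
  proof (induction i)
    case (Suc i)
    then show ?case using xH[OF Suc] x by (simp add: m_comm)
  qed (simp add: one)
  then have FH: "F \<subseteq> H" unfolding F_def by (intro lspan_least[OF AR H(1)]) auto
  have FL: "\<exists>y\<in>L j. \<exists>z\<in>F. f = y \<oplus> t [^] k \<otimes> z" if "f \<in> F" for f and k :: nat
    using that
  proof (induction k arbitrary: f)
    case 0
    then have "f = \<zero> \<oplus> t [^] (0::nat) \<otimes> f" using Fc by simp
    then show ?case using 0 submodule_overD(2)[OF L] by blast
  next
    case (Suc k)
    obtain y z where yz: "y \<in> L j" "z \<in> F" "f = y \<oplus> t \<otimes> z"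
      using subsetD[OF FH Suc.prems] by (auto simp: H_def mem_set_add)
    obtain y' z' where yz': "y' \<in> L j" "z' \<in> F" "z = y' \<oplus> t [^] k \<otimes> z'" using Suc.IH[OF yz(2)] by auto
    have c: "y \<in> carrier R" "z \<in> carrier R" "y' \<in> carrier R" "z' \<in> carrier R"
      using yz yz' Lc Fc by auto
    have "f = (y \<oplus> t \<otimes> y') \<oplus> t [^] Suc k \<otimes> z'"
      unfolding yz(3) yz'(3) using c tc by (simp add: r_distr a_assoc m_assoc m_lcomm)
    moreover have "y \<oplus> t \<otimes> y' \<in> L j"
      using submodule_overD(3,4)[OF L] t(1) yz(1) yz'(1) by auto
    ultimately show ?case using yz'(2) by blast
  qed
  obtain y z where yz: "y \<in> L j" "z \<in> F" "x [^] Suc e = y \<oplus> t [^] m \<otimes> z" using FL[OF xF] by blast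
  have "y \<in> L (Suc e)" using yz(1) L_mono[of j "Suc e"] j(1) by auto
  moreover have "t [^] m \<otimes> z \<in> L (Suc e)" using TF AL[of "Suc e"] yz(2) by (auto simp: T_def)
  ultimately show ?thesis using submodule_overD(3)[OF L] yz(3) unfolding L_def by auto
qed

text \<open>The integral equation of \<open>x\<close> is multiplied by \<open>t^(n (e + 1))\<close>.
  With \<open>w = t^n x\<close>, the term in \<open>x^i\<close>, \<open>i \<le> e\<close>, becomes
  the product of \<open>t^n\<close>, \<open>t^(n (e - i))\<close> and \<open>w^i\<close>, so a
  factor \<open>t^n\<close> survives in every term.\<close>

lemma power_mem_uniform:
  assumes A: "subcring A R" and t: "t \<in> A" "t \<in> Units R" and e: "length_le A ((\<otimes>) t ` A) A e"
    and x: "x \<in> carrier R" and m: "\<And>j::nat. t [^] (m::nat) \<otimes> x [^] j \<in> A"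
    and w: "t [^] (n::nat) \<otimes> x \<in> A"
  shows "(t [^] n \<otimes> x) [^] Suc e \<in> (\<otimes>) (t [^] n) ` A"
proof -
  note AR = subcringE(1)[OF A]
  have tc: "t \<in> carrier R" using t by auto
  let ?w = "t [^] n \<otimes> x"
  have "t [^] (n * Suc e) \<otimes> x [^] Suc e \<in> (\<otimes>) (t [^] n) ` A"
  proof (rule lspan_mult_left[OF _ AR _ _ _ integral_equation_uniform_degree[OF A t e x m]])
    show "submodule_over A ((\<otimes>) (t [^] n) ` A)"
      using submodule_image[OF AR submodule_self[OF A]] tc by auto
    fix g assume "g \<in> (\<lambda>i::nat. x [^] i) ` {..<Suc e}"
    then obtain i where i: "i < Suc e" "g = x [^] i" by auto
    have "n * Suc e = n + (n * (e - i) + n * i)" using i(1) by (simp add: algebra_simps diff_mult_distrib2)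
    then have "t [^] (n * Suc e) \<otimes> g = t [^] n \<otimes> (t [^] (n * (e - i)) \<otimes> ?w [^] i)"
      using tc x i by (simp add: nat_pow_mult[symmetric] nat_pow_distrib nat_pow_pow m_assoc del: mult_Suc_right)
    moreover have "t [^] (n * (e - i)) \<otimes> ?w [^] i \<in> A"
      using subcringE(6)[OF A] subcring_nat_pow[OF A] t w by auto
    ultimately show "t [^] (n * Suc e) \<otimes> g \<in> (\<otimes>) (t [^] n) ` A" by auto
  qed (use tc x in auto)
  moreover have "(t [^] n \<otimes> x) [^] Suc e = t [^] (n * Suc e) \<otimes> x [^] Suc e"
    using tc x by (simp only: nat_pow_distrib nat_pow_pow nat_pow_closed)
  ultimately show ?thesis by simp
qed

end

section \<open>One-dimensional noetherian local rings\<close>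

lemma (in cring) ideal_subcring_iff:
  assumes A: "subcring A R"
  shows "ideal N (R\<lparr>carrier := A\<rparr>) \<longleftrightarrow> submodule_over A N \<and> N \<subseteq> A"
proof
  note AR = subcringE(1)[OF A]
  assume "ideal N (R\<lparr>carrier := A\<rparr>)"
  then interpret N: ideal N "R\<lparr>carrier := A\<rparr>" .
  show "submodule_over A N \<and> N \<subseteq> A"
    using N.a_subset additive_subgroup.a_closed[OF N.is_additive_subgroup]
      additive_subgroup.zero_closed[OF N.is_additive_subgroup] N.I_l_closed AR
    by (auto simp: submodule_over_def)
next
  note AR = subcringE(1)[OF A]
  interpret A: cring "R\<lparr>carrier := A\<rparr>" using subcring_iff[OF AR] A by simp
  assume *: "submodule_over A N \<and> N \<subseteq> A"
  then have N: "submodule_over A N" and NA: "N \<subseteq> A" by auto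
  have inv: "inv\<^bsub>add_monoid (R\<lparr>carrier := A\<rparr>)\<^esub> x \<in> N" if "x \<in> N" for x
  proof -
    have x: "x \<in> A" "x \<in> carrier R" using that NA AR by auto
    then have "\<ominus>\<^bsub>R\<lparr>carrier := A\<rparr>\<^esub> x = \<ominus> x"
      by (intro A.minus_equality) (use subcringE(5)[OF A] l_neg in auto)
    moreover have "\<ominus> x = \<zero> \<ominus> x" using x(2) by algebra
    ultimately show ?thesis
      using submodule_minus[OF A N submodule_overD(2)[OF N] that] by (simp add: a_inv_def)
  qed
  show "ideal N (R\<lparr>carrier := A\<rparr>)"
  proof (rule idealI)
    show "subgroup N (add_monoid (R\<lparr>carrier := A\<rparr>))"
      unfolding subgroup_def using NA submodule_overD[OF N] inv by auto
    fix a x assume ax: "a \<in> N" "x \<in> carrier (R\<lparr>carrier := A\<rparr>)"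
    then have "x \<otimes> a \<in> N" "a \<otimes> x = x \<otimes> a" using submodule_overD(4)[OF N, of x a] NA AR m_comm[of a x] by auto
    then show "x \<otimes>\<^bsub>R\<lparr>carrier := A\<rparr>\<^esub> a \<in> N" "a \<otimes>\<^bsub>R\<lparr>carrier := A\<rparr>\<^esub> x \<in> N" by simp_all
  qed (rule A.ring_axioms)
qed

locale admissible = cring Q for Q :: "('a, 'b) ring_scheme" (structure) +
  fixes R M :: "'a set"
  assumes adm: "admissible_ring Q R M"
begin

lemma R_subcring: "subcring R Q"
  using adm by (simp add: admissible_ring_def total_ring_of_fractions_def)

lemma R_carrier: "R \<subseteq> carrier Q" "x \<in> R \<Longrightarrow> x \<in> carrier Q"
  using subcringE(1)[OF R_subcring] by auto

lemma R_closed: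
  shows "\<zero> \<in> R" "\<one> \<in> R" "x \<in> R \<Longrightarrow> \<ominus> x \<in> R" "x \<in> R \<Longrightarrow> y \<in> R \<Longrightarrow> x \<otimes> y \<in> R"
    "x \<in> R \<Longrightarrow> y \<in> R \<Longrightarrow> x \<oplus> y \<in> R" "x \<in> R \<Longrightarrow> y \<in> R \<Longrightarrow> x \<ominus> y \<in> R" "x \<in> R \<Longrightarrow> x [^] (n::nat) \<in> R"
  using subcringE[OF R_subcring] subcring_nat_pow[OF R_subcring] by (auto simp: a_minus_def)

abbreviation (input) RR where "RR \<equiv> Q\<lparr>carrier := R\<rparr>"

lemma RR_cring: "cring RR"
  using subcring_iff[OF R_carrier(1)] R_subcring by simp

lemma R_submodule: "submodule_over R R"
  using submodule_self[OF R_subcring] .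

lemmas ideal_iff = ideal_subcring_iff[OF R_subcring]

definition prime_id :: "'a set \<Rightarrow> bool" where
  "prime_id P \<longleftrightarrow> submodule_over R P \<and> P \<subseteq> R \<and> P \<noteq> R \<and>
     (\<forall>a\<in>R. \<forall>b\<in>R. a \<otimes> b \<in> P \<longrightarrow> a \<in> P \<or> b \<in> P)"

lemma primeideal_iff: "primeideal P RR \<longleftrightarrow> prime_id P"
proof
  assume "primeideal P RR"
  then interpret P: primeideal P RR .
  show "prime_id P"
    using ideal_iff P.is_ideal P.I_notcarr P.I_prime by (auto simp: prime_id_def)
next
  assume "prime_id P"
  then show "primeideal P RR"
    by (intro primeidealI) (use ideal_iff RR_cring in \<open>auto simp: prime_id_def\<close>)
qed

lemma maximalideal_iff:
  "maximalideal N RR \<longleftrightarrow> submodule_over R N \<and> N \<subset> R \<and>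
     (\<forall>Y. submodule_over R Y \<and> N \<subseteq> Y \<and> Y \<subseteq> R \<longrightarrow> Y = N \<or> Y = R)"
proof
  assume "maximalideal N RR"
  then interpret N: maximalideal N RR .
  show "submodule_over R N \<and> N \<subset> R \<and> (\<forall>Y. submodule_over R Y \<and> N \<subseteq> Y \<and> Y \<subseteq> R \<longrightarrow> Y = N \<or> Y = R)"
    using ideal_iff N.is_ideal N.I_notcarr N.I_maximal by auto
next
  assume "submodule_over R N \<and> N \<subset> R \<and> (\<forall>Y. submodule_over R Y \<and> N \<subseteq> Y \<and> Y \<subseteq> R \<longrightarrow> Y = N \<or> Y = R)"
  then show "maximalideal N RR"
    by (intro maximalidealI) (use ideal_iff in auto)
qed

lemma local: "maximalideal N RR \<longleftrightarrow> N = M"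
  using adm by (auto simp: admissible_ring_def local_ring_def)

lemma M_maximal:
  "submodule_over R M" "M \<subset> R" "submodule_over R Y \<Longrightarrow> M \<subseteq> Y \<Longrightarrow> Y \<subseteq> R \<Longrightarrow> Y = M \<or> Y = R"
  using local[of M] maximalideal_iff[of M] by auto

lemma M_R: "x \<in> M \<Longrightarrow> x \<in> R"
  using M_maximal(2) by auto

lemma M_prime: "prime_id M"
proof -
  have "maximalideal M RR" using local by simp
  then have "primeideal M RR" by (rule cring.maximalideal_prime[OF RR_cring])
  then show ?thesis by (simp add: primeideal_iff)
qed

text \<open>Noetherianity as a maximal principle: a chain of ideals contains its union, so Zorn's
  lemma applies to every nonempty family.\<close>

lemma maximal_submodule:
  assumes "S \<noteq> {}" and S: "\<And>N. N \<in> S \<Longrightarrow> submodule_over R N \<and> N \<subseteq> R"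
  obtains N where "N \<in> S" "\<And>Y. Y \<in> S \<Longrightarrow> N \<subseteq> Y \<Longrightarrow> Y = N"
proof -
  interpret RR: noetherian_ring RR using adm by (simp add: admissible_ring_def)
  have "\<exists>N\<in>S. \<forall>Y\<in>S. N \<subseteq> Y \<longrightarrow> Y = N"
  proof (rule subset_Zorn_nonempty)
    fix C assume C: "C \<noteq> {}" "subset.chain S C"
    then have "subset.chain {N. ideal N RR} C" using S ideal_iff by (auto simp: subset_chain_def)
    then have "\<Union>C \<in> C" using RR.ideal_chain_is_trivial C(1) by blast
    then show "\<Union>C \<in> S" using C(2) by (auto simp: subset_chain_def)
  qed (rule assms)
  then show ?thesis using that by auto
qed

lemma principal:
  assumes "a \<in> R"
  shows "submodule_over R ((\<otimes>) a ` R)" "(\<otimes>) a ` R \<subseteq> R" "a \<in> (\<otimes>) a ` R"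
proof -
  show "a \<in> (\<otimes>) a ` R" using assms R_closed(2) R_carrier by (auto simp: image_iff intro!: bexI[of _ \<one>])
qed (use submodule_image[OF R_carrier(1) R_submodule] image_mult_subset[OF R_subcring assms R_submodule]
      assms R_carrier in auto)

lemma submodule_eq_R: "submodule_over R N \<Longrightarrow> N \<subseteq> R \<Longrightarrow> \<one> \<in> N \<Longrightarrow> N = R"
  using submodule_overD(4)[of R N _ \<one>] R_carrier by force

lemma proper_le_M:
  assumes N: "submodule_over R N" "N \<subseteq> R" "N \<noteq> R"
  shows "N \<subseteq> M"
proof -
  let ?S = "{Y. submodule_over R Y \<and> N \<subseteq> Y \<and> Y \<subset> R}"
  obtain Y where Y: "Y \<in> ?S" "\<And>Z. Z \<in> ?S \<Longrightarrow> Y \<subseteq> Z \<Longrightarrow> Z = Y"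
    by (rule maximal_submodule[of ?S]) (use N in auto)
  have "maximalideal Y RR" using Y by (auto simp: maximalideal_iff)
  then show ?thesis using Y(1) local by auto
qed

lemma unit_outside_M:
  assumes "c \<in> R" "c \<notin> M"
  obtains d where "d \<in> R" "c \<otimes> d = \<one>"
proof -
  have "(\<otimes>) c ` R = R"
    using proper_le_M[OF principal(1,2)] principal(3) assms by blast
  then have "\<one> \<in> (\<otimes>) c ` R" using R_closed by simp
  then show ?thesis using that by auto
qed

text \<open>An ideal \<open>P\<close> maximal among those disjoint from \<open>S\<close> is prime:
  if \<open>a\<close> and \<open>b\<close> are outside \<open>P\<close>, both \<open>P + aR\<close>
  and \<open>P + bR\<close> meet \<open>S\<close>, and multiplying the two elements shows that
  \<open>P + abR\<close> does too.\<close>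

lemma prime_avoiding:
  assumes N: "submodule_over R N" "N \<subseteq> R" and S: "S \<subseteq> R" "S \<noteq> {}" "\<And>x y. x \<in> S \<Longrightarrow> y \<in> S \<Longrightarrow> x \<otimes> y \<in> S"
    and disj: "N \<inter> S = {}"
  obtains P where "prime_id P" "N \<subseteq> P" "P \<inter> S = {}"
proof -
  let ?S = "{Y. submodule_over R Y \<and> N \<subseteq> Y \<and> Y \<subseteq> R \<and> Y \<inter> S = {}}"
  obtain P where P: "P \<in> ?S" and max: "\<And>Z. Z \<in> ?S \<Longrightarrow> P \<subseteq> Z \<Longrightarrow> Z = P"
    by (rule maximal_submodule[of ?S]) (use N disj in auto)
  have Ps: "submodule_over R P" "P \<subseteq> R" "P \<inter> S = {}" using P by auto
  have meet: "\<exists>p\<in>P. \<exists>r\<in>R. p \<oplus> a \<otimes> r \<in> S" if a: "a \<in> R" "a \<notin> P" for a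
  proof -
    let ?Z = "P <+>\<^bsub>Q\<^esub> (\<otimes>) a ` R"
    note Z = submodule_set_add[OF R_carrier(1) Ps(1) principal(1)[OF a(1)]]
    have "?Z \<subseteq> R" by (rule set_add_least[OF R_submodule Ps(2) principal(2)[OF a(1)]])
    moreover have "?Z \<noteq> P" using Z(3) principal(3)[OF a(1)] a(2) by auto
    ultimately have "?Z \<inter> S \<noteq> {}" using max[of ?Z] Z P by auto
    then show ?thesis by (auto simp: mem_set_add)
  qed
  have "a \<in> P \<or> b \<in> P" if ab: "a \<in> R" "b \<in> R" "a \<otimes> b \<in> P" for a b
  proof (rule ccontr)
    assume "\<not> (a \<in> P \<or> b \<in> P)"
    then obtain p r q s where *: "p \<in> P" "r \<in> R" "p \<oplus> a \<otimes> r \<in> S" "q \<in> P" "s \<in> R" "q \<oplus> b \<otimes> s \<in> S"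
      using meet[of a] meet[of b] ab by auto
    have c: "p \<in> carrier Q" "r \<in> carrier Q" "q \<in> carrier Q" "s \<in> carrier Q" "a \<in> carrier Q" "b \<in> carrier Q"
      using * ab R_carrier Ps by auto
    have "(p \<oplus> a \<otimes> r) \<otimes> (q \<oplus> b \<otimes> s) = (q \<oplus> b \<otimes> s) \<otimes> p \<oplus> ((a \<otimes> r) \<otimes> q \<oplus> (r \<otimes> s) \<otimes> (a \<otimes> b))"
      using c by algebra
    also have "\<dots> \<in> P"
    proof (intro submodule_overD(3)[OF Ps(1)])
      show "(q \<oplus> b \<otimes> s) \<otimes> p \<in> P" using submodule_overD(4)[OF Ps(1) _ *(1)] S(1) *(6) by auto
      show "(a \<otimes> r) \<otimes> q \<in> P" using submodule_overD(4)[OF Ps(1) _ *(4)] ab *(2) R_closed by auto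
      show "(r \<otimes> s) \<otimes> (a \<otimes> b) \<in> P" using submodule_overD(4)[OF Ps(1) _ ab(3)] *(2,5) R_closed by auto
    qed
    finally show False using S(3)[OF *(3,6)] Ps(3) by auto
  qed
  then have "prime_id P" using Ps S unfolding prime_id_def by auto
  then show ?thesis using that P by auto
qed

lemma no_prime_chain:
  assumes "prime_id P0" "prime_id P1" "prime_id P2" "P0 \<subset> P1" "P1 \<subset> P2"
  shows False
proof -
  let ?P = "\<lambda>i::nat. if i = 0 then P0 else if i = 1 then P1 else P2"
  have "2 \<in> {n. \<exists>P. (\<forall>i\<le>n. primeideal (P i) RR) \<and> (\<forall>i<n. P i \<subset> P (Suc i))}"
    using assms by (auto simp: primeideal_iff less_2_cases_iff intro!: exI[of _ ?P])
  then have "enat 2 \<le> krull_dim RR" unfolding krull_dim_def by (rule SUP_upper)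
  also have "\<dots> = 1" using adm by (simp add: admissible_ring_def)
  finally show False by (simp add: one_enat_def)
qed

section \<open>Regular elements and the parameter \<open>t\<close>\<close>

definition reg :: "'a \<Rightarrow> bool" where
  "reg x \<longleftrightarrow> x \<in> R \<and> (\<forall>y\<in>R. x \<otimes> y = \<zero> \<longrightarrow> y = \<zero>)"

lemma regular_elements_RR: "regular_elements RR = {x. reg x}"
  by (auto simp: regular_elements_def reg_def)

lemma reg_unit: "reg x \<Longrightarrow> x \<in> Units Q"
  using adm regular_elements_RR by (auto simp: admissible_ring_def total_ring_of_fractions_def)

lemma unit_reg: "x \<in> R \<Longrightarrow> x \<in> Units Q \<Longrightarrow> reg x"
  unfolding reg_def by (metis R_carrier(2) Units_closed Units_l_cancel r_null zero_closed)

lemma reg_pow: "reg x \<Longrightarrow> reg (x [^] (n::nat))"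
  using Units_pow_closed[OF reg_unit[of x]] by (intro unit_reg) (auto simp: reg_def R_closed)

text \<open>The prime \<open>P\<close> contains a prime that avoids \<open>{x\<^sup>n s | s \<notin> P}\<close>, and the dimension is one.\<close>

lemma prime_with_regular:
  assumes P: "prime_id P" and x: "x \<in> P" "reg x"
  shows "P = M"
proof (rule ccontr)
  assume "P \<noteq> M"
  have Ps: "submodule_over R P" "P \<subseteq> R" "P \<noteq> R" "\<And>a b. a \<in> R \<Longrightarrow> b \<in> R \<Longrightarrow> a \<otimes> b \<in> P \<Longrightarrow> a \<in> P \<or> b \<in> P"
    using P by (auto simp: prime_id_def)
  have PM: "P \<subset> M" using proper_le_M[OF Ps(1-3)] \<open>P \<noteq> M\<close> by auto
  have xR: "x \<in> R" using x by (auto simp: reg_def)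
  have xc: "x \<in> carrier Q" using xR R_carrier by auto
  have one: "\<one> \<notin> P" using submodule_eq_R[OF Ps(1,2)] Ps(3) by auto
  \<comment> \<open>\<open>S\<close> contains \<open>R - P\<close> (take \<open>n = 0\<close>) and
    \<open>x\<close> (take \<open>s = 1\<close>), so a prime disjoint from \<open>S\<close> lies in
    \<open>P\<close> and misses \<open>x\<close>.\<close>
  define S where "S = {x [^] n \<otimes> s | (n::nat) s. s \<in> R - P}"
  have S: "S \<subseteq> R" "S \<noteq> {}" using xR one R_closed by (auto simp: S_def)
  have S_mult: "y \<otimes> z \<in> S" if yz: "y \<in> S" "z \<in> S" for y z
  proof -
    obtain m n :: nat and r s where *: "y = x [^] m \<otimes> r" "z = x [^] n \<otimes> s" "r \<in> R - P" "s \<in> R - P"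
      using yz by (auto simp: S_def)
    have c: "r \<in> carrier Q" "s \<in> carrier Q" using * R_carrier by auto
    have "y \<otimes> z = x [^] (m + n) \<otimes> (r \<otimes> s)"
      unfolding * using c xc by (simp add: nat_pow_mult[symmetric] m_ac)
    moreover have "r \<otimes> s \<in> R - P" using * Ps(4) R_closed by auto
    ultimately show ?thesis by (auto simp: S_def)
  qed
  have "{\<zero>} \<inter> S = {}"
  proof -
    have "\<zero> \<noteq> x [^] n \<otimes> s" if "s \<in> R - P" for n :: nat and s
      using reg_pow[OF x(2), of n] that submodule_overD(2)[OF Ps(1)] by (force simp: reg_def)
    then show ?thesis unfolding S_def by blast
  qed
  moreover have "submodule_over R {\<zero>}"
    by (rule submodule_overI) (use R_carrier in auto)
  ultimately obtain P0 where P0: "prime_id P0" "P0 \<inter> S = {}"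
    using R_closed(1) by (elim prime_avoiding[OF _ _ S S_mult]) auto
  have "P0 \<subseteq> P"
  proof
    fix y assume y: "y \<in> P0"
    then have yR: "y \<in> R" using P0 by (auto simp: prime_id_def)
    show "y \<in> P"
    proof (rule ccontr)
      assume "y \<notin> P"
      then have "x [^] (0::nat) \<otimes> y \<in> S" using yR unfolding S_def by blast
      then show False using y P0(2) yR R_carrier by auto
    qed
  qed
  moreover have "x \<notin> P0"
  proof -
    have "x [^] (1::nat) \<otimes> \<one> \<in> S" using one R_closed unfolding S_def by blast
    then show ?thesis using P0(2) xc by auto
  qed
  ultimately have "P0 \<subset> P" using x by auto
  then show False using no_prime_chain[OF P0(1) P M_prime] PM by auto
qed

text \<open>The ring has depth one, so \<open>M\<close> contains a nonempty regular sequence; its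
  first entry is regular modulo the ideal generated by the empty set, which is zero.\<close>

lemma exists_regular_in_M: "\<exists>t\<in>M. reg t"
proof -
  interpret RR: cring RR by (rule RR_cring)
  have "depth RR M = 1" using adm by (simp add: admissible_ring_def cohen_macaulay_def)
  have "\<exists>xs. set xs \<subseteq> M \<and> regular_sequence RR xs \<and> xs \<noteq> []"
  proof (rule ccontr)
    assume "\<not> ?thesis"
    then have "depth RR M \<le> 0" unfolding depth_def by (intro SUP_least) (auto simp: zero_enat_def)
    then show False using \<open>depth RR M = 1\<close> by simp
  qed
  then obtain x xs where x: "x \<in> M" "regular_sequence RR (x # xs)"
    by (metis list.set_intros(1) neq_Nil_conv subset_code(1))
  have "Idl\<^bsub>RR\<^esub> {} \<subseteq> {\<zero>}"
    using RR.genideal_minimal[OF RR.zeroideal, of "{}"] by simp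
  moreover have "\<zero> \<in> Idl\<^bsub>RR\<^esub> {}"
    using ideal_iff[of "Idl\<^bsub>RR\<^esub> {}"] RR.genideal_ideal[of "{}"] submodule_overD(2) by auto
  ultimately have "Idl\<^bsub>RR\<^esub> {} = {\<zero>}" by auto
  then have "reg x"
    using x M_R unfolding regular_sequence_def reg_def by (auto dest: spec[of _ 0])
  then show ?thesis using x by auto
qed

definition t :: 'a where "t = (SOME t. t \<in> M \<and> reg t)"

lemma t: "t \<in> M" "reg t" "t \<in> R" "t \<in> carrier Q" "t \<in> Units Q"
proof -
  have "t \<in> M \<and> reg t" unfolding t_def by (rule someI_ex) (use exists_regular_in_M in auto)
  then show "t \<in> M" "reg t" "t \<in> R" "t \<in> carrier Q" "t \<in> Units Q"
    using M_R R_carrier reg_unit by auto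
qed

text \<open>Otherwise a prime over \<open>N\<close> avoids all powers of \<open>t\<close>; being
  \<open>M\<close>, it contains \<open>t\<close>. The condition on primes is kept abstract because
  it holds for two reasons below: \<open>N\<close> contains a regular element, or \<open>N\<close>
  lies strictly above another prime.\<close>

lemma t_power_mem:
  assumes N: "submodule_over R N" "N \<subseteq> R" and prime: "\<And>P. prime_id P \<Longrightarrow> N \<subseteq> P \<Longrightarrow> P = M"
  shows "\<exists>m::nat. t [^] m \<in> N"
proof (rule ccontr)
  assume "\<not> ?thesis"
  then have "N \<inter> range (\<lambda>m::nat. t [^] m) = {}" by auto
  moreover have "x \<otimes> y \<in> range (\<lambda>m::nat. t [^] m)"
    if xy: "x \<in> range (\<lambda>m::nat. t [^] m)" "y \<in> range (\<lambda>m::nat. t [^] m)" for x y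
    using xy t by (auto simp: nat_pow_mult)
  moreover have "range (\<lambda>m::nat. t [^] m) \<subseteq> R" using t R_closed(7) by auto
  ultimately obtain P where P: "prime_id P" "N \<subseteq> P" "P \<inter> range (\<lambda>m::nat. t [^] m) = {}"
    using prime_avoiding[OF N, of "range (\<lambda>m::nat. t [^] m)"] by blast
  then have "P = M" using prime by simp
  moreover have "t [^] (1::nat) \<in> range (\<lambda>m::nat. t [^] m)" by blast
  ultimately show False using P(3) t by auto
qed

text \<open>\<open>Q\<close> is obtained from \<open>R\<close> by inverting \<open>t\<close> alone:
  the only prime containing a regular \<open>b\<close> is \<open>M\<close>, so \<open>b\<close>
  divides a power of \<open>t\<close>.\<close>

lemma t_power_denominator:
  assumes "q \<in> carrier Q"
  shows "\<exists>m::nat. t [^] m \<otimes> q \<in> R"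
proof -
  obtain a b where ab: "a \<in> R" "reg b" "q = a \<otimes> inv b"
    using adm assms regular_elements_RR unfolding admissible_ring_def total_ring_of_fractions_def by blast
  have b: "b \<in> R" "b \<in> carrier Q" "b \<in> Units Q" using ab(2) reg_unit by (auto simp: reg_def R_carrier)
  obtain m :: nat where "t [^] m \<in> (\<otimes>) b ` R"
    using t_power_mem[OF principal(1,2)[OF b(1)]] prime_with_regular[OF _ _ ab(2)] principal(3)[OF b(1)] by blast
  then obtain r where r: "r \<in> R" "t [^] m = b \<otimes> r" by auto
  have c: "a \<in> carrier Q" "r \<in> carrier Q" "inv b \<in> carrier Q" using ab r R_carrier b by auto
  have "t [^] m \<otimes> q = (b \<otimes> inv b) \<otimes> (r \<otimes> a)" unfolding r ab(3) using c b by algebra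
  then have "t [^] m \<otimes> q \<in> R" using b c r ab R_closed by simp
  then show ?thesis by auto
qed

lemma t_power_denominator_mono:
  assumes "t [^] (m::nat) \<otimes> q \<in> R" "m \<le> n" "q \<in> carrier Q"
  shows "t [^] (n::nat) \<otimes> q \<in> R"
proof -
  have "t [^] n = t [^] (n - m) \<otimes> t [^] m" using assms t by (simp add: nat_pow_mult)
  then have "t [^] n \<otimes> q = t [^] (n - m) \<otimes> (t [^] m \<otimes> q)" using assms t by (simp add: m_assoc)
  then show ?thesis using R_closed assms t by auto
qed

section \<open>Finite length modulo a regular element\<close>

lemma submodule_colon:
  assumes N: "submodule_over R N" and a: "a \<in> R"
  shows "submodule_over R {r \<in> R. r \<otimes> a \<in> N}"
proof (rule submodule_overI)
  have ac: "a \<in> carrier Q" using a R_carrier by auto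
  show "\<zero> \<in> {r \<in> R. r \<otimes> a \<in> N}" using submodule_overD(2)[OF N] R_closed ac by auto
  show "x \<oplus> y \<in> {r \<in> R. r \<otimes> a \<in> N}" if "x \<in> {r \<in> R. r \<otimes> a \<in> N}" "y \<in> {r \<in> R. r \<otimes> a \<in> N}" for x y
    using that submodule_overD(3)[OF N, of "x \<otimes> a" "y \<otimes> a"] R_closed R_carrier ac by (auto simp: l_distr)
  show "b \<otimes> x \<in> {r \<in> R. r \<otimes> a \<in> N}" if "b \<in> R" "x \<in> {r \<in> R. r \<otimes> a \<in> N}" for b x
    using that submodule_overD(4)[OF N, of b "x \<otimes> a"] R_closed R_carrier ac by (auto simp: m_assoc)
qed (use R_carrier in auto)

text \<open>Multiplication by \<open>a\<close> identifies \<open>R / (N : a)\<close> with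
  \<open>(N + aR) / N\<close>; submodules are compared by their colon ideals.\<close>

lemma length_le_colon:
  assumes N: "submodule_over R N" "N \<subseteq> R" and a: "a \<in> R"
    and n: "length_le R {r \<in> R. r \<otimes> a \<in> N} R n"
  shows "length_le R N (N <+>\<^bsub>Q\<^esub> (\<otimes>) a ` R) n"
proof -
  let ?c = "\<lambda>Y. {r \<in> R. r \<otimes> a \<in> Y}"
  obtain f where "rank_function R (?c N) R n f" using n by (auto simp: length_le_def)
  note f = rank_functionD[OF this]
  have ac: "a \<in> carrier Q" using a R_carrier by auto
  show ?thesis
  proof (rule length_leI[where rk = "\<lambda>Y. f (?c Y)"])
    show "f (?c Y) \<le> n" if "submodule_over R Y" "N \<subseteq> Y" for Y
      using that by (intro f(2) submodule_colon a) auto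
    fix Y Z assume Y: "submodule_over R Y" and Z: "submodule_over R Z" and NY: "N \<subseteq> Y"
      and YZ: "Y \<subset> Z" and ZN: "Z \<subseteq> N <+>\<^bsub>Q\<^esub> (\<otimes>) a ` R"
    obtain z where z: "z \<in> Z" "z \<notin> Y" using YZ by auto
    then obtain x r where xr: "x \<in> N" "r \<in> R" "z = x \<oplus> a \<otimes> r"
      using subsetD[OF ZN z(1)] by (auto simp: mem_set_add)
    have c: "x \<in> carrier Q" "r \<in> carrier Q" using xr N R_carrier by auto
    have "r \<otimes> a = z \<ominus> x" unfolding xr using c ac by algebra
    moreover have "z \<ominus> x \<in> Z"
      using submodule_minus[OF R_subcring Z z(1), of x] xr(1) NY YZ by auto
    ultimately have rZ: "r \<in> ?c Z" using xr by auto
    have "r \<notin> ?c Y"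
    proof
      assume "r \<in> ?c Y"
      then have "x \<oplus> r \<otimes> a \<in> Y" using submodule_overD(3)[OF Y, of x "r \<otimes> a"] xr NY by auto
      then show False using z(2) xr c ac by (simp add: m_comm)
    qed
    then have "?c Y \<subset> ?c Z" using rZ YZ by auto
    then show "f (?c Y) < f (?c Z)" using NY by (intro f(1) submodule_colon Y Z a) auto
  qed
qed

text \<open>Noetherian induction. A maximal counterexample \<open>Y\<close> is not \<open>M\<close>,
  hence not prime, since a prime with a regular element is \<open>M\<close>. With \<open>a b\<close>
  in \<open>Y\<close> and both factors outside, \<open>Y + aR\<close> and \<open>Y : a\<close> are
  larger, and their bounds add up to one for \<open>Y\<close>.\<close>

lemma exists_length_le:
  assumes N: "submodule_over R N" "N \<subseteq> R" and x: "x \<in> N" "reg x"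
  shows "\<exists>n. length_le R N R n"
proof (rule ccontr)
  assume neg: "\<not> ?thesis"
  let ?S = "{Y. submodule_over R Y \<and> Y \<subseteq> R \<and> N \<subseteq> Y \<and> \<not> (\<exists>n. length_le R Y R n)}"
  obtain Y where Y: "Y \<in> ?S" and max: "\<And>Z. Z \<in> ?S \<Longrightarrow> Y \<subseteq> Z \<Longrightarrow> Z = Y"
    by (rule maximal_submodule[of ?S]) (use N neg in auto)
  then have Ys: "submodule_over R Y" "Y \<subseteq> R" "N \<subseteq> Y" "\<And>n. \<not> length_le R Y R n" by auto
  have "length_le R R R 0" by (rule length_leI[where rk = "\<lambda>_. 0"]) auto
  then have "Y \<noteq> R" using Ys(4) by auto
  moreover have "length_le R M R 1"
  proof (rule length_leI[where rk = "\<lambda>Z. if Z = M then 0 else 1"])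
    fix Y Z assume *: "submodule_over R Y" "submodule_over R Z" "M \<subseteq> Y" "Y \<subset> Z" "Z \<subseteq> R"
    then have "Y = M" "Z \<noteq> M" using M_maximal(3)[of Y] by auto
    then show "(if Y = M then 0 else 1) < (if Z = M then 0 else 1 :: nat)" by simp
  qed auto
  then have "Y \<noteq> M" using Ys(4) by auto
  ultimately have "\<not> prime_id Y" using prime_with_regular[of Y x] x Ys(3) by auto
  then obtain a b where ab: "a \<in> R" "b \<in> R" "a \<otimes> b \<in> Y" "a \<notin> Y" "b \<notin> Y"
    using Ys \<open>Y \<noteq> R\<close> by (auto simp: prime_id_def)
  let ?Z = "Y <+>\<^bsub>Q\<^esub> (\<otimes>) a ` R"
  note Z = submodule_set_add[OF R_carrier(1) Ys(1) principal(1)[OF ab(1)]]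
  have ZR: "?Z \<subseteq> R" by (rule set_add_least[OF R_submodule Ys(2) principal(2)[OF ab(1)]])
  have "?Z \<noteq> Y" using Z(3) principal(3)[OF ab(1)] ab(4) by auto
  then obtain p where p: "length_le R ?Z R p" using max[of ?Z] Z(1,2) ZR Ys(3) by auto
  let ?C = "{r \<in> R. r \<otimes> a \<in> Y}"
  have "Y \<subseteq> ?C"
  proof
    fix y assume "y \<in> Y"
    then have "y \<in> R" "a \<otimes> y \<in> Y" using Ys submodule_overD(4)[OF Ys(1) ab(1)] by auto
    then show "y \<in> ?C" using ab(1) R_carrier by (simp add: m_comm)
  qed
  moreover have "b \<in> ?C" using ab R_carrier by (simp add: m_comm)
  ultimately obtain q where q: "length_le R ?C R q"
    using max[of ?C] submodule_colon[OF Ys(1) ab(1)] Ys(3) ab(5) by auto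
  have "length_le R Y R (q + p)"
    by (rule length_le_trans[OF R_subcring Z(1,2) ZR R_submodule length_le_colon[OF Ys(1,2) ab(1) q] p])
  then show False using Ys(4) by auto
qed

text \<open>All \<open>Z n\<close> contain \<open>x R\<close>, so they have a rank; from an index of
  least rank on, nothing can shrink.\<close>

lemma decreasing_stabilizes:
  fixes Z :: "nat \<Rightarrow> 'a set"
  assumes Z: "\<And>n. submodule_over R (Z n)" "\<And>n. Z n \<subseteq> R" "\<And>n. Z (Suc n) \<subseteq> Z n"
    and x: "reg x" "\<And>n. x \<in> Z n"
  obtains n where "\<forall>m\<ge>n. Z m = Z n"
proof -
  have xR: "x \<in> R" using x by (simp add: reg_def)
  obtain l where "length_le R ((\<otimes>) x ` R) R l"
    using exists_length_le[OF principal(1,2)[OF xR] principal(3)[OF xR] x(1)] by auto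
  then obtain f where "rank_function R ((\<otimes>) x ` R) R l f" by (auto simp: length_le_def)
  note f = rank_functionD[OF this]
  have xZ: "(\<otimes>) x ` R \<subseteq> Z n" for n
    using submodule_overD(4)[OF Z(1) _ x(2)] R_carrier xR by (auto simp: m_comm)
  obtain n where n: "\<And>m. f (Z n) \<le> f (Z m)"
    using ex_has_least_nat[of "\<lambda>_. True" 0 "\<lambda>n. f (Z n)"] by auto
  have "Z m = Z n" if "m \<ge> n" for m
  proof (rule ccontr)
    assume "Z m \<noteq> Z n"
    then have "Z m \<subset> Z n" using lift_Suc_antimono_le[of Z, OF Z(3) that] by auto
    then show False using f(1)[OF Z(1) Z(1) xZ _ Z(2)] n[of m] by (metis not_le)
  qed
  then have "\<forall>m\<ge>n. Z m = Z n" by (intro allI impI)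
  then show ?thesis by (rule that)
qed

section \<open>Powers of the maximal ideal\<close>

definition Mpow :: "nat \<Rightarrow> 'a set" where
  "Mpow n = M [^]\<^bsub>ideals_set RR\<^esub> n"

lemma Mpow_simps: "Mpow 0 = R" "Mpow (Suc n) = ideal_prod RR (Mpow n) M"
  by (simp_all add: Mpow_def ideals_set_def nat_pow_def)

lemma Mpow_ideal: "ideal (Mpow n) RR"
proof (induction n)
  case 0
  then show ?case using Mpow_simps R_submodule by (simp add: ideal_iff)
next
  case (Suc n)
  interpret RR: cring RR by (rule RR_cring)
  show ?case
    using RR.ideal_prod_is_ideal[OF Suc] local[of M] maximalideal.axioms(1) by (auto simp: Mpow_simps)
qed

lemma Mpow_submodule: "submodule_over R (Mpow n)" "Mpow n \<subseteq> R"
  using Mpow_ideal ideal_iff by auto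

lemma Mpow_Suc_subset: "Mpow (Suc n) \<subseteq> Mpow n"
proof -
  interpret RR: cring RR by (rule RR_cring)
  have "ideal M RR" using local[of M] maximalideal.axioms(1) by auto
  then show ?thesis using RR.ideal_prod_inter[OF Mpow_ideal, of M n] by (simp add: Mpow_simps)
qed

lemma t_power_Mpow: "t [^] n \<in> Mpow n"
proof (induction n)
  case (Suc n)
  then show ?case using ideal_prod.prod[OF Suc t(1), of RR] by (simp add: Mpow_simps)
qed (simp add: Mpow_simps R_closed)

text \<open>Nakayama's lemma by hand. The ideals \<open>M^n + tR\<close> become constant; if the
  final one exceeded \<open>tR\<close>, it would be \<open>Y + xR\<close> with \<open>Y\<close>
  maximal below it, and multiplying by \<open>M\<close> would give \<open>x = y + x m\<close>, hence
  \<open>x\<close> in \<open>Y\<close> because \<open>1 - m\<close> is a unit.\<close>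

lemma Mpow_subset_tR: "\<exists>n. Mpow n \<subseteq> (\<otimes>) t ` R"
proof -
  let ?T = "(\<otimes>) t ` R"
  note T = principal[OF t(3)]
  define Z where "Z n = Mpow n <+>\<^bsub>Q\<^esub> ?T" for n
  note Z = submodule_set_add[OF R_carrier(1) Mpow_submodule(1) T(1), folded Z_def]
  have ZR: "Z n \<subseteq> R" for n
    unfolding Z_def by (rule set_add_least[OF R_submodule Mpow_submodule(2) T(2)])
  have Z_Suc: "Z (Suc n) \<subseteq> Z n" for n
    using Mpow_Suc_subset[of n] unfolding Z_def by (simp add: subset_iff mem_set_add) blast
  have tZ: "t \<in> Z n" for n by (rule subsetD[OF Z(3) T(3)])
  obtain n where n: "\<forall>m\<ge>n. Z m = Z n"
    by (rule decreasing_stabilizes[of Z, OF Z(1) ZR Z_Suc t(2) tZ])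
  have "Z (Suc n) = Z n" using spec[OF n, of "Suc n"] by simp
  have "Z n = ?T"
  proof (rule ccontr)
    assume "Z n \<noteq> ?T"
    let ?S = "{Y. submodule_over R Y \<and> ?T \<subseteq> Y \<and> Y \<subset> Z n}"
    obtain Y where Y: "Y \<in> ?S" and max: "\<And>W. W \<in> ?S \<Longrightarrow> Y \<subseteq> W \<Longrightarrow> W = Y"
    proof (rule maximal_submodule[of ?S])
      have "?T \<subseteq> Z n" by (rule Z(3))
      then have "?T \<in> ?S" using T(1) \<open>Z n \<noteq> ?T\<close> by (simp add: psubset_eq)
      then show "?S \<noteq> {}" by (metis emptyE)
      show "submodule_over R N \<and> N \<subseteq> R" if "N \<in> ?S" for N
        using that ZR[of n] by (simp add: psubset_eq) (metis subset_trans)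
    qed blast
    then have Ys: "submodule_over R Y" "?T \<subseteq> Y" "Y \<subset> Z n" by auto
    obtain x where x: "x \<in> Z n" "x \<notin> Y" using Ys by auto
    have xR: "x \<in> R" "x \<in> carrier Q" using x ZR R_carrier by auto
    have "(\<otimes>) x ` R \<subseteq> Z n"
      using submodule_overD(4)[OF Z(1) _ x(1)] xR R_carrier by (auto simp: m_comm)
    then have "Y <+>\<^bsub>Q\<^esub> (\<otimes>) x ` R \<subseteq> Z n" by (intro set_add_least[OF Z(1)]) (use Ys in auto)
    note Yx = submodule_set_add[OF R_carrier(1) Ys(1) principal(1)[OF xR(1)]]
    have "Y <+>\<^bsub>Q\<^esub> (\<otimes>) x ` R \<noteq> Y" using Yx(3) principal(3)[OF xR(1)] x by auto
    have Yx_eq: "Y <+>\<^bsub>Q\<^esub> (\<otimes>) x ` R = Z n"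
    proof (rule ccontr)
      assume "Y <+>\<^bsub>Q\<^esub> (\<otimes>) x ` R \<noteq> Z n"
      then have "Y <+>\<^bsub>Q\<^esub> (\<otimes>) x ` R \<in> ?S"
        using Yx(1,2) \<open>Y <+>\<^bsub>Q\<^esub> (\<otimes>) x ` R \<subseteq> Z n\<close> Ys(2) by (simp add: psubset_eq)
      then show False using max[OF _ Yx(2)] \<open>Y <+>\<^bsub>Q\<^esub> (\<otimes>) x ` R \<noteq> Y\<close> by simp
    qed
    let ?W = "Y <+>\<^bsub>Q\<^esub> (\<otimes>) x ` M"
    note W = submodule_set_add[OF R_carrier(1) Ys(1) submodule_image[OF R_carrier(1) M_maximal(1) xR(2)]]
    have "p \<in> ?W" if "p \<in> Mpow (Suc n)" for p
      using that unfolding Mpow_simps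
    proof induction
      case (prod p m)
      then have "p \<in> Z n" using Z(2) by auto
      then obtain y r where yr: "y \<in> Y" "r \<in> R" "p = y \<oplus> x \<otimes> r"
        unfolding Yx_eq[symmetric] by (auto simp: mem_set_add)
      have c: "y \<in> carrier Q" "r \<in> carrier Q" "m \<in> carrier Q" "m \<in> R"
        using yr prod M_R R_carrier submodule_overD(5)[OF Ys(1)] by auto
      have "p \<otimes> m = m \<otimes> y \<oplus> x \<otimes> (r \<otimes> m)" unfolding yr using c xR by algebra
      moreover have "m \<otimes> y \<in> Y" "r \<otimes> m \<in> M"
        using submodule_overD(4)[OF Ys(1)] submodule_overD(4)[OF M_maximal(1)] yr prod c by auto
      ultimately show ?case by (auto simp: mem_set_add)
    next
      case (sum p q)
      then show ?case using submodule_overD(3)[OF W(1)] by simp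
    qed
    then have "Z (Suc n) \<subseteq> ?W"
      unfolding Z_def by (intro set_add_least[OF W(1)]) (use Ys W(2) in auto)
    then have "x \<in> ?W" using x \<open>Z (Suc n) = Z n\<close> by auto
    then obtain y m where ym: "y \<in> Y" "m \<in> M" "x = y \<oplus> x \<otimes> m" by (auto simp: mem_set_add)
    have c: "y \<in> carrier Q" "m \<in> carrier Q" "m \<in> R"
      using ym M_R R_carrier submodule_overD(5)[OF Ys(1)] by auto
    have "\<one> \<ominus> m \<notin> M"
    proof
      assume "\<one> \<ominus> m \<in> M"
      then have "(\<one> \<ominus> m) \<oplus> m \<in> M" using submodule_overD(3)[OF M_maximal(1)] ym by auto
      moreover have "(\<one> \<ominus> m) \<oplus> m = \<one>" using c by algebra
      ultimately show False using submodule_eq_R[OF M_maximal(1)] M_maximal(2) by auto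
    qed
    then obtain d where d: "d \<in> R" "(\<one> \<ominus> m) \<otimes> d = \<one>"
      using unit_outside_M[of "\<one> \<ominus> m"] R_closed c by auto
    have dc: "d \<in> carrier Q" using d R_carrier by auto
    have "x \<otimes> (\<one> \<ominus> m) = x \<ominus> x \<otimes> m" using c xR by algebra
    also have "\<dots> = (y \<oplus> x \<otimes> m) \<ominus> x \<otimes> m" using ym(3) by simp
    also have "\<dots> = y" using c xR by algebra
    finally have "x \<otimes> (\<one> \<ominus> m) = y" .
    have "x = x \<otimes> ((\<one> \<ominus> m) \<otimes> d)" using d xR by simp
    also have "\<dots> = d \<otimes> (x \<otimes> (\<one> \<ominus> m))" using xR c dc by algebra
    also have "\<dots> = d \<otimes> y" using \<open>x \<otimes> (\<one> \<ominus> m) = y\<close> by simp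
    finally have "x \<in> Y" using submodule_overD(4)[OF Ys(1) d(1) ym(1)] by simp
    then show False using x by auto
  qed
  then show ?thesis using Z(2)[of n] by auto
qed

end

section \<open>Discrete valuations\<close>

lemma (in cring) Units_regular:
  assumes "x \<in> Units R"
  shows "x \<in> regular_elements R"
proof -
  have "y = \<zero>" if "y \<in> carrier R" "x \<otimes> y = \<zero>" for y
    using Units_cancel(1)[OF assms that(1)] that(2) assms by simp
  then show ?thesis using assms by (auto simp: regular_elements_def)
qed

locale admissible_valuations = admissible Q R M
  for Q :: "('a, 'b) ring_scheme" (structure) and R M :: "'a set" +
  fixes v :: "'n::finite \<Rightarrow> 'a \<Rightarrow> int extended"
  assumes vals: "associated_valuations Q R v"
begin

text \<open>An element of value \<open>Pinf\<close> satisfies \<open>vge i n\<close> for every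
  \<open>n\<close> and \<open>veq i n\<close> for none. Working with bounds avoids arithmetic with
  infinite values, and both predicates carry membership in the carrier.\<close>

definition vge :: "'n \<Rightarrow> int \<Rightarrow> 'a \<Rightarrow> bool" where
  "vge i n x \<longleftrightarrow> x \<in> carrier Q \<and> Fin n \<le> v i x"

definition veq :: "'n \<Rightarrow> int \<Rightarrow> 'a \<Rightarrow> bool" where
  "veq i n x \<longleftrightarrow> x \<in> carrier Q \<and> v i x = Fin n"

lemma valuation:
  shows "v i ` carrier Q = insert Pinf (range Fin)"
    "x \<in> carrier Q \<Longrightarrow> y \<in> carrier Q \<Longrightarrow> v i (x \<otimes> y) = v i x + v i y"
    "x \<in> carrier Q \<Longrightarrow> y \<in> carrier Q \<Longrightarrow> min (v i x) (v i y) \<le> v i (x \<oplus> y)"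
  using vals by (auto simp: associated_valuations_def discrete_valuation_def)

lemma v_cases:
  assumes "x \<in> carrier Q"
  obtains "v i x = Pinf" | n where "v i x = Fin n"
  using valuation(1)[of i] assms by blast

lemma vge_carrier: "vge i n x \<Longrightarrow> x \<in> carrier Q" and veq_carrier: "veq i n x \<Longrightarrow> x \<in> carrier Q"
  by (auto simp: vge_def veq_def)

lemma exists_veq: "\<exists>x. veq i n x"
proof -
  have "Fin n \<in> v i ` carrier Q" unfolding valuation(1) by auto
  then show ?thesis by (auto simp: veq_def)
qed

lemma v_zero: "v i \<zero> = Pinf"
proof -
  obtain y where y: "y \<in> carrier Q" "v i y = Fin 1" using exists_veq by (auto simp: veq_def)
  then have "v i \<zero> = v i \<zero> + Fin 1" using valuation(2)[of \<zero> y i] by simp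
  then show ?thesis by (cases rule: v_cases[OF zero_closed, of i]) auto
qed

lemma v_one: "v i \<one> = Fin 0"
proof -
  obtain y where y: "y \<in> carrier Q" "v i y = Fin 1" using exists_veq by (auto simp: veq_def)
  then have "Fin 1 = v i \<one> + Fin 1" using valuation(2)[of \<one> y i] by simp
  then show ?thesis by (cases rule: v_cases[OF one_closed, of i]) auto
qed

lemma v_minus_one: "v i (\<ominus> \<one>) = Fin 0"
proof -
  have "\<ominus> \<one> \<otimes> \<ominus> \<one> = \<one>" by algebra
  then have "v i (\<ominus> \<one>) + v i (\<ominus> \<one>) = Fin 0" using valuation(2)[of "\<ominus> \<one>" "\<ominus> \<one>" i] v_one by simp
  then show ?thesis by (cases "v i (\<ominus> \<one>)") auto
qed

lemma v_neg:
  assumes "x \<in> carrier Q"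
  shows "v i (\<ominus> x) = v i x"
proof -
  have "\<ominus> x = \<ominus> \<one> \<otimes> x" using assms by algebra
  then show ?thesis using valuation(2)[of "\<ominus> \<one>" x i] v_minus_one assms
    by (cases rule: v_cases[OF assms, of i]) auto
qed

lemma vge_zero: "vge i n \<zero>" and veq_one: "veq i 0 \<one>"
  by (simp_all add: vge_def veq_def v_zero v_one)

lemma vge_mono: "vge i n x \<Longrightarrow> m \<le> n \<Longrightarrow> vge i m x"
  unfolding vge_def by (cases "v i x") auto

lemma vge_add: "vge i n x \<Longrightarrow> vge i n y \<Longrightarrow> vge i n (x \<oplus> y)"
  unfolding vge_def using valuation(3)[of x y i] order_trans[of "Fin n" "min (v i x) (v i y)" "v i (x \<oplus> y)"]
  by simp

lemma vge_neg: "vge i n x \<Longrightarrow> vge i n (\<ominus> x)"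
  by (simp add: vge_def v_neg)

lemma vge_minus: "vge i n x \<Longrightarrow> vge i n y \<Longrightarrow> vge i n (x \<ominus> y)"
  unfolding a_minus_def by (intro vge_add vge_neg)

lemma vge_mult: "vge i m x \<Longrightarrow> vge i n y \<Longrightarrow> vge i (m + n) (x \<otimes> y)"
  unfolding vge_def using valuation(2)[of x y i] by (cases "v i x"; cases "v i y") auto

lemma veq_mult: "veq i m x \<Longrightarrow> veq i n y \<Longrightarrow> veq i (m + n) (x \<otimes> y)"
  unfolding veq_def using valuation(2)[of x y i] by auto

lemma veq_vge: "veq i n x \<Longrightarrow> vge i n x"
  by (simp add: vge_def veq_def)

lemma veq_iff: "veq i n x \<longleftrightarrow> vge i n x \<and> \<not> vge i (n + 1) x"
  unfolding vge_def veq_def by (cases "v i x") auto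

lemma veq_vge_iff: "veq i n x \<Longrightarrow> vge i m x \<longleftrightarrow> m \<le> n"
  unfolding vge_def veq_def by (cases "v i x") auto

lemma veq_unique: "veq i n x \<Longrightarrow> veq i m x \<Longrightarrow> n = m"
  by (simp add: veq_def)

lemma veq_neg: "veq i n x \<Longrightarrow> veq i n (\<ominus> x)"
  by (simp add: veq_def v_neg)

lemma veq_add:
  assumes x: "veq i n x" and y: "vge i (n + 1) y"
  shows "veq i n (x \<oplus> y)"
proof -
  have c: "x \<in> carrier Q" "y \<in> carrier Q" using x y by (auto simp: veq_carrier vge_carrier)
  have "\<not> vge i (n + 1) (x \<oplus> y)"
  proof
    assume "vge i (n + 1) (x \<oplus> y)"
    then have "vge i (n + 1) ((x \<oplus> y) \<ominus> y)" by (intro vge_minus y)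
    moreover have "(x \<oplus> y) \<ominus> y = x" using c by algebra
    ultimately show False using x by (simp add: veq_iff)
  qed
  moreover have "vge i n (x \<oplus> y)" using vge_add[OF veq_vge[OF x] vge_mono[OF y]] by simp
  ultimately show ?thesis by (simp add: veq_iff)
qed

lemma veq_pow: "veq i n x \<Longrightarrow> veq i (int k * n) (x [^] k)"
proof (induction k)
  case (Suc k)
  then show ?case using veq_mult[OF Suc.IH[OF Suc.prems] Suc.prems] by (simp add: algebra_simps)
qed (simp add: veq_one)

lemma vge_pow: "vge i n x \<Longrightarrow> vge i (int k * n) (x [^] k)"
proof (induction k)
  case (Suc k)
  then show ?case using vge_mult[OF Suc.IH[OF Suc.prems] Suc.prems] by (simp add: algebra_simps)
qed (simp add: veq_vge[OF veq_one])

lemma vge_Pinf: "x \<in> carrier Q \<Longrightarrow> v i x = Pinf \<Longrightarrow> vge i n x"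
  by (simp add: vge_def)

lemma v_Pinf_mult: "x \<in> carrier Q \<Longrightarrow> y \<in> carrier Q \<Longrightarrow> v i x = Pinf \<Longrightarrow> v i (x \<otimes> y) = Pinf"
  using valuation(2)[of x y i] v_cases[of y i] by (metis plus_extended.simps(3,4))

lemma veq_unit:
  assumes "x \<in> Units Q"
  obtains n where "veq i n x" "veq i (- n) (inv x)"
proof -
  have x: "x \<in> carrier Q" "inv x \<in> carrier Q" "x \<otimes> inv x = \<one>" using assms by auto
  then have eq: "v i x + v i (inv x) = Fin 0" using valuation(2)[of x "inv x" i] v_one by simp
  obtain n where "v i x = Fin n" using eq by (cases "v i x"; cases "v i (inv x)") auto
  moreover have "v i (inv x) = Fin (- n)" using eq calculation by (cases "v i (inv x)") auto
  ultimately show ?thesis using that x by (auto simp: veq_def)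
qed

lemma veq_inv: "x \<in> Units Q \<Longrightarrow> veq i n x \<Longrightarrow> veq i (- n) (inv x)"
  by (metis veq_unit veq_unique)

lemma valuation_ring_iff: "W \<in> valuation_rings Q R \<longleftrightarrow> (\<exists>i. W = {x. vge i 0 x})"
proof -
  have "valuation_rings Q R = range (\<lambda>i. {x \<in> carrier Q. 0 \<le> v i x})"
    using vals by (auto simp: associated_valuations_def bij_betw_def)
  then show ?thesis by (auto simp: vge_def zero_extended_def)
qed

lemma valuation_ring_inj: "{x. vge i 0 x} = {x. vge j 0 x} \<Longrightarrow> i = j"
  using vals by (auto simp: associated_valuations_def bij_betw_def inj_def vge_def zero_extended_def)

lemma valuation_ring: "{x. vge i 0 x} \<in> valuation_rings Q R"
  using valuation_ring_iff by auto

lemma vge_R: "x \<in> R \<Longrightarrow> vge i 0 x"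
  using valuation_ring[of i] by (auto simp: valuation_rings_def)

lemma vge_R_mult: "a \<in> R \<Longrightarrow> vge i n x \<Longrightarrow> vge i n (a \<otimes> x)"
  using vge_mult[OF vge_R] by fastforce

section \<open>The parameter \<open>t\<close> and the residues at each place\<close>

definition vt :: "'n \<Rightarrow> int" where "vt i = (THE n. veq i n t)"

lemma veq_t: "veq i (vt i) t"
proof -
  obtain n where "veq i n t" using veq_unit[OF t(5)] by blast
  then show ?thesis unfolding vt_def by (rule theI) (use veq_unique \<open>veq i n t\<close> in auto)
qed

lemma veq_t_pow: "veq i (int k * vt i) (t [^] k)"
  by (rule veq_pow[OF veq_t])

text \<open>If \<open>t\<close> had value zero at \<open>i\<close>, inverting it would produce no
  negative values, so the valuation ring would be all of \<open>Q\<close>.\<close>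

lemma vt_pos: "vt i \<ge> 1"
proof (rule ccontr)
  assume "\<not> vt i \<ge> 1"
  moreover have "vt i \<ge> 0" using veq_vge_iff[OF veq_t] vge_R[OF t(3)] by simp
  ultimately have 0: "vt i = 0" by simp
  have "vge i 0 q" if q: "q \<in> carrier Q" for q
  proof -
    obtain m :: nat where "t [^] m \<otimes> q \<in> R" using t_power_denominator[OF q] by auto
    then have "vge i 0 (t [^] m \<otimes> q)" by (rule vge_R)
    then have "Fin 0 \<le> v i (t [^] m) + v i q" using valuation(2)[of "t [^] m" q i] q t by (auto simp: vge_def)
    moreover have "v i (t [^] m) = Fin 0" using veq_t_pow[of i m] 0 by (simp add: veq_def)
    ultimately show ?thesis using q by (cases "v i q") (auto simp: vge_def)
  qed
  then have "{x. vge i 0 x} = carrier Q" using vge_carrier by auto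
  then show False using valuation_ring[of i] by (auto simp: valuation_rings_def)
qed

text \<open>The elements of \<open>R\<close> of positive value at \<open>i\<close> form a prime
  containing the regular element \<open>t\<close>; by dimension one it is \<open>M\<close>, whatever
  the place \<open>i\<close>.\<close>

lemma vge_one_iff:
  assumes c: "c \<in> R"
  shows "vge i 1 c \<longleftrightarrow> c \<in> M"
proof -
  define P where "P = {r \<in> R. vge i 1 r}"
  have sub: "submodule_over R P"
    by (rule submodule_overI) (use R_closed R_carrier vge_zero vge_add vge_R_mult in \<open>auto simp: P_def\<close>)
  have "\<one> \<notin> P" using veq_one[of i] by (simp add: P_def veq_iff)
  then have "P \<noteq> R" using R_closed by auto
  moreover have "a \<in> P \<or> b \<in> P" if ab: "a \<in> R" "b \<in> R" "a \<otimes> b \<in> P" for a b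
  proof (rule ccontr)
    assume "\<not> (a \<in> P \<or> b \<in> P)"
    then have "veq i 0 a" "veq i 0 b" using ab vge_R by (auto simp: P_def veq_iff)
    then have "veq i 0 (a \<otimes> b)" using veq_mult by fastforce
    then show False using ab by (simp add: P_def veq_iff)
  qed
  ultimately have "prime_id P" using sub by (auto simp: prime_id_def P_def)
  moreover have "t \<in> P" using t veq_vge_iff[OF veq_t] vt_pos by (simp add: P_def)
  ultimately have "P = M" using prime_with_regular t by blast
  then show ?thesis using c by (auto simp: P_def)
qed

lemma veq_unit_R: "c \<in> R \<Longrightarrow> c \<notin> M \<Longrightarrow> veq i 0 c"
  by (simp add: veq_iff vge_R vge_one_iff)

text \<open>
  The elements of infinite value form a prime of \<open>R\<close>. In dimension one, every strictly larger ideal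
  contains a power of \<open>t\<close>.
\<close>

lemma inverse_mod_Pinf:
  assumes x: "veq i n x"
  obtains y where "y \<in> carrier Q" "veq i (- n) y" "v i (x \<otimes> y \<ominus> \<one>) = Pinf"
proof -
  have xc: "x \<in> carrier Q" using x by (simp add: veq_def)
  obtain k :: nat where k: "t [^] k \<otimes> x \<in> R" using t_power_denominator[OF xc] by auto
  define a where "a = t [^] k \<otimes> x"
  have a: "a \<in> R" "a \<in> carrier Q" using k R_carrier by (auto simp: a_def)
  have va: "veq i (int k * vt i + n) a" unfolding a_def by (rule veq_mult[OF veq_t_pow x])
  define P where "P = {r \<in> R. v i r = Pinf}"
  have sub: "submodule_over R P"
  proof (rule submodule_overI)
    show "y \<oplus> z \<in> P" if "y \<in> P" "z \<in> P" for y z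
      using that valuation(3)[of y z i] R_closed R_carrier by (auto simp: P_def)
    show "r \<otimes> y \<in> P" if "r \<in> R" "y \<in> P" for r y
      using that v_Pinf_mult[of y r i] R_closed R_carrier m_comm[of r y] by (auto simp: P_def)
  qed (use R_closed R_carrier v_zero in \<open>auto simp: P_def\<close>)
  have "\<one> \<notin> P" using v_one by (simp add: P_def)
  then have "P \<noteq> R" using R_closed by auto
  moreover have "a \<in> P \<or> b \<in> P" if ab: "a \<in> R" "b \<in> R" "a \<otimes> b \<in> P" for a b
  proof (rule ccontr)
    have c: "a \<in> carrier Q" "b \<in> carrier Q" using ab R_carrier by auto
    assume "\<not> (a \<in> P \<or> b \<in> P)"
    then have "v i a \<noteq> Pinf" "v i b \<noteq> Pinf" using ab by (auto simp: P_def)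
    then show False
      using ab(3) valuation(2)[OF c, of i]
      by (cases rule: v_cases[OF c(1), of i]; cases rule: v_cases[OF c(2), of i]) (auto simp: P_def)
  qed
  ultimately have P: "prime_id P" using sub by (auto simp: prime_id_def P_def)
  have "a \<notin> P" using va by (simp add: P_def veq_def)
  let ?N = "P <+>\<^bsub>Q\<^esub> (\<otimes>) a ` R"
  note N = submodule_set_add[OF R_carrier(1) sub principal(1)[OF a(1)]]
  have "P \<subseteq> R" by (auto simp: P_def)
  then have NR: "?N \<subseteq> R" by (rule set_add_least[OF R_submodule _ principal(2)[OF a(1)]])
  have "\<exists>m::nat. t [^] m \<in> ?N"
  proof (rule t_power_mem[OF N(1) NR])
    fix Z assume Z: "prime_id Z" "?N \<subseteq> Z"
    then have "P \<subset> Z" using N(2,3) principal(3)[OF a(1)] \<open>a \<notin> P\<close> by blast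
    moreover have "Z \<subseteq> M" using proper_le_M Z(1) by (auto simp: prime_id_def)
    ultimately show "Z = M" using no_prime_chain[OF P Z(1) M_prime] by auto
  qed
  then obtain m :: nat and p r where pr: "p \<in> P" "r \<in> R" "t [^] m = p \<oplus> a \<otimes> r" by (auto simp: mem_set_add)
  have c: "p \<in> carrier Q" "r \<in> carrier Q" using pr R_carrier by (auto simp: P_def)
  have tm: "t [^] m \<in> Units Q" by (rule Units_pow_closed[OF t(5)])
  define u where "u = inv (t [^] m)"
  have u: "u \<in> carrier Q" "u \<otimes> t [^] m = \<one>" using tm by (auto simp: u_def)
  \<comment> \<open>From \<open>t^m = p + a r\<close> with \<open>p\<close> of infinite value,
    \<open>a r / t^m\<close> is \<open>1\<close> modulo infinite values; since
    \<open>a = t^k x\<close>, this exhibits an inverse of \<open>x\<close>.\<close>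
  define y where "y = t [^] k \<otimes> u \<otimes> r"
  have yc: "y \<in> carrier Q" using u c t by (simp add: y_def)
  have "x \<otimes> y \<ominus> \<one> = u \<otimes> (a \<otimes> r) \<ominus> u \<otimes> t [^] m"
  proof -
    have "x \<otimes> y = u \<otimes> (a \<otimes> r)" unfolding y_def a_def using u(1) c xc t by (simp add: m_ac)
    then show ?thesis using u(2) by simp
  qed
  also have "\<dots> = u \<otimes> (a \<otimes> r) \<ominus> u \<otimes> (p \<oplus> a \<otimes> r)" using pr by simp
  also have "\<dots> = p \<otimes> (\<ominus> u)" using u(1) c a by algebra
  finally have xy: "v i (x \<otimes> y \<ominus> \<one>) = Pinf"
    using v_Pinf_mult[of p "\<ominus> u" i] u c pr by (simp add: P_def)
  have "vge i 1 (x \<otimes> y \<ominus> \<one>)" using xy xc yc by (simp add: vge_Pinf)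
  then have "veq i 0 (\<one> \<oplus> (x \<otimes> y \<ominus> \<one>))" using veq_add[OF veq_one] by simp
  moreover have "\<one> \<oplus> (x \<otimes> y \<ominus> \<one>) = x \<otimes> y" using xc yc by algebra
  ultimately have "v i x + v i y = Fin 0" using valuation(2)[OF xc yc, of i] by (simp add: veq_def)
  then have "veq i (- n) y" using x yc by (cases "v i y") (auto simp: veq_def)
  then show ?thesis using that yc xy by blast
qed

lemma res_rat: "residually_rational Q R M"
  using adm by (simp add: admissible_ring_def)

text \<open>The elements of positive value form a maximal ideal of the valuation ring, with inverses
  modulo infinite values in place of inverses. It contains the regular \<open>t\<close>, so residual
  rationality applies to it, and surjectivity on cosets yields \<open>c\<close>.\<close>

lemma residue:
  assumes x: "vge i 0 x"
  obtains c where "c \<in> R" "vge i 1 (x \<ominus> c)"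
proof -
  let ?V = "{x. vge i 0 x}" and ?N = "{x. vge i 1 x}"
  have V: "subcring ?V Q" using valuation_ring[of i] by (simp add: valuation_rings_def)
  have Nsub: "submodule_over ?V ?N"
    by (rule submodule_overI) (use vge_carrier vge_zero vge_add vge_mult[of i 0 _ 1] in auto)
  have NV: "?N \<subseteq> ?V" using vge_mono by fastforce
  have "maximalideal ?N (Q\<lparr>carrier := ?V\<rparr>)"
  proof (rule maximalidealI)
    show "ideal ?N (Q\<lparr>carrier := ?V\<rparr>)" using ideal_subcring_iff[OF V] Nsub NV by simp
    have "\<one> \<in> ?V - ?N" using veq_one[of i] by (simp add: veq_iff)
    then show "carrier (Q\<lparr>carrier := ?V\<rparr>) \<noteq> ?N" by auto
    fix Y assume "ideal Y (Q\<lparr>carrier := ?V\<rparr>)" "?N \<subseteq> Y" "Y \<subseteq> carrier (Q\<lparr>carrier := ?V\<rparr>)"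
    then have Y: "submodule_over ?V Y" "Y \<subseteq> ?V" "?N \<subseteq> Y" using ideal_subcring_iff[OF V] by auto
    show "Y = ?N \<or> Y = carrier (Q\<lparr>carrier := ?V\<rparr>)"
    proof (rule ccontr)
      assume neg: "\<not> ?thesis"
      then obtain x where x: "x \<in> Y" "x \<notin> ?N" using Y by auto
      then have "veq i 0 x" using Y(2) by (auto simp: veq_iff)
      then obtain y where y: "y \<in> carrier Q" "veq i (- 0) y" "v i (x \<otimes> y \<ominus> \<one>) = Pinf"
        using inverse_mod_Pinf by blast
      have xc: "x \<in> carrier Q" using \<open>veq i 0 x\<close> by (rule veq_carrier)
      have "x \<otimes> y \<ominus> \<one> \<in> Y" using Y(3) vge_Pinf[OF _ y(3)] xc y(1) by auto
      moreover have "y \<otimes> x \<in> Y" using submodule_overD(4)[OF Y(1) _ x(1), of y] veq_vge[OF y(2)] by simp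
      ultimately have "y \<otimes> x \<ominus> (x \<otimes> y \<ominus> \<one>) \<in> Y" by (rule submodule_minus[OF V Y(1), rotated])
      moreover have "y \<otimes> x \<ominus> (x \<otimes> y \<ominus> \<one>) = \<one>" using xc y(1) by algebra
      ultimately have one: "\<one> \<in> Y" by simp
      have "?V \<subseteq> Y" using submodule_overD(4)[OF Y(1) _ one] vge_carrier by fastforce
      then show False using neg Y(2) by auto
    qed
  qed
  moreover have "t \<in> ?N" using veq_vge_iff[OF veq_t] vt_pos by simp
  moreover have "t \<in> regular_elements Q"
    by (rule Units_regular[OF t(5)])
  ultimately have "(\<lambda>C. ?N <+>\<^bsub>Q\<^esub> C) \<in> ring_iso (RR Quot M) (Q\<lparr>carrier := ?V\<rparr> Quot ?N)"
    using res_rat[unfolded residually_rational_def, rule_format, OF valuation_ring[of i], of ?N] by auto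
  then have surj: "(\<lambda>C. ?N <+>\<^bsub>Q\<^esub> C) ` carrier (RR Quot M) = carrier (Q\<lparr>carrier := ?V\<rparr> Quot ?N)"
    by (auto simp: ring_iso_def bij_betw_def)
  have xc: "x \<in> carrier Q" using x by (rule vge_carrier)
  have "?N +>\<^bsub>Q\<lparr>carrier := ?V\<rparr>\<^esub> x \<in> carrier (Q\<lparr>carrier := ?V\<rparr> Quot ?N)"
    using x by (auto simp: FactRing_def A_RCOSETS_def')
  then obtain C where C: "C \<in> carrier (RR Quot M)" "?N +>\<^bsub>Q\<lparr>carrier := ?V\<rparr>\<^esub> x = ?N <+>\<^bsub>Q\<^esub> C"
    using surj by (metis (no_types, lifting) imageE)
  then obtain c where c: "c \<in> R" "C = M +>\<^bsub>RR\<^esub> c" by (auto simp: FactRing_def A_RCOSETS_def')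
  have "\<zero> \<oplus> x \<in> ?N +>\<^bsub>Q\<lparr>carrier := ?V\<rparr>\<^esub> x" using vge_zero by (auto simp: a_r_coset_def')
  then have "x \<in> ?N <+>\<^bsub>Q\<^esub> C" using C xc by simp
  then obtain n m where nm: "vge i 1 n" "m \<in> M" "x = n \<oplus> (m \<oplus> c)"
    unfolding mem_set_add c by (auto simp: a_r_coset_def')
  have cc: "n \<in> carrier Q" "m \<in> carrier Q" "c \<in> carrier Q" using nm c M_R R_carrier vge_carrier by auto
  have "x \<ominus> c = n \<oplus> m" unfolding nm using cc by algebra
  moreover have "vge i 1 m" using nm(2) vge_one_iff M_R by blast
  ultimately have "vge i 1 (x \<ominus> c)" using vge_add nm(1) by simp
  then show ?thesis using that c by blast
qed

text \<open>Divide by \<open>w\<close> and take a residue. The \<open>y\<close> used is an inverse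
  of \<open>w\<close> modulo infinite values only, but the error \<open>(w y - 1) x\<close> has
  infinite value too.\<close>

lemma residue_relative:
  assumes x: "vge i n x" and w: "veq i n w"
  obtains c where "c \<in> R" "vge i (n + 1) (x \<ominus> c \<otimes> w)"
proof -
  have c: "x \<in> carrier Q" "w \<in> carrier Q" using x w by (auto simp: vge_carrier veq_carrier)
  obtain y where y: "y \<in> carrier Q" "veq i (- n) y" "v i (w \<otimes> y \<ominus> \<one>) = Pinf"
    using inverse_mod_Pinf[OF w] by blast
  have "vge i 0 (x \<otimes> y)" using vge_mult[OF x veq_vge[OF y(2)]] by simp
  then obtain d where d: "d \<in> R" "vge i 1 (x \<otimes> y \<ominus> d)" by (rule residue)
  have dc: "d \<in> carrier Q" using d R_carrier by auto
  have "vge i (n + 1) (w \<otimes> (x \<otimes> y \<ominus> d))" using vge_mult[OF veq_vge[OF w] d(2)] .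
  moreover have "vge i (n + 1) ((w \<otimes> y \<ominus> \<one>) \<otimes> x)"
    using c y by (intro vge_Pinf v_Pinf_mult) auto
  ultimately have "vge i (n + 1) (w \<otimes> (x \<otimes> y \<ominus> d) \<ominus> (w \<otimes> y \<ominus> \<one>) \<otimes> x)" by (rule vge_minus)
  moreover have "w \<otimes> (x \<otimes> y \<ominus> d) \<ominus> (w \<otimes> y \<ominus> \<one>) \<otimes> x = x \<ominus> d \<otimes> w" using c y(1) dc by algebra
  ultimately show ?thesis using that d(1) by simp
qed

text \<open>The bound on the residue field in the form used later: pairwise incongruent elements of
  \<open>R\<close>, indexed by the places themselves so that places and candidates can be counted
  against each other.\<close>

lemma exists_residues: "\<exists>c :: 'n \<Rightarrow> 'a. range c \<subseteq> R \<and> (\<forall>k l. c k \<ominus> c l \<in> M \<longrightarrow> k = l)"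
proof -
  obtain f where f: "inj_on f (valuation_rings Q R)" "f ` valuation_rings Q R \<subseteq> carrier (RR Quot M)"
    using adm unfolding admissible_ring_def lepoll_def by auto
  define g where "g k = f {x. vge k 0 x}" for k
  have g: "g k \<in> carrier (RR Quot M)" for k using f(2) valuation_ring[of k] by (auto simp: g_def)
  have "\<exists>c\<in>R. g k = M +>\<^bsub>RR\<^esub> c" for k using g[of k] by (auto simp: FactRing_def A_RCOSETS_def')
  then obtain c where c: "\<And>k. c k \<in> R" "\<And>k. g k = M +>\<^bsub>RR\<^esub> c k" by metis
  have "k = l" if kl: "c k \<ominus> c l \<in> M" for k l
  proof -
    have sub: "M +>\<^bsub>RR\<^esub> c k \<subseteq> M +>\<^bsub>RR\<^esub> c l" if kl: "c k \<ominus> c l \<in> M" for k l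
    proof
      fix x assume "x \<in> M +>\<^bsub>RR\<^esub> c k"
      then obtain m where m: "m \<in> M" "x = m \<oplus> c k" by (auto simp: a_r_coset_def')
      have cc: "m \<in> carrier Q" "c k \<in> carrier Q" "c l \<in> carrier Q" using m c M_R R_carrier by auto
      have "x = (m \<oplus> (c k \<ominus> c l)) \<oplus> c l" unfolding m using cc by algebra
      moreover have "m \<oplus> (c k \<ominus> c l) \<in> M" using submodule_overD(3)[OF M_maximal(1) m(1) kl] .
      ultimately show "x \<in> M +>\<^bsub>RR\<^esub> c l" by (auto simp: a_r_coset_def')
    qed
    have cc: "c k \<in> carrier Q" "c l \<in> carrier Q" using c R_carrier by auto
    have "c l \<ominus> c k = \<zero> \<ominus> (c k \<ominus> c l)" using cc by algebra
    then have "c l \<ominus> c k \<in> M"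
      using submodule_minus[OF R_subcring M_maximal(1) submodule_overD(2)[OF M_maximal(1)] kl] by simp
    then have "g k = g l" using sub[of k l] sub[of l k] kl c(2) by auto
    then have "{x. vge k 0 x} = {x. vge l 0 x}"
      unfolding g_def using inj_onD[OF f(1) _ valuation_ring valuation_ring] by blast
    then show ?thesis by (rule valuation_ring_inj)
  qed
  then show ?thesis using c by (intro exI[of _ c]) auto
qed

text \<open>The ring \<open>V\<close> given by Samuel's theorem is proper because it misses
  \<open>x\<close>, so it is one of the listed valuation rings, which all contain
  \<open>x\<close>.\<close>

lemma integral_if_vge:
  assumes x: "x \<in> carrier Q" and ge: "\<And>i. vge i 0 x"
  shows "integral_over R x"
proof (rule ccontr)
  assume "\<not> ?thesis"
  then obtain V where V: "subcring V Q" "R \<subseteq> V" "x \<notin> V"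
    "\<forall>y\<in>carrier Q - V. \<forall>z\<in>carrier Q - V. y \<otimes> z \<in> carrier Q - V"
    using exists_valuation_ring[OF R_subcring x] by auto
  then have "V \<in> valuation_rings Q R" using x by (auto simp: valuation_rings_def)
  then show False using valuation_ring_iff ge V(3) by auto
qed

text \<open>All powers of \<open>x\<close> lie in one finitely generated module, and finitely many
  generators have a common denominator \<open>t^m\<close>.\<close>

lemma integral_bounded_denominators:
  assumes x: "x \<in> carrier Q" and int: "integral_over R x"
  obtains m :: nat where "\<And>j::nat. t [^] m \<otimes> x [^] j \<in> R"
proof -
  obtain G where G: "finite G" "G \<subseteq> carrier Q" "\<one> \<in> lspan R G" "\<forall>g\<in>G. x \<otimes> g \<in> lspan R G"
    using int unfolding integral_over_def by auto
  note S = lspan_submodule[OF R_subcring G(2)]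
  obtain f :: "'a \<Rightarrow> nat" where f: "\<And>g. g \<in> G \<Longrightarrow> t [^] f g \<otimes> g \<in> R"
    using t_power_denominator G(2) by (metis subsetD)
  define m where "m = Max (insert 0 (f ` G))"
  have "t [^] m \<otimes> g \<in> R" if "g \<in> G" for g
    using G that by (intro t_power_denominator_mono[OF f]) (auto simp: m_def)
  then have *: "t [^] m \<otimes> y \<in> R" if "y \<in> lspan R G" for y
    using lspan_mult_left[OF _ R_carrier(1) G(2) R_submodule _ that, of "t [^] m"] t by simp
  have "x [^] j \<in> lspan R G" for j :: nat
  proof (induction j)
    case (Suc j)
    have "x \<otimes> x [^] j \<in> lspan R G"
      using lspan_mult_left[OF x R_carrier(1) G(2) S _ Suc] G(4) by simp
    then show ?case using x by (simp add: m_comm)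
  qed (simp add: G)
  then show ?thesis using that * by blast
qed

end

section \<open>The conductor of the integral closure\<close>

context admissible_valuations begin

definition vmin :: "nat \<Rightarrow> 'a set" where
  "vmin k = {x \<in> R. \<forall>i. vge i (int k) x}"

lemma vmin_submodule: "submodule_over R (vmin k)" "vmin k \<subseteq> R"
  by (auto simp: vmin_def intro!: submodule_overI R_closed vge_zero vge_add vge_R_mult R_carrier)

lemma vmin_antimono: "k \<le> l \<Longrightarrow> vmin l \<subseteq> vmin k"
  by (auto simp: vmin_def intro: vge_mono)

text \<open>An element of the completion all of whose values are infinite would be nilpotent.\<close>

lemma no_infinite_value_sequence:
  assumes s: "\<And>n. s n \<in> R" "\<And>n. s n \<notin> (\<otimes>) t ` R" "\<And>n i. vge i (int n * vt i) (s n)"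
    "\<And>n. s (Suc n) \<ominus> s n \<in> (\<otimes>) (t [^] n) ` R"
  shows False
proof -
  interpret RR: cring RR by (rule RR_cring)
  obtain e where e: "length_le R ((\<otimes>) t ` R) R e"
    using exists_length_le[OF principal(1,2)[OF t(3)] principal(3)[OF t(3)] t(2)] by auto
  have sc: "s n \<in> carrier Q" for n using s(1) R_carrier by auto
  have power: "s n [^] Suc e \<in> (\<otimes>) (t [^] n) ` R" for n
  proof -
    have tn: "t [^] n \<in> Units Q" by (rule Units_pow_closed[OF t(5)])
    \<comment> \<open>Dividing \<open>s n\<close> by \<open>t^n\<close> leaves values at least zero,
      so the quotient is integral; the exponent \<open>Suc e\<close> obtained from it does not
      depend on \<open>n\<close>.\<close>
    define x where "x = inv (t [^] n) \<otimes> s n"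
    have x: "x \<in> carrier Q" using tn sc by (simp add: x_def)
    have tx: "t [^] n \<otimes> x = s n" unfolding x_def by (rule Units_cancel(2)[OF tn sc])
    have "vge i 0 x" for i
      using vge_mult[OF veq_vge[OF veq_inv[OF tn veq_t_pow]] s(3)[of i n]] by (simp add: x_def)
    then have "integral_over R x" by (rule integral_if_vge[OF x])
    then obtain m :: nat where m: "\<And>j::nat. t [^] m \<otimes> x [^] j \<in> R"
      using integral_bounded_denominators[OF x] by blast
    show ?thesis using power_mem_uniform[OF R_subcring t(3,5) e x m, of n] s(1) by (simp add: tx)
  qed
  have t_Mpow: "(\<otimes>) (t [^] n) ` R \<subseteq> Mpow n" for n
    using submodule_overD(4)[OF Mpow_submodule(1) _ t_power_Mpow] R_carrier t by (auto simp: m_comm)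
  note I = Mpow_ideal
  define \<omega> where "\<omega> n = Mpow n +>\<^bsub>RR\<^esub> s n" for n
  let ?C = "adic_completion RR M"
  \<comment> \<open>Compatibility of the cosets: consecutive terms differ by an element of
    \<open>t^n R\<close>, which lies in \<open>M^n\<close>.\<close>
  have mono: "\<omega> (Suc n) \<subseteq> \<omega> n" for n
  proof
    fix x assume "x \<in> \<omega> (Suc n)"
    then obtain m where m: "m \<in> Mpow (Suc n)" "x = m \<oplus> s (Suc n)" by (auto simp: \<omega>_def a_r_coset_def')
    have mn: "m \<in> Mpow n" using m Mpow_Suc_subset by auto
    then have mc: "m \<in> carrier Q" using Mpow_submodule(2) R_carrier by auto
    have "x = (m \<oplus> (s (Suc n) \<ominus> s n)) \<oplus> s n" unfolding m using mc sc by algebra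
    moreover have "m \<oplus> (s (Suc n) \<ominus> s n) \<in> Mpow n"
      using submodule_overD(3)[OF Mpow_submodule(1) mn] s(4)[of n] t_Mpow by auto
    ultimately show "x \<in> \<omega> n" by (auto simp: \<omega>_def a_r_coset_def')
  qed
  then have \<omega>: "\<omega> \<in> carrier ?C"
    using s(1) by (auto simp: adic_completion_def Let_def FactRing_def A_RCOSETS_def' \<omega>_def Mpow_def)
  have pow: "(\<omega> [^]\<^bsub>?C\<^esub> k) n = Mpow n +>\<^bsub>RR\<^esub> (s n [^] k)" for k :: nat and n
  proof (induction k)
    case 0
    then show ?case by (simp add: adic_completion_def Let_def FactRing_def nat_pow_def Mpow_def)
  next
    case (Suc k)
    have "(\<omega> [^]\<^bsub>?C\<^esub> Suc k) n = (\<omega> [^]\<^bsub>?C\<^esub> k) n \<otimes>\<^bsub>RR Quot Mpow n\<^esub> \<omega> n"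
      by (simp add: adic_completion_def Let_def nat_pow_def Mpow_def)
    also have "\<dots> = Mpow n +>\<^bsub>RR\<^esub> (s n [^] k \<otimes> s n)"
      unfolding Suc using ideal.rcoset_mult_add[OF I[of n], of "s n [^] k" "s n"] s(1) R_closed
      by (simp add: FactRing_def \<omega>_def)
    finally show ?case by simp
  qed
  have "\<omega> [^]\<^bsub>?C\<^esub> Suc e = \<zero>\<^bsub>?C\<^esub>"
  proof
    fix n
    have "s n [^] Suc e \<in> Mpow n" using power t_Mpow by blast
    then have "Mpow n +>\<^bsub>RR\<^esub> (s n [^] Suc e) = Mpow n"
    proof -
      interpret I: ideal "Mpow n" RR by (rule I)
      show "s n [^] Suc e \<in> Mpow n \<Longrightarrow> ?thesis" by (rule I.a_rcos_const)
    qed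
    then show "(\<omega> [^]\<^bsub>?C\<^esub> Suc e) n = \<zero>\<^bsub>?C\<^esub> n"
      unfolding pow by (simp add: adic_completion_def Let_def FactRing_def Mpow_def)
  qed
  then have zero: "\<omega> = \<zero>\<^bsub>?C\<^esub>"
    using adm \<omega> unfolding admissible_ring_def reduced_ring_def by blast
  \<comment> \<open>At this index, vanishing of the sequence puts \<open>s n\<close> into
    \<open>M^n\<close>, hence into \<open>tR\<close>.\<close>
  obtain n where n: "Mpow n \<subseteq> (\<otimes>) t ` R" using Mpow_subset_tR by auto
  have "Mpow n +>\<^bsub>RR\<^esub> s n = Mpow n"
    using fun_cong[OF zero, of n] by (simp add: \<omega>_def adic_completion_def Let_def FactRing_def Mpow_def)
  moreover have "\<zero> \<oplus> s n \<in> Mpow n +>\<^bsub>RR\<^esub> s n"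
    using submodule_overD(2)[OF Mpow_submodule(1)] by (auto simp: a_r_coset_def')
  ultimately show False using n s(2) sc by auto
qed

text \<open>If no \<open>vmin k\<close> lies in \<open>tR\<close>, elements outside
  \<open>tR\<close> can be corrected to larger and larger values: modulo \<open>t^n R\<close> the
  ideals \<open>vmin k\<close> stabilize, so an element of the stable image is congruent to one of
  much larger value. The resulting sequence is the forbidden one.\<close>

lemma exists_vmin_subset: "\<exists>k. vmin k \<subseteq> (\<otimes>) t ` R"
proof (rule ccontr)
  assume neg: "\<not> ?thesis"
  \<comment> \<open>A bound for the values of \<open>t\<close> at all places, so that values of at
    least \<open>n T\<close> reach those of \<open>t^n\<close>.\<close>
  define T where "T = nat (Max (range vt))"
  have T: "int n * vt i \<le> int (n * T)" for n i
  proof -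
    have "vt i \<le> Max (range vt)" by (rule Max_ge) auto
    then have "vt i \<le> int T" unfolding T_def by linarith
    then show ?thesis by (simp add: mult_left_mono)
  qed
  let ?t = "\<lambda>n::nat. (\<otimes>) (t [^] n) ` R"
  have tR: "submodule_over R (?t n)" "?t n \<subseteq> R" "t [^] n \<in> ?t n" for n
    using principal[of "t [^] n"] R_closed t by auto
  define Z where "Z n k = vmin k <+>\<^bsub>Q\<^esub> ?t n" for n k
  note Z = submodule_set_add[OF R_carrier(1) vmin_submodule(1) tR(1), folded Z_def]
  have "\<forall>n. \<exists>k0. \<forall>k\<ge>k0. Z n k = Z n k0"
  proof
    fix n
    have ZR: "Z n k \<subseteq> R" for k
      unfolding Z_def by (rule set_add_least[OF R_submodule vmin_submodule(2) tR(2)])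
    have Z_Suc: "Z n (Suc k) \<subseteq> Z n k" for k
      using vmin_antimono[of k "Suc k"] unfolding Z_def by (simp add: subset_iff mem_set_add) blast
    have tZ: "t [^] n \<in> Z n k" for k by (rule subsetD[OF Z(3) tR(3)])
    show "\<exists>k0. \<forall>k\<ge>k0. Z n k = Z n k0"
      by (rule decreasing_stabilizes[of "Z n", OF Z(1) ZR Z_Suc reg_pow[OF t(2)] tZ]) (rule exI)
  qed
  from choice[OF this] obtain \<kappa> where \<kappa>: "\<forall>n. \<forall>k\<ge>\<kappa> n. Z n k = Z n (\<kappa> n)" by (elim exE)
  \<comment> \<open>The summand \<open>n * T\<close> lets \<open>s n\<close> be divided by
    \<open>t^n\<close> without negative values; the sum makes \<open>K\<close> increasing and puts
    \<open>K n\<close> beyond the index where the ideals modulo \<open>t^(n+1)\<close> stop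
    changing.\<close>
  define K where "K n = n * T + (\<Sum>m\<le>Suc n. \<kappa> m)" for n
  have K_mono: "K n \<le> K (Suc n)" for n by (auto simp: K_def)
  have K_ge: "K n \<ge> \<kappa> (Suc n)" "K n \<ge> n * T" for n by (auto simp: K_def)
  have "\<exists>s. \<forall>n. (s n \<in> vmin (K n) \<and> s n \<notin> (\<otimes>) t ` R) \<and> s (Suc n) \<ominus> s n \<in> ?t (Suc n)"
  proof (rule dependent_nat_choice)
    show "\<exists>x. x \<in> vmin (K 0) \<and> x \<notin> (\<otimes>) t ` R" using neg by blast
    fix x n assume x: "x \<in> vmin (K n) \<and> x \<notin> (\<otimes>) t ` R"
    have "Z (Suc n) (K n) = Z (Suc n) (\<kappa> (Suc n))" "Z (Suc n) (K (Suc n)) = Z (Suc n) (\<kappa> (Suc n))"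
      using spec[OF spec[OF \<kappa>, of "Suc n"], of "K n"] spec[OF spec[OF \<kappa>, of "Suc n"], of "K (Suc n)"]
        K_ge(1)[of n] K_mono[of n] by simp_all
    moreover have "x \<in> Z (Suc n) (K n)" using Z(2) x by blast
    ultimately have "x \<in> Z (Suc n) (K (Suc n))" by simp
    then obtain y r where yr: "y \<in> vmin (K (Suc n))" "r \<in> R" "x = y \<oplus> t [^] Suc n \<otimes> r"
      unfolding Z_def mem_set_add by auto
    have c: "y \<in> carrier Q" "r \<in> carrier Q" "t [^] Suc n \<in> carrier Q" "y \<in> R"
      using yr vmin_submodule(2) R_carrier t by auto
    have "y \<ominus> x = t [^] Suc n \<otimes> (\<ominus> r)" unfolding yr(3) using c(1-3) by algebra
    then have diff: "y \<ominus> x \<in> ?t (Suc n)" using R_closed(3)[OF yr(2)] by blast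
    have "y \<notin> (\<otimes>) t ` R"
    proof
      assume "y \<in> (\<otimes>) t ` R"
      then obtain z where z: "z \<in> R" "y = t \<otimes> z" by auto
      have zc: "z \<in> carrier Q" using z R_carrier by auto
      have "x = t \<otimes> (z \<oplus> t [^] n \<otimes> r)"
        unfolding yr(3) z(2) using c(2) zc t by (simp add: r_distr m_assoc m_lcomm)
      moreover have "z \<oplus> t [^] n \<otimes> r \<in> R" using z yr t R_closed by auto
      ultimately show False using x by blast
    qed
    then show "\<exists>y. (y \<in> vmin (K (Suc n)) \<and> y \<notin> (\<otimes>) t ` R) \<and> y \<ominus> x \<in> ?t (Suc n)"
      using yr diff by blast
  qed
  then obtain s where s: "\<And>n. s n \<in> vmin (K n)" "\<And>n. s n \<notin> (\<otimes>) t ` R"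
    "\<And>n. s (Suc n) \<ominus> s n \<in> ?t (Suc n)" by blast
  show False
  proof (rule no_infinite_value_sequence)
    show "s n \<in> R" for n using s(1) vmin_submodule(2) by auto
    show "s n \<notin> (\<otimes>) t ` R" for n by (rule s(2))
    show "vge i (int n * vt i) (s n)" for n i
    proof -
      have "int n * vt i \<le> int (K n)" using T[of n i] K_ge(2)[of n] by linarith
      then show ?thesis using s(1)[of n] vge_mono[of i "int (K n)" "s n"] by (auto simp: vmin_def)
    qed
    show "s (Suc n) \<ominus> s n \<in> ?t n" for n
    proof -
      obtain r where r: "r \<in> R" "s (Suc n) \<ominus> s n = t [^] Suc n \<otimes> r" using s(3)[of n] by auto
      then have "s (Suc n) \<ominus> s n = t [^] n \<otimes> (t \<otimes> r)" using t R_carrier by (simp add: m_assoc)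
      then show ?thesis using r t R_closed by auto
    qed
  qed
qed

text \<open>Factors \<open>t\<close> are removed one at a time: \<open>t^(j+1) x\<close> lies in
  \<open>R\<close> with all values at least \<open>k\<close>, hence in \<open>tR\<close>, and
  cancelling \<open>t\<close> puts \<open>t^j x\<close> into \<open>R\<close>.\<close>

lemma exists_conductor_R: "\<exists>k::nat. \<forall>x\<in>carrier Q. (\<forall>i. vge i (int k) x) \<longrightarrow> x \<in> R"
proof -
  obtain k where k: "vmin k \<subseteq> (\<otimes>) t ` R" using exists_vmin_subset by auto
  have "x \<in> R" if x: "x \<in> carrier Q" "\<And>i. vge i (int k) x" for x
  proof -
    obtain m :: nat where m: "t [^] m \<otimes> x \<in> R" using t_power_denominator[OF x(1)] by auto
    have "t [^] j \<otimes> x \<in> R \<Longrightarrow> x \<in> R" for j :: nat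
    proof (induction j)
      case (Suc j)
      have "vge i (int k) (t [^] Suc j \<otimes> x)" for i
        using vge_R_mult[OF _ x(2)] R_closed t by auto
      then have "t [^] Suc j \<otimes> x \<in> (\<otimes>) t ` R" using k Suc.prems by (auto simp: vmin_def)
      then obtain r where r: "r \<in> R" "t [^] Suc j \<otimes> x = t \<otimes> r" by auto
      have "t \<otimes> (t [^] j \<otimes> x) = t \<otimes> r" using r x(1) t by (simp add: m_ac)
      then have "t [^] j \<otimes> x = r" using r x(1) t R_carrier by simp
      then show ?case using Suc.IH r by simp
    qed (use x in simp)
    then show ?thesis using m by blast
  qed
  then show ?thesis by blast
qed

text \<open>Krull intersection for the powers of \<open>t\<close>. The ideals generated by
  \<open>x / t^n\<close> increase, so at a stable stage \<open>z = x / t^(n+1)\<close> satisfies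
  \<open>z = t z r\<close>, and \<open>1 - t r\<close> is a unit.\<close>

lemma zero_if_divisible:
  assumes x: "x \<in> R" and y: "\<And>n::nat. \<exists>y\<in>R. x = t [^] n \<otimes> y"
  shows "x = \<zero>"
proof -
  obtain f where f: "\<And>n. f n \<in> R" "\<And>n::nat. x = t [^] n \<otimes> f n" using y by metis
  have fc: "f n \<in> carrier Q" for n using f R_carrier by auto
  have step: "f n = t \<otimes> f (Suc n)" for n
  proof -
    have "t [^] n \<otimes> f n = t [^] n \<otimes> (t \<otimes> f (Suc n))"
      using f(2)[of n] f(2)[of "Suc n"] fc t by (simp add: m_assoc)
    then show ?thesis using fc t Units_l_cancel[OF Units_pow_closed[OF t(5)]] by auto
  qed
  let ?S = "range (\<lambda>n. (\<otimes>) (f n) ` R)"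
  obtain N where N: "N \<in> ?S" "\<And>Y. Y \<in> ?S \<Longrightarrow> N \<subseteq> Y \<Longrightarrow> Y = N"
    by (rule maximal_submodule[of ?S]) (use principal f R_closed in auto)
  then obtain n where n: "N = (\<otimes>) (f n) ` R" by auto
  have "(\<otimes>) (f n) ` R \<subseteq> (\<otimes>) (f (Suc n)) ` R"
  proof safe
    fix r assume r: "r \<in> R"
    have "f n \<otimes> r = f (Suc n) \<otimes> (t \<otimes> r)" unfolding step[of n] using fc t r R_carrier by (simp add: m_ac)
    then show "f n \<otimes> r \<in> (\<otimes>) (f (Suc n)) ` R" using r t R_closed by auto
  qed
  then have "(\<otimes>) (f (Suc n)) ` R = (\<otimes>) (f n) ` R" using N(2)[of "(\<otimes>) (f (Suc n)) ` R"] n by auto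
  then have "f (Suc n) \<in> (\<otimes>) (f n) ` R" using principal(3)[OF f(1)] by blast
  then obtain r where r: "r \<in> R" "f (Suc n) = f n \<otimes> r" by auto
  have rc: "r \<in> carrier Q" using r R_carrier by auto
  let ?z = "f (Suc n)"
  have "?z = t \<otimes> ?z \<otimes> r" using r(2) step[of n] by simp
  then have "?z \<ominus> t \<otimes> ?z \<otimes> r = \<zero>" using fc rc t by (metis m_closed r_neg a_minus_def)
  moreover have "?z \<otimes> (\<one> \<ominus> t \<otimes> r) = ?z \<ominus> t \<otimes> ?z \<otimes> r" using fc rc t by algebra
  ultimately have z: "?z \<otimes> (\<one> \<ominus> t \<otimes> r) = \<zero>" by simp
  have "veq i 0 (\<one> \<ominus> t \<otimes> r)" for i
  proof -
    have "vge i 1 (r \<otimes> t)" using vge_R_mult[OF r(1)] veq_vge_iff[OF veq_t] vt_pos by auto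
    then have "vge i 1 (\<ominus> (t \<otimes> r))" using vge_neg rc t by (simp add: m_comm)
    then show ?thesis unfolding a_minus_def by (intro veq_add[OF veq_one]) simp
  qed
  then have "\<one> \<ominus> t \<otimes> r \<notin> M"
    using vge_one_iff[of "\<one> \<ominus> t \<otimes> r"] r t R_closed by (auto simp: veq_iff)
  then obtain d where d: "d \<in> R" "(\<one> \<ominus> t \<otimes> r) \<otimes> d = \<one>"
    using unit_outside_M[of "\<one> \<ominus> t \<otimes> r"] r t R_closed by auto
  have dc: "d \<in> carrier Q" using d R_carrier by auto
  have "?z = ?z \<otimes> ((\<one> \<ominus> t \<otimes> r) \<otimes> d)" using d fc by simp
  also have "\<dots> = (?z \<otimes> (\<one> \<ominus> t \<otimes> r)) \<otimes> d" using fc rc t dc by (intro m_assoc[symmetric]) auto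
  also have "\<dots> = \<zero>" using z dc by simp
  finally show ?thesis using f(2)[of "Suc n"] t by simp
qed

text \<open>If \<open>y\<close> in \<open>R\<close> is killed by \<open>t^m x\<close>, all its
  values are infinite; so are those of \<open>y / t^n\<close>, which therefore lies in
  \<open>R\<close> by the conductor. Then \<open>y\<close> is divisible by all powers of
  \<open>t\<close> and vanishes, so \<open>t^m x\<close> is regular.\<close>

lemma unit_if_finite_values:
  assumes x: "x \<in> carrier Q" and fin: "\<And>i. v i x \<noteq> Pinf"
  shows "x \<in> Units Q"
proof -
  obtain k :: nat where k: "\<And>x. x \<in> carrier Q \<Longrightarrow> (\<And>i. vge i (int k) x) \<Longrightarrow> x \<in> R"
    using exists_conductor_R by blast
  obtain m :: nat where m: "t [^] m \<otimes> x \<in> R" using t_power_denominator[OF x] by auto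
  have tm: "t [^] m \<in> Units Q" by (rule Units_pow_closed[OF t(5)])
  let ?a = "t [^] m \<otimes> x"
  have ac: "?a \<in> carrier Q" using m R_carrier by auto
  have afin: "v i ?a \<noteq> Pinf" for i
    using veq_t_pow[of i m] fin[of i] valuation(2)[of "t [^] m" x i] x t
    by (cases rule: v_cases[OF x, of i]) (auto simp: veq_def)
  have "y = \<zero>" if y: "y \<in> R" "?a \<otimes> y = \<zero>" for y
  proof (rule zero_if_divisible[OF y(1)])
    have yc: "y \<in> carrier Q" using y R_carrier by auto
    have yinf: "v i y = Pinf" for i
      using valuation(2)[OF ac yc, of i] y(2) v_zero[of i] afin[of i]
      by (cases rule: v_cases[OF yc, of i]; cases rule: v_cases[OF ac, of i]) auto
    fix n :: nat
    have tn: "t [^] n \<in> Units Q" by (rule Units_pow_closed[OF t(5)])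
    let ?y = "y \<otimes> inv (t [^] n)"
    have "?y \<in> R"
      using yc tn yinf by (intro k vge_Pinf v_Pinf_mult) auto
    moreover have "y = t [^] n \<otimes> ?y"
    proof -
      have "t [^] n \<otimes> ?y = y \<otimes> (t [^] n \<otimes> inv (t [^] n))"
        using yc tn t by (intro m_lcomm) auto
      then show ?thesis using tn yc by simp
    qed
    ultimately show "\<exists>z\<in>R. y = t [^] n \<otimes> z" by blast
  qed
  then have "reg ?a" using m by (simp add: reg_def)
  then have "?a \<in> Units Q" by (rule reg_unit)
  then have "inv (t [^] m) \<otimes> ?a \<in> Units Q" using tm by simp
  moreover have "inv (t [^] m) \<otimes> ?a = x" by (rule Units_cancel(1)[OF tm x])
  ultimately show ?thesis by simp
qed

lemma regular_iff: "x \<in> regular_elements Q \<longleftrightarrow> x \<in> Units Q"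
proof
  assume x: "x \<in> regular_elements Q"
  then have xc: "x \<in> carrier Q" by (simp add: regular_elements_def)
  obtain m :: nat where m: "t [^] m \<otimes> x \<in> R" using t_power_denominator[OF xc] by auto
  have tm: "t [^] m \<in> Units Q" by (rule Units_pow_closed[OF t(5)])
  have "y = \<zero>" if y: "y \<in> R" "(t [^] m \<otimes> x) \<otimes> y = \<zero>" for y
  proof -
    have yc: "y \<in> carrier Q" using y R_carrier by auto
    have "t [^] m \<otimes> (x \<otimes> y) = t [^] m \<otimes> \<zero>" using y(2) xc yc t by (simp add: m_assoc)
    then have "x \<otimes> y = \<zero>" using Units_l_cancel[OF tm] xc yc by blast
    then show ?thesis using x yc by (auto simp: regular_elements_def)
  qed
  then have "reg (t [^] m \<otimes> x)" using m by (simp add: reg_def)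
  then have u: "t [^] m \<otimes> x \<in> Units Q" by (rule reg_unit)
  then have "inv (t [^] m) \<otimes> (t [^] m \<otimes> x) \<in> Units Q" using tm by simp
  then show "x \<in> Units Q" using Units_cancel(1)[OF tm xc] by simp
qed (rule Units_regular)

lemma regular_iff_finite_values:
  "x \<in> regular_elements Q \<longleftrightarrow> x \<in> carrier Q \<and> (\<forall>i. v i x \<noteq> Pinf)"
proof
  assume "x \<in> regular_elements Q"
  then have x: "x \<in> Units Q" by (simp add: regular_iff)
  have "v i x \<noteq> Pinf" for i
  proof -
    obtain n where "veq i n x" by (rule veq_unit[OF x])
    then show ?thesis by (simp add: veq_def)
  qed
  then show "x \<in> carrier Q \<and> (\<forall>i. v i x \<noteq> Pinf)" using x by auto
qed (auto simp: regular_iff intro: unit_if_finite_values)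

end

section \<open>Approximation and fractional ideals\<close>

text \<open>Pigeonhole: each \<open>k\<close> in \<open>K\<close> rules out at most one candidate,
  and there are as many candidates as places, more than \<open>K\<close> has elements.\<close>

lemma exists_avoiding:
  fixes B :: "'n::finite \<Rightarrow> 'n \<Rightarrow> bool"
  assumes "K \<noteq> UNIV" and unique: "\<And>k l m. k \<in> K \<Longrightarrow> B k l \<Longrightarrow> B k m \<Longrightarrow> l = m"
  shows "\<exists>l. \<forall>k\<in>K. \<not> B k l"
proof (rule ccontr)
  assume "\<not> ?thesis"
  then have ex: "\<And>l. \<exists>k\<in>K. B k l" by auto
  have "UNIV \<subseteq> (\<lambda>k. THE l. B k l) ` K"
  proof
    fix l :: 'n
    obtain k where k: "k \<in> K" "B k l" using ex by auto
    then have "(THE l. B k l) = l" using unique by blast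
    then show "l \<in> (\<lambda>k. THE l. B k l) ` K" using k by force
  qed
  then have "card (UNIV :: 'n set) \<le> card K"
    by (meson card_image_le card_mono finite finite_imageI le_trans)
  moreover have "card K < card (UNIV :: 'n set)" using assms(1) by (intro psubset_card_mono) auto
  ultimately show False by simp
qed

context admissible_valuations begin

text \<open>The product \<open>z\<close> of powers of \<open>t\<close> and \<open>x\<close> has
  value zero at \<open>i\<close> and positive value at \<open>j\<close>. Subtracting its residue at
  \<open>i\<close> exchanges the roles: \<open>u\<close> is positive at \<open>i\<close> and of
  value zero at \<open>j\<close>. A high power of \<open>u\<close> then removes the pole at
  \<open>i\<close> of an element with value \<open>-1\<close> at \<open>j\<close>.\<close>

lemma valuation_ring_not_subset_sym:
  assumes x: "x \<in> carrier Q" "\<not> vge i 0 x" "vge j 0 x"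
  shows "\<exists>y\<in>carrier Q. \<not> vge j 0 y \<and> vge i 0 y"
proof -
  obtain k where k: "veq i (- k) x" "k \<ge> 1"
    using x(1,2) that by (cases rule: v_cases[OF x(1), of i]) (force simp: vge_def veq_def)+
  define z where "z = t [^] nat k \<otimes> x [^] nat (vt i)"
  have vt: "vt i \<ge> 1" "vt j \<ge> 1" using vt_pos by auto
  have zi: "veq i 0 z"
    using veq_mult[OF veq_t_pow[of i "nat k"] veq_pow[OF k(1), of "nat (vt i)"]] k(2) vt
    by (simp add: z_def)
  have "vge j (k * vt j) z"
    using vge_mult[OF veq_vge[OF veq_t_pow[of j "nat k"]] vge_pow[OF x(3), of "nat (vt i)"]] k(2)
    by (simp add: z_def)
  moreover have "k * vt j \<ge> 1" using k(2) vt by (metis mult_mono mult_1 zero_le_one order_trans)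
  ultimately have zj: "vge j 1 z" by (rule vge_mono)
  have zc: "z \<in> carrier Q" using zi by (rule veq_carrier)
  obtain c where c: "c \<in> R" "vge i 1 (z \<ominus> c)" using residue[OF veq_vge[OF zi]] by blast
  have cc: "c \<in> carrier Q" using c R_carrier by auto
  have "c \<notin> M"
  proof
    assume "c \<in> M"
    then have "vge i 1 c" using vge_one_iff c by simp
    then have "vge i 1 ((z \<ominus> c) \<oplus> c)" using vge_add c by blast
    moreover have "(z \<ominus> c) \<oplus> c = z" using zc cc by algebra
    ultimately show False using zi by (simp add: veq_iff)
  qed
  define u where "u = z \<ominus> c"
  have "veq j 0 (\<ominus> c \<oplus> z)" using veq_add[OF veq_neg[OF veq_unit_R[OF c(1) \<open>c \<notin> M\<close>, of j]]] zj by simp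
  then have uj: "veq j 0 u" using zc cc by (simp add: u_def a_minus_def a_comm)
  obtain y where y: "veq j (- 1) y" using exists_veq by blast
  have yc: "y \<in> carrier Q" using y by (rule veq_carrier)
  obtain n where n: "vge i n y"
    using yc by (cases rule: v_cases[OF yc, of i]) (auto simp: vge_def)
  let ?w = "y \<otimes> u [^] nat (- n)"
  have "vge i (n + int (nat (- n)) * 1) ?w" using vge_mult[OF n vge_pow[of i 1 u "nat (- n)"]] c by (simp add: u_def)
  then have "vge i 0 ?w" by (rule vge_mono) auto
  moreover have "veq j (- 1) ?w" using veq_mult[OF y veq_pow[OF uj, of "nat (- n)"]] by simp
  then have "\<not> vge j 0 ?w" "?w \<in> carrier Q" using veq_vge_iff veq_carrier by auto
  ultimately show ?thesis by blast
qed

lemma valuation_rings_incomparable: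
  assumes "i \<noteq> j"
  obtains x where "x \<in> carrier Q" "\<not> vge i 0 x" "vge j 0 x"
proof -
  have "{x. vge i 0 x} \<noteq> {x. vge j 0 x}" using valuation_ring_inj assms by blast
  then obtain x where "vge i 0 x \<noteq> vge j 0 x" by blast
  then show ?thesis
    using that valuation_ring_not_subset_sym[of x i j] valuation_ring_not_subset_sym[of x j i] vge_carrier
    by blast
qed

definition res :: "'n \<Rightarrow> 'a" where
  "res = (SOME c. range c \<subseteq> R \<and> (\<forall>k l. c k \<ominus> c l \<in> M \<longrightarrow> k = l))"

lemma res: "res k \<in> R" "res k \<in> carrier Q" "res k \<ominus> res l \<in> M \<Longrightarrow> k = l"
proof -
  have "range res \<subseteq> R \<and> (\<forall>k l. res k \<ominus> res l \<in> M \<longrightarrow> k = l)"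
    unfolding res_def by (rule someI_ex[OF exists_residues])
  then show "res k \<in> R" "res k \<in> carrier Q" "res k \<ominus> res l \<in> M \<Longrightarrow> k = l"
    using R_carrier by (auto simp: image_subset_iff)
qed

text \<open>
  The residues of \<open>x\<close> at the places where it is integral do not exhaust the residue field, so
  \<open>x - c\<close> is a unit for some \<open>c \<in> R\<close>, and its inverse is integral everywhere.
\<close>

lemma separate_valuations:
  assumes "i \<noteq> j"
  shows "\<exists>u. (\<forall>k. vge k 0 u) \<and> veq j 0 u \<and> vge i 1 u"
proof -
  obtain x where x: "x \<in> carrier Q" "\<not> vge i 0 x" "vge j 0 x"
    using valuation_rings_incomparable[OF assms] by blast
  have "\<exists>l. \<forall>k\<in>{k. vge k 0 x}. \<not> vge k 1 (x \<ominus> res l)"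
  proof (rule exists_avoiding)
    show "{k. vge k 0 x} \<noteq> UNIV" using x by auto
    fix k l m assume "vge k 1 (x \<ominus> res l)" "vge k 1 (x \<ominus> res m)"
    then have "vge k 1 ((x \<ominus> res m) \<ominus> (x \<ominus> res l))" using vge_minus by blast
    moreover have "(x \<ominus> res m) \<ominus> (x \<ominus> res l) = res l \<ominus> res m" using x res(2)[of l] res(2)[of m] by algebra
    ultimately have "res l \<ominus> res m \<in> M" using vge_one_iff res(1) R_closed by auto
    then show "l = m" by (rule res)
  qed
  then obtain c where c: "c \<in> R" "\<And>k. vge k 0 x \<Longrightarrow> \<not> vge k 1 (x \<ominus> c)" using res(1) by blast
  have cc: "c \<in> carrier Q" using c R_carrier by auto
  let ?w = "x \<ominus> c"
  have wc: "?w \<in> carrier Q" using x cc by simp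
  have w0: "veq k 0 ?w" if "vge k 0 x" for k
    using c(2)[OF that] vge_minus[OF that vge_R[OF c(1)]] by (simp add: veq_iff)
  have wneg: "\<exists>n<0. veq k n ?w" if neg: "\<not> vge k 0 x" for k
  proof -
    obtain n where n: "veq k n x" "n < 0"
      using x(1) neg by (cases rule: v_cases[OF x(1), of k]) (auto simp: vge_def veq_def)
    then have "vge k (n + 1) (\<ominus> c)" using vge_mono[OF vge_neg[OF vge_R[OF c(1)]], of "n + 1"] by simp
    then have "veq k n ?w" unfolding a_minus_def using veq_add n by blast
    then show ?thesis using n by auto
  qed
  have "v k ?w \<noteq> Pinf" for k using w0[of k] wneg[of k] by (cases "vge k 0 x") (auto simp: veq_def)
  then have w: "?w \<in> Units Q" by (rule unit_if_finite_values[OF wc])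
  \<comment> \<open>Inversion makes the negative values positive, so \<open>u\<close> is positive
    exactly where \<open>x\<close> had a pole; \<open>i\<close> is such a place and \<open>j\<close>
    is not.\<close>
  let ?u = "inv ?w"
  have u0: "veq k 0 ?u" if "vge k 0 x" for k using veq_inv[OF w w0[OF that]] by simp
  have uneg: "vge k 1 ?u" if "\<not> vge k 0 x" for k
  proof -
    obtain n where n: "n < 0" "veq k n ?w" using wneg[OF \<open>\<not> vge k 0 x\<close>] by auto
    then show ?thesis using veq_vge_iff[OF veq_inv[OF w n(2)]] by simp
  qed
  have "vge k 0 ?u" for k
    using u0[of k] uneg[of k] by (cases "vge k 0 x") (auto intro: veq_vge vge_mono)
  then show ?thesis using u0[OF x(3)] uneg[OF x(2)] by blast
qed

text \<open>Multiplying separating elements gives \<open>u\<close> of value zero at \<open>j\<close>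
  and positive elsewhere; a power of it lifts the other values of any \<open>y\<close> with value
  \<open>a\<close> at \<open>j\<close> to the prescribed bounds.\<close>

lemma approximation:
  fixes b :: "'n \<Rightarrow> int"
  shows "\<exists>z. veq j a z \<and> (\<forall>i. i \<noteq> j \<longrightarrow> vge i (b i) z)"
proof -
  have "\<exists>u. (\<forall>k. vge k 0 u) \<and> veq j 0 u \<and> (\<forall>i\<in>S. vge i 1 u)" if "j \<notin> S" for S
    using finite[of S] that
  proof (induction S)
    case empty
    show ?case using veq_one veq_vge[OF veq_one] by (intro exI[of _ \<one>]) auto
  next
    case (insert i S)
    then obtain u where u: "\<And>k. vge k 0 u" "veq j 0 u" "\<And>i. i \<in> S \<Longrightarrow> vge i 1 u" by auto
    obtain w where w: "\<And>k. vge k 0 w" "veq j 0 w" "vge i 1 w"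
      using separate_valuations[of i j] insert by auto
    have "vge k 0 (u \<otimes> w)" for k using vge_mult[OF u(1) w(1)] by simp
    moreover have "veq j 0 (u \<otimes> w)" using veq_mult[OF u(2) w(2)] by simp
    moreover have "vge k 1 (u \<otimes> w)" if "k \<in> insert i S" for k
      using vge_mult[OF u(1) w(3)] vge_mult[OF u(3) w(1)] that by auto
    ultimately show ?case by blast
  qed
  from this[of "- {j}"] obtain u where u: "veq j 0 u" "\<And>i. i \<noteq> j \<Longrightarrow> vge i 1 u" by auto
  obtain y where y: "veq j a y" using exists_veq by blast
  have yc: "y \<in> carrier Q" using y by (rule veq_carrier)
  have "\<exists>n. vge i n y" for i using yc by (cases rule: v_cases[OF yc, of i]) (auto simp: vge_def)
  then obtain n where n: "\<And>i. vge i (n i) y" by metis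
  define N where "N = nat (Max (range (\<lambda>i. b i - n i)))"
  have N: "b i \<le> n i + int N" for i
  proof -
    have "b i - n i \<le> Max (range (\<lambda>i. b i - n i))" by (rule Max_ge) auto
    then show ?thesis unfolding N_def by linarith
  qed
  have "veq j a (y \<otimes> u [^] N)" using veq_mult[OF y veq_pow[OF u(1), of N]] by simp
  moreover have "vge i (b i) (y \<otimes> u [^] N)" if "i \<noteq> j" for i
    using vge_mono[OF vge_mult[OF n vge_pow[OF u(2)[OF that], of N]], of "b i"] N[of i] by simp
  ultimately show ?thesis by blast
qed

text \<open>Places are added one at a time. Each summand exceeds the target by at least one away
  from its own place, so no value already reached is cancelled.\<close>

lemma exists_values:
  fixes a :: "'n \<Rightarrow> int"
  shows "\<exists>z. \<forall>i. veq i (a i) z"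
proof -
  have "\<exists>z. (\<forall>i\<in>S. veq i (a i) z) \<and> (\<forall>i. i \<notin> S \<longrightarrow> vge i (a i + 1) z)" for S
    using finite[of S]
  proof (induction S)
    case empty
    show ?case using vge_zero by (intro exI[of _ \<zero>]) auto
  next
    case (insert j S)
    then obtain z where z: "\<And>i. i \<in> S \<Longrightarrow> veq i (a i) z" "\<And>i. i \<notin> S \<Longrightarrow> vge i (a i + 1) z" by auto
    obtain w where w: "veq j (a j) w" "\<And>i. i \<noteq> j \<Longrightarrow> vge i (a i + 1) w"
      using approximation[of j "a j" "\<lambda>i. a i + 1"] by auto
    have c: "z \<in> carrier Q" "w \<in> carrier Q"
      using z[of j] w insert by (auto simp: veq_carrier vge_carrier)
    have "veq i (a i) (z \<oplus> w)" if "i \<in> insert j S" for i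
    proof (cases "i = j")
      case True
      then show ?thesis using veq_add[OF w(1) z(2)[OF insert.hyps(2)]] c by (simp add: a_comm)
    next
      case False
      then show ?thesis using veq_add[OF z(1) w(2)] that by auto
    qed
    moreover have "vge i (a i + 1) (z \<oplus> w)" if "i \<notin> insert j S" for i
      using that z(2) w(2) vge_add by auto
    ultimately show ?case by blast
  qed
  from this[of UNIV] show ?thesis by auto
qed

lemma unit_if_veq: "(\<And>i. veq i (a i) x) \<Longrightarrow> x \<in> Units Q"
  by (rule unit_if_finite_values) (auto simp: veq_def)

section \<open>Regular fractional ideals and the modules \<open>V(a)\<close>\<close>

abbreviation rfi :: "'a set \<Rightarrow> bool" where "rfi \<equiv> regular_fractional_ideal Q R"

lemma rfi_iff:
  "rfi N \<longleftrightarrow> submodule_over R N \<and> (\<exists>d. reg d \<and> (\<forall>x\<in>N. d \<otimes> x \<in> R)) \<and> (\<exists>x\<in>N. x \<in> Units Q)"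
proof -
  have "additive_subgroup N Q \<and> (\<forall>a\<in>R. \<forall>x\<in>N. a \<otimes> x \<in> N) \<longleftrightarrow> submodule_over R N"
  proof
    assume "additive_subgroup N Q \<and> (\<forall>a\<in>R. \<forall>x\<in>N. a \<otimes> x \<in> N)"
    then show "submodule_over R N"
      using additive_subgroup.a_subset additive_subgroup.a_closed additive_subgroup.zero_closed
      by (auto simp: submodule_over_def)
  next
    assume N: "submodule_over R N"
    have "\<ominus> x \<in> N" if "x \<in> N" for x
      using submodule_minus[OF R_subcring N submodule_overD(2)[OF N] that] submodule_overD(5)[OF N that]
      by (simp add: a_minus_def)
    then have "subgroup N (add_monoid Q)"
      unfolding subgroup_def using submodule_overD[OF N] by (auto simp: a_inv_def)
    then show "additive_subgroup N Q \<and> (\<forall>a\<in>R. \<forall>x\<in>N. a \<otimes> x \<in> N)"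
      using submodule_overD(4)[OF N] by (auto intro: additive_subgroupI)
  qed
  then show ?thesis
    unfolding regular_fractional_ideal_def fractional_ideal_def regular_elements_RR
    using regular_iff by blast
qed

lemma rfiE:
  assumes "rfi N"
  obtains d x where "reg d" "\<forall>x\<in>N. d \<otimes> x \<in> R" "x \<in> N" "x \<in> Units Q"
  using assms unfolding rfi_iff by blast

lemma rfi_submodule: "rfi N \<Longrightarrow> submodule_over R N"
  by (simp add: rfi_iff)

definition vset :: "('n \<Rightarrow> int) \<Rightarrow> 'a set" where
  "vset a = {x. \<forall>i. vge i (a i) x}"

lemma vset_carrier: "x \<in> vset a \<Longrightarrow> x \<in> carrier Q"
  unfolding vset_def using vge_carrier by blast

lemma vset_antimono: "(\<And>i. a i \<le> b i) \<Longrightarrow> vset b \<subseteq> vset a"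
  by (auto simp: vset_def intro: vge_mono)

lemma vset_submodule: "submodule_over R (vset a)"
  by (rule submodule_overI)
    (use vset_carrier in \<open>auto simp: vset_def intro: vge_zero vge_add vge_R_mult\<close>)

lemma exists_unit_vset: "\<exists>x\<in>vset a. x \<in> Units Q"
proof -
  obtain x where "\<And>i. veq i (a i) x" using exists_values by blast
  then have "x \<in> vset a" "x \<in> Units Q" using unit_if_veq[of a x] veq_vge by (auto simp: vset_def)
  then show ?thesis by blast
qed

lemma vset_rfi: "rfi (vset a)"
proof -
  obtain k :: nat where k: "\<And>x. x \<in> carrier Q \<Longrightarrow> (\<And>i. vge i (int k) x) \<Longrightarrow> x \<in> R"
    using exists_conductor_R by blast
  \<comment> \<open>Enough factors \<open>t\<close> to lift the bounds \<open>a\<close> to the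
    conductor bound \<open>k\<close>; each factor adds at least one at every place.\<close>
  define N where "N = nat (Max (range (\<lambda>i. int k - a i)))"
  have "t [^] N \<otimes> x \<in> R" if "x \<in> vset a" for x
  proof (rule k)
    show "t [^] N \<otimes> x \<in> carrier Q" using that vset_carrier t by simp
    fix i
    have "int k - a i \<le> Max (range (\<lambda>i. int k - a i))" by (rule Max_ge) auto
    then have "int k \<le> int N + a i" unfolding N_def by linarith
    also have "int N \<le> int N * vt i" using mult_left_mono[OF vt_pos[of i], of "int N"] by simp
    finally have "int k \<le> int N * vt i + a i" by simp
    then show "vge i (int k) (t [^] N \<otimes> x)"
      using vge_mono[OF vge_mult[OF veq_vge[OF veq_t_pow[of i N]]]] that by (auto simp: vset_def)
  qed
  then show ?thesis
    unfolding rfi_iff using vset_submodule reg_pow[OF t(2)] exists_unit_vset by blast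
qed

text \<open>For a unit \<open>x\<close> in \<open>N\<close> with values \<open>n\<close>, the module
  \<open>V(k + n)\<close> equals \<open>x V(k)\<close>, which lies in \<open>x R\<close>.\<close>

lemma rfi_contains_vset:
  assumes "rfi N"
  shows "\<exists>g. vset g \<subseteq> N"
proof -
  obtain x where x: "x \<in> N" "x \<in> Units Q" using assms rfi_iff by auto
  have N: "submodule_over R N" using assms by (rule rfi_submodule)
  obtain k :: nat where k: "\<And>x. x \<in> carrier Q \<Longrightarrow> (\<And>i. vge i (int k) x) \<Longrightarrow> x \<in> R"
    using exists_conductor_R by blast
  have "\<exists>n. veq i n x" for i using veq_unit[OF x(2)] by blast
  then obtain n where n: "\<And>i. veq i (n i) x" by metis
  have "y \<in> N" if y: "y \<in> vset (\<lambda>i. int k + n i)" for y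
  proof -
    have yc: "y \<in> carrier Q" using y by (rule vset_carrier)
    have "y \<otimes> inv x \<in> R"
    proof (rule k)
      show "vge i (int k) (y \<otimes> inv x)" for i
        using vge_mult[OF _ veq_vge[OF veq_inv[OF x(2) n]], of i "int k + n i" y] y by (simp add: vset_def)
    qed (use yc x in simp)
    then have "(y \<otimes> inv x) \<otimes> x \<in> N" using submodule_overD(4)[OF N] x by blast
    then show ?thesis using Units_cancel(3)[OF x(2) yc] by simp
  qed
  then show ?thesis by blast
qed

lemma rfi_lower_bound:
  assumes "rfi N"
  shows "\<exists>b. \<forall>x\<in>N. \<forall>i. vge i (b i) x"
proof -
  obtain d where d: "reg d" "\<forall>x\<in>N. d \<otimes> x \<in> R" using assms by (rule rfiE)
  note d = d(1) bspec[OF d(2)]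
  have du: "d \<in> Units Q" using d reg_unit by auto
  have "\<exists>n. veq i n d" for i using veq_unit[OF du] by blast
  then obtain n where n: "\<And>i. veq i (n i) d" by metis
  have "vge i (- n i) x" if x: "x \<in> N" for x i
  proof -
    have xc: "x \<in> carrier Q" using submodule_overD(5)[OF rfi_submodule[OF assms] x] .
    have "vge i (- n i + 0) (inv d \<otimes> (d \<otimes> x))"
      by (rule vge_mult[OF veq_vge[OF veq_inv[OF du n]] vge_R[OF d(2)[OF x]]])
    moreover have "inv d \<otimes> (d \<otimes> x) = x" by (rule Units_cancel(1)[OF du xc])
    ultimately show ?thesis by simp
  qed
  then show ?thesis by (intro exI[of _ "\<lambda>i. - n i"]) blast
qed

lemma rfi_set_add:
  assumes N: "rfi N" and P: "rfi P"
  shows "rfi (N <+>\<^bsub>Q\<^esub> P)"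
proof -
  note S = submodule_set_add[OF R_carrier(1) rfi_submodule[OF N] rfi_submodule[OF P]]
  obtain d where d: "reg d" "\<forall>x\<in>N. d \<otimes> x \<in> R" using N by (rule rfiE)
  note d = d(1) bspec[OF d(2)]
  obtain e where e: "reg e" "\<forall>x\<in>P. e \<otimes> x \<in> R" using P by (rule rfiE)
  note e = e(1) bspec[OF e(2)]
  have de: "d \<in> R" "e \<in> R" "d \<in> carrier Q" "e \<in> carrier Q" using d e R_carrier by (auto simp: reg_def)
  have "reg (d \<otimes> e)" using de reg_unit d e R_closed by (intro unit_reg) auto
  moreover have "(d \<otimes> e) \<otimes> x \<in> R" if x: "x \<in> N <+>\<^bsub>Q\<^esub> P" for x
  proof -
    obtain y z where yz: "y \<in> N" "z \<in> P" "x = y \<oplus> z" using x by (auto simp: mem_set_add)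
    have c: "y \<in> carrier Q" "z \<in> carrier Q"
      using yz submodule_overD(5) rfi_submodule N P by blast+
    have "(d \<otimes> e) \<otimes> x = e \<otimes> (d \<otimes> y) \<oplus> d \<otimes> (e \<otimes> z)" unfolding yz using c de by algebra
    then show ?thesis using d(2)[OF yz(1)] e(2)[OF yz(2)] de R_closed by simp
  qed
  ultimately show ?thesis unfolding rfi_iff using S N rfi_iff by blast
qed

lemma quotient_submodule:
  assumes J: "submodule_over R J" and I: "I \<subseteq> carrier Q"
  shows "submodule_over R (ideal_quotient Q J I)"
proof (rule submodule_overI)
  show "ideal_quotient Q J I \<subseteq> carrier Q" by (auto simp: ideal_quotient_def)
  show "\<zero> \<in> ideal_quotient Q J I" using submodule_overD(2)[OF J] I by (auto simp: ideal_quotient_def)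
  show "x \<oplus> y \<in> ideal_quotient Q J I" if "x \<in> ideal_quotient Q J I" "y \<in> ideal_quotient Q J I" for x y
    using that submodule_overD(3)[OF J] I by (auto simp: ideal_quotient_def l_distr subset_iff)
  show "a \<otimes> x \<in> ideal_quotient Q J I" if "a \<in> R" "x \<in> ideal_quotient Q J I" for a x
    using that submodule_overD(4)[OF J] I R_carrier by (auto simp: ideal_quotient_def m_assoc subset_iff)
qed

lemma quotient_rfi:
  assumes J: "rfi J" and I: "rfi I"
  shows "rfi (ideal_quotient Q J I)"
proof -
  note Js = rfi_submodule[OF J] and Is = rfi_submodule[OF I]
  obtain d y where d: "reg d" "\<forall>x\<in>I. d \<otimes> x \<in> R" and y: "y \<in> I" "y \<in> Units Q"
    using I by (rule rfiE)
  note d = d(1) bspec[OF d(2)]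
  obtain e z where e: "reg e" "\<forall>x\<in>J. e \<otimes> x \<in> R" and z: "z \<in> J" "z \<in> Units Q"
    using J by (rule rfiE)
  note e = e(1) bspec[OF e(2)]
  have c: "d \<in> Units Q" "e \<in> Units Q" "d \<in> R" "e \<in> R" using d e reg_unit by (auto simp: reg_def)
  obtain m :: nat where m: "t [^] m \<otimes> inv y \<in> R" using t_power_denominator y by blast
  have tm: "t [^] m \<in> Units Q" "t [^] m \<in> R" using Units_pow_closed[OF t(5)] t R_closed by auto
  \<comment> \<open>For the unit \<open>y\<close> of \<open>I\<close>, every \<open>x\<close> in the
    quotient is \<open>(x y) / y\<close> with \<open>x y\<close> in \<open>J\<close>;
    \<open>e\<close> clears the denominators of \<open>J\<close> and \<open>t^m\<close> that of
    \<open>1/y\<close>.\<close>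
  have "reg (t [^] m \<otimes> e)" using tm c R_closed by (intro unit_reg) auto
  moreover have "(t [^] m \<otimes> e) \<otimes> x \<in> R" if x: "x \<in> ideal_quotient Q J I" for x
  proof -
    have xc: "x \<in> carrier Q" and "x \<otimes> y \<in> J" using x y by (auto simp: ideal_quotient_def)
    then have "(t [^] m \<otimes> inv y) \<otimes> (e \<otimes> (x \<otimes> y)) \<in> R" using m e(2) R_closed by auto
    moreover have "(t [^] m \<otimes> inv y) \<otimes> (e \<otimes> (x \<otimes> y)) = ((t [^] m \<otimes> e) \<otimes> x) \<otimes> (inv y \<otimes> y)"
      using c tm xc y by (simp add: m_ac Units_closed del: Units_l_inv Units_r_inv)
    ultimately show ?thesis using c tm xc y by (simp add: Units_closed)
  qed
  \<comment> \<open>The unit required in the quotient: \<open>d\<close> maps \<open>I\<close> into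
    \<open>R\<close>, and \<open>R z\<close> lies in \<open>J\<close>.\<close>
  moreover have "d \<otimes> z \<in> ideal_quotient Q J I"
  proof -
    have "(d \<otimes> z) \<otimes> x \<in> J" if x: "x \<in> I" for x
    proof -
      have xc: "x \<in> carrier Q" using submodule_overD(5)[OF Is x] .
      have "(d \<otimes> z) \<otimes> x = (d \<otimes> x) \<otimes> z" using c z xc by (simp add: m_ac Units_closed)
      then show ?thesis using submodule_overD(4)[OF Js d(2)[OF x] z(1)] by simp
    qed
    then show ?thesis using c z by (simp add: ideal_quotient_def Units_closed)
  qed
  moreover have "d \<otimes> z \<in> Units Q" using c z by simp
  ultimately show ?thesis
    unfolding rfi_iff using quotient_submodule[OF Js submodule_overD(1)[OF Is]] by blast
qed

text \<open>Nonemptiness of a fiber without regularity of the witness: infinite values are allowed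
  outside \<open>K\<close>, so that sums can be formed freely.\<close>

definition attains :: "'a set \<Rightarrow> ('n \<Rightarrow> int) \<Rightarrow> 'n set \<Rightarrow> bool" where
  "attains N a K \<longleftrightarrow> (\<exists>x\<in>N. (\<forall>k\<in>K. veq k (a k) x) \<and> (\<forall>i. i \<notin> K \<longrightarrow> vge i (a i + 1) x))"

text \<open>The witness is \<open>x + c y\<close>. At a place of \<open>L\<close> at most one
  residue class of \<open>c\<close> makes the value too large, and \<open>L\<close> is proper, so
  some representative \<open>c\<close> works; on \<open>K - L\<close> the term \<open>c y\<close> is
  negligible.\<close>

lemma attains_Un:
  assumes N: "rfi N" and K: "attains N a K" "attains N a L"
  shows "attains N a (K \<union> L)"
proof (cases "L = UNIV")
  case False
  obtain x where x: "x \<in> N" "\<And>k. k \<in> K \<Longrightarrow> veq k (a k) x" "\<And>i. i \<notin> K \<Longrightarrow> vge i (a i + 1) x"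
    using K(1) by (auto simp: attains_def)
  obtain y where y: "y \<in> N" "\<And>k. k \<in> L \<Longrightarrow> veq k (a k) y" "\<And>i. i \<notin> L \<Longrightarrow> vge i (a i + 1) y"
    using K(2) by (auto simp: attains_def)
  have c: "x \<in> carrier Q" "y \<in> carrier Q" using x y submodule_overD(5)[OF rfi_submodule[OF N]] by auto
  have "\<exists>l. \<forall>k\<in>L. \<not> vge k (a k + 1) (x \<oplus> res l \<otimes> y)"
  proof (rule exists_avoiding[OF False])
    fix k l m assume k: "k \<in> L" and lm: "vge k (a k + 1) (x \<oplus> res l \<otimes> y)" "vge k (a k + 1) (x \<oplus> res m \<otimes> y)"
    have "vge k (a k + 1) ((x \<oplus> res l \<otimes> y) \<ominus> (x \<oplus> res m \<otimes> y))" using vge_minus[OF lm] .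
    moreover have "(x \<oplus> res l \<otimes> y) \<ominus> (x \<oplus> res m \<otimes> y) = (res l \<ominus> res m) \<otimes> y"
      using c res(2)[of l] res(2)[of m] by algebra
    ultimately have ge: "vge k (a k + 1) ((res l \<ominus> res m) \<otimes> y)" by simp
    have "res l \<ominus> res m \<in> M"
    proof (rule ccontr)
      assume "res l \<ominus> res m \<notin> M"
      then have "veq k 0 (res l \<ominus> res m)" using veq_unit_R res(1) R_closed by auto
      then have "veq k (a k) ((res l \<ominus> res m) \<otimes> y)" using veq_mult[OF _ y(2)[OF k]] by fastforce
      then show False using ge by (simp add: veq_iff)
    qed
    then show "l = m" by (rule res)
  qed
  then obtain l where l: "\<And>k. k \<in> L \<Longrightarrow> \<not> vge k (a k + 1) (x \<oplus> res l \<otimes> y)" by blast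
  let ?z = "x \<oplus> res l \<otimes> y"
  have "vge k (a k) x" for k using x(2,3)[of k] veq_vge vge_mono[of k "a k + 1" x "a k"] by fastforce
  moreover have "vge k (a k) y" for k using y(2,3)[of k] veq_vge vge_mono[of k "a k + 1" y "a k"] by fastforce
  ultimately have ge: "vge k (a k) ?z" for k using vge_add vge_R_mult res(1) by blast
  have "?z \<in> N" using x y res(1) submodule_overD(3,4)[OF rfi_submodule[OF N]] by blast
  moreover have "veq k (a k) ?z" if "k \<in> K \<union> L" for k
  proof (cases "k \<in> L")
    case True
    then show ?thesis using l ge by (simp add: veq_iff)
  next
    case False
    then show ?thesis using veq_add[OF x(2) vge_R_mult[OF res(1) y(3)]] that by auto
  qed
  moreover have "vge i (a i + 1) ?z" if "i \<notin> K \<union> L" for i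
    using vge_add[OF x(3) vge_R_mult[OF res(1) y(3)]] that by auto
  ultimately show ?thesis unfolding attains_def by blast
qed (use K in auto)

section \<open>Value sets and conductors in terms of elements\<close>

lemma value_vector_eq: "(\<And>i. veq i (a i) x) \<Longrightarrow> value_vector v x $ i = a i"
  by (simp add: value_vector_def veq_def)

text \<open>Adding to \<open>x\<close> an element of \<open>N\<close> with values above
  \<open>\<alpha>\<close> and above all finite values of \<open>x\<close> removes the infinite
  values and changes no finite one.\<close>

lemma fiber_nonempty_iff:
  assumes N: "rfi N"
  shows "fiber K (value_set Q v N) \<alpha> \<noteq> {} \<longleftrightarrow> attains N (($) \<alpha>) K"
proof
  assume "fiber K (value_set Q v N) \<alpha> \<noteq> {}"
  then obtain \<beta> where "\<beta> \<in> fiber K (value_set Q v N) \<alpha>" by blast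
  then obtain x where x: "x \<in> N" "x \<in> regular_elements Q"
    "\<forall>k\<in>K. value_vector v x $ k = \<alpha> $ k" "\<forall>i. i \<notin> K \<longrightarrow> value_vector v x $ i > \<alpha> $ i"
    by (auto simp: fiber_def value_set_def)
  have "\<exists>n. veq i n x" for i
    using x(2) regular_iff_finite_values v_cases[of x i] by (metis veq_def)
  then obtain a where a: "\<And>i. veq i (a i) x" by metis
  have "veq k (\<alpha> $ k) x" if "k \<in> K" for k
    using a[of k] value_vector_eq[OF a] x(3) that by simp
  moreover have "vge i (\<alpha> $ i + 1) x" if "i \<notin> K" for i
    using veq_vge_iff[OF a[of i]] value_vector_eq[OF a] x(4) that by auto
  ultimately show "attains N (($) \<alpha>) K" unfolding attains_def using x(1) by blast
next
  assume "attains N (($) \<alpha>) K"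
  then obtain x where x: "x \<in> N" "\<And>k. k \<in> K \<Longrightarrow> veq k (\<alpha> $ k) x" "\<And>i. i \<notin> K \<Longrightarrow> vge i (\<alpha> $ i + 1) x"
    by (auto simp: attains_def)
  have xc: "x \<in> carrier Q" using submodule_overD(5)[OF rfi_submodule[OF N] x(1)] .
  obtain g where g: "vset g \<subseteq> N" using rfi_contains_vset[OF N] by auto
  \<comment> \<open>The default \<open>0\<close> at places of infinite value only enters the lower
    bound for \<open>a\<close>; the final value there is \<open>a i\<close>.\<close>
  define n where "n i = (case v i x of Fin n \<Rightarrow> n | _ \<Rightarrow> 0)" for i
  define a where "a i = max (g i) (max (\<alpha> $ i + 1) (n i + 1))" for i
  obtain w where w: "\<And>i. veq i (a i) w" using exists_values by blast
  have "w \<in> vset a" using w veq_vge by (auto simp: vset_def)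
  moreover have "vset a \<subseteq> vset g" by (rule vset_antimono) (simp add: a_def)
  ultimately have wN: "w \<in> N" using g by blast
  have wc: "w \<in> carrier Q" using w veq_carrier by blast
  let ?z = "x \<oplus> w"
  define b where "b i = (if v i x = Pinf then a i else n i)" for i
  have z: "veq i (b i) ?z" for i
  proof (cases rule: v_cases[OF xc, of i])
    case 1
    then have "veq i (a i) (w \<oplus> x)" using veq_add[OF w] vge_Pinf[OF xc] by blast
    then show ?thesis using 1 xc wc by (simp add: b_def a_comm)
  next
    case (2 m)
    then have "veq i m x" "n i = m" using xc by (simp_all add: veq_def n_def)
    moreover have "vge i (m + 1) w" using veq_vge_iff[OF w[of i]] calculation by (simp add: a_def)
    ultimately show ?thesis using veq_add 2 by (auto simp: b_def)
  qed
  have "?z \<in> N" using x(1) wN submodule_overD(3)[OF rfi_submodule[OF N]] by blast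
  moreover have "?z \<in> regular_elements Q" using unit_if_veq[OF z] regular_iff by simp
  ultimately have "value_vector v ?z \<in> value_set Q v N" by (auto simp: value_set_def)
  moreover have "b k = \<alpha> $ k" if "k \<in> K" for k
    using x(2)[OF that] by (auto simp: b_def n_def veq_def)
  moreover have "b i > \<alpha> $ i" if "i \<notin> K" for i
    using x(3)[OF that]
    by (cases rule: v_cases[OF xc, of i]) (auto simp: b_def n_def vge_def a_def)
  ultimately have "value_vector v ?z \<in> fiber K (value_set Q v N) \<alpha>"
    using value_vector_eq[OF z] by (simp add: fiber_def)
  then show "fiber K (value_set Q v N) \<alpha> \<noteq> {}" by blast
qed

lemma mem_value_set_iff:
  assumes N: "rfi N"
  shows "\<alpha> \<in> value_set Q v N \<longleftrightarrow> (\<exists>x\<in>N. \<forall>i. veq i (\<alpha> $ i) x)"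
proof -
  have "\<alpha> \<in> value_set Q v N \<longleftrightarrow> fiber UNIV (value_set Q v N) \<alpha> \<noteq> {}"
    by (auto simp: fiber_def vec_eq_iff[symmetric])
  then show ?thesis using fiber_nonempty_iff[OF N] by (simp add: attains_def)
qed

text \<open>An arbitrary \<open>y\<close> in \<open>V(c)\<close> enters the smaller module after
  subtracting a multiple \<open>r x\<close> with \<open>r\<close> in \<open>R\<close> that cancels
  its leading part at \<open>i\<close>. Conductors are lowered by this one coordinate at a
  time.\<close>

lemma vset_step:
  assumes N: "submodule_over R N" and up: "vset (c(i := c i + 1)) \<subseteq> N"
    and x: "x \<in> N" "veq i (c i) x" "\<And>j. j \<noteq> i \<Longrightarrow> vge j (c j) x"
  shows "vset c \<subseteq> N"
proof
  fix y assume y: "y \<in> vset c"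
  have c: "x \<in> carrier Q" "y \<in> carrier Q" using y vset_carrier submodule_overD(5)[OF N x(1)] by auto
  obtain r where r: "r \<in> R" "vge i (c i + 1) (y \<ominus> r \<otimes> x)"
    using residue_relative[OF _ x(2), of y] y by (auto simp: vset_def)
  have "vge j (c j) (y \<ominus> r \<otimes> x)" if "j \<noteq> i" for j
    using y x(3)[OF that] by (intro vge_minus vge_R_mult r) (auto simp: vset_def)
  then have "y \<ominus> r \<otimes> x \<in> N" using up r(2) by (auto simp: vset_def)
  then have "(y \<ominus> r \<otimes> x) \<oplus> r \<otimes> x \<in> N" using submodule_overD(3,4)[OF N] x r by blast
  moreover have "(y \<ominus> r \<otimes> x) \<oplus> r \<otimes> x = y" using c r R_carrier by algebra
  ultimately show "y \<in> N" by simp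
qed

text \<open>Take \<open>c\<close> with the smallest coordinate sum. If some \<open>g\<close> has
  \<open>g_i < c_i\<close>, an element with value \<open>c_i - 1\<close> at \<open>i\<close> and
  large values elsewhere lies in \<open>V(g)\<close>, hence in \<open>N\<close>, and allows lowering
  \<open>c\<close> at \<open>i\<close>.\<close>

lemma exists_least_vset:
  assumes N: "rfi N"
  shows "\<exists>c. vset c \<subseteq> N \<and> (\<forall>g. vset g \<subseteq> N \<longrightarrow> (\<forall>i. c i \<le> g i))"
proof -
  obtain b where b: "\<And>x i. x \<in> N \<Longrightarrow> vge i (b i) x" using rfi_lower_bound[OF N] by blast
  have bound: "b i \<le> g i" if g: "vset g \<subseteq> N" for g i
  proof -
    obtain x where x: "\<And>i. veq i (g i) x" using exists_values by blast
    then have "x \<in> N" using g veq_vge by (auto simp: vset_def)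
    then show ?thesis using b veq_vge_iff[OF x] by blast
  qed
  \<comment> \<open>Subtracting the lower bounds \<open>b\<close> makes all summands nonnegative
    whenever \<open>V(g)\<close> lies in \<open>N\<close>, so passing to \<open>nat\<close> loses
    nothing.\<close>
  define f where "f g = nat (\<Sum>i\<in>UNIV. g i - b i)" for g
  obtain c where c: "vset c \<subseteq> N" "\<And>g. vset g \<subseteq> N \<Longrightarrow> f c \<le> f g"
    using ex_has_least_nat[of "\<lambda>g. vset g \<subseteq> N" _ f] rfi_contains_vset[OF N] by blast
  have "c i \<le> g i" if g: "vset g \<subseteq> N" for g i
  proof (rule ccontr)
    assume less: "\<not> c i \<le> g i"
    obtain x where x: "veq i (c i - 1) x" "\<And>j. j \<noteq> i \<Longrightarrow> vge j (max (c j) (g j)) x"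
      using approximation[of i "c i - 1" "\<lambda>j. max (c j) (g j)"] by blast
    have "vge j (g j) x" for j
      using x(2)[of j] vge_mono[of j _ x "g j"] veq_vge_iff[OF x(1), of "g j"] less by (cases "j = i") auto
    then have xN: "x \<in> N" using g by (auto simp: vset_def)
    let ?c = "c(i := c i - 1)"
    have sub: "vset ?c \<subseteq> N"
    proof (rule vset_step[OF rfi_submodule[OF N] _ xN])
      show "vset (?c(i := ?c i + 1)) \<subseteq> N" using c(1) by simp
      show "veq i (?c i) x" using x by simp
      show "vge j (?c j) x" if "j \<noteq> i" for j using vge_mono[OF x(2)[OF that]] that by simp
    qed
    have "(\<Sum>i\<in>UNIV. ?c i - b i) < (\<Sum>i\<in>UNIV. c i - b i)"
      by (rule sum_strict_mono_ex1) auto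
    moreover have "(\<Sum>i\<in>UNIV. ?c i - b i) \<ge> 0"
      using bound[OF sub] by (intro sum_nonneg) (simp only: diff_ge_0_iff_ge)
    ultimately have "f ?c < f c" by (simp add: f_def)
    then show False using c(2)[OF sub] by simp
  qed
  then show ?thesis using c(1) by blast
qed

text \<open>Values are turned into a containment of modules by descent: some \<open>V(d)\<close>
  lies in \<open>N\<close>, and coordinates are lowered from \<open>d\<close> to
  \<open>\<gamma>\<close> one at a time, each time using an element of \<open>N\<close> whose values
  are exactly the current ones.\<close>

lemma conductor_condition_iff:
  assumes N: "rfi N"
  shows "\<gamma> \<in> value_set Q v N \<and> {\<gamma> + \<beta> | \<beta>. 0 \<le> \<beta>} \<subseteq> value_set Q v N \<longleftrightarrow> vset (($) \<gamma>) \<subseteq> N"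
proof
  assume sub: "vset (($) \<gamma>) \<subseteq> N"
  have "\<gamma> + \<beta> \<in> value_set Q v N" if \<beta>: "0 \<le> \<beta>" for \<beta>
  proof -
    obtain x where x: "\<And>i. veq i ((\<gamma> + \<beta>) $ i) x" using exists_values[of "($) (\<gamma> + \<beta>)"] by blast
    have "vge i (\<gamma> $ i) x" for i
      using veq_vge_iff[OF x[of i]] \<beta> by (simp add: less_eq_vec_def)
    then have "x \<in> N" using sub by (auto simp: vset_def)
    then show ?thesis using x mem_value_set_iff[OF N] by blast
  qed
  moreover from this[of 0] have "\<gamma> \<in> value_set Q v N" by simp
  ultimately show "\<gamma> \<in> value_set Q v N \<and> {\<gamma> + \<beta> | \<beta>. 0 \<le> \<beta>} \<subseteq> value_set Q v N" by blast
next
  assume "\<gamma> \<in> value_set Q v N \<and> {\<gamma> + \<beta> | \<beta>. 0 \<le> \<beta>} \<subseteq> value_set Q v N"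
  then have E: "\<And>\<beta>. 0 \<le> \<beta> \<Longrightarrow> \<gamma> + \<beta> \<in> value_set Q v N" by blast
  have attained: "\<exists>x\<in>N. \<forall>i. veq i (a i) x" if "\<And>i. \<gamma> $ i \<le> a i" for a
  proof -
    have "(\<chi> i. a i) = \<gamma> + ((\<chi> i. a i) - \<gamma>)" by simp
    moreover have "0 \<le> (\<chi> i. a i) - \<gamma>" using that by (simp add: less_eq_vec_def)
    ultimately have "(\<chi> i. a i) \<in> value_set Q v N" using E by metis
    then show ?thesis using mem_value_set_iff[OF N] by simp
  qed
  obtain g where g: "vset g \<subseteq> N" using rfi_contains_vset[OF N] by auto
  define d where "d i = max (g i) (\<gamma> $ i)" for i
  have d: "vset d \<subseteq> N" using g vset_antimono[of g d] by (auto simp: d_def)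
  have "vset a \<subseteq> N" if "\<And>i. \<gamma> $ i \<le> a i" "\<And>i. a i \<le> d i" "nat (\<Sum>i\<in>UNIV. d i - a i) = m" for a m
    using that
  proof (induction m arbitrary: a rule: less_induct)
    case (less m)
    show ?case
    proof (cases "a = d")
      case False
      then obtain i where i: "a i < d i" using less.prems(2) by (metis ext order_le_less)
      obtain x where x: "x \<in> N" "\<And>i. veq i (a i) x" using attained[OF less.prems(1)] by blast
      let ?a = "a(i := a i + 1)"
      have "(\<Sum>i\<in>UNIV. d i - ?a i) < (\<Sum>i\<in>UNIV. d i - a i)"
        by (rule sum_strict_mono_ex1) auto
      moreover have "(\<Sum>i\<in>UNIV. d i - ?a i) \<ge> 0"
        using less.prems(2) i by (intro sum_nonneg) auto
      ultimately have "nat (\<Sum>i\<in>UNIV. d i - ?a i) < m" using less.prems(3) by linarith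
      then have "vset ?a \<subseteq> N"
        by (rule less.IH) (use less.prems(1,2) i in \<open>auto simp: less_imp_le intro: order_trans[of _ "a i"]\<close>)
      then show ?thesis
        by (rule vset_step[OF rfi_submodule[OF N] _ x]) (rule veq_vge[OF x(2)])
    qed (use d in simp)
  qed
  from this[of "($) \<gamma>"] show "vset (($) \<gamma>) \<subseteq> N" by (simp add: d_def)
qed

lemma conductor_value_set:
  assumes N: "rfi N"
  shows "vset (($) (conductor (value_set Q v N))) \<subseteq> N"
    "vset g \<subseteq> N \<Longrightarrow> conductor (value_set Q v N) $ i \<le> g i"
proof -
  obtain c where c: "vset c \<subseteq> N" "\<And>g i. vset g \<subseteq> N \<Longrightarrow> c i \<le> g i"
    using exists_least_vset[OF N] by blast
  have "conductor (value_set Q v N) = (\<chi> i. c i)"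
    unfolding conductor_def conductor_condition_iff[OF N]
  proof (rule Least_equality)
    have "($) (\<chi> i. c i) = c" by (rule ext) simp
    then show "vset (($) (\<chi> i. c i)) \<subseteq> N" using c(1) by simp
    show "(\<chi> i. c i) \<le> \<gamma>" if "vset (($) \<gamma>) \<subseteq> N" for \<gamma>
      using c(2)[OF that] by (simp add: less_eq_vec_def)
  qed
  then have "($) (conductor (value_set Q v N)) = c" by (auto simp: fun_eq_iff)
  then show "vset (($) (conductor (value_set Q v N))) \<subseteq> N"
    "vset g \<subseteq> N \<Longrightarrow> conductor (value_set Q v N) $ i \<le> g i" using c by auto
qed

end

section \<open>Duality of fibers\<close>

lemma Un_closed_covering:
  fixes \<phi> :: "'n::finite set \<Rightarrow> bool"
  assumes Un: "\<And>K L. \<phi> K \<Longrightarrow> \<phi> L \<Longrightarrow> \<phi> (K \<union> L)"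
    and cover: "\<And>i. i \<in> K \<Longrightarrow> \<exists>L. i \<in> L \<and> L \<subseteq> K \<and> \<phi> L" and "K \<noteq> {}"
  shows "\<phi> K"
proof -
  have "\<exists>L. S \<subseteq> L \<and> L \<subseteq> K \<and> \<phi> L" if "S \<noteq> {}" "S \<subseteq> K" for S
    using finite[of S] that
  proof (induction S rule: finite_ne_induct)
    case (singleton i)
    then show ?case using cover[of i] by auto
  next
    case (insert i S)
    then obtain L L' where "S \<subseteq> L" "L \<subseteq> K" "\<phi> L" "i \<in> L'" "L' \<subseteq> K" "\<phi> L'" using cover[of i] by auto
    then show ?case using Un[of L L'] by (intro exI[of _ "L \<union> L'"]) auto
  qed
  from this[of K] show ?thesis using \<open>K \<noteq> {}\<close> by (metis order_refl subset_antisym)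
qed

text \<open>
  The combinatorial content of the duality: \<open>\<phi>\<close> and \<open>\<psi>\<close> tell which fibers of two value sets are
  nonempty.
\<close>

locale dual_fibers =
  fixes \<phi> \<psi> :: "'n::finite set \<Rightarrow> bool"
  assumes phi_Un: "\<And>K L. \<phi> K \<Longrightarrow> \<phi> L \<Longrightarrow> \<phi> (K \<union> L)"
    and psi_Un: "\<And>K L. \<psi> K \<Longrightarrow> \<psi> L \<Longrightarrow> \<psi> (K \<union> L)"
    and dual: "\<And>i A. i \<notin> A \<Longrightarrow> (\<exists>K. i \<in> K \<and> K \<inter> A = {} \<and> \<phi> K) \<longleftrightarrow>
      \<not> (\<exists>K. i \<in> K \<and> K \<inter> (- insert i A) = {} \<and> \<psi> K)"
begin

lemma swap: "dual_fibers \<psi> \<phi>"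
proof
  fix i :: 'n and A assume "i \<notin> A"
  moreover from this have "- insert i (- insert i A) = A" by auto
  ultimately show "(\<exists>K. i \<in> K \<and> K \<inter> A = {} \<and> \<psi> K) \<longleftrightarrow>
      \<not> (\<exists>K. i \<in> K \<and> K \<inter> (- insert i A) = {} \<and> \<phi> K)"
    using dual[of i "- insert i A"] by auto
qed (use phi_Un psi_Un in auto)

text \<open>With \<open>A\<close> empty the dual condition forces \<open>K = {i}\<close>: some
  \<open>K\<close> through \<open>i\<close> satisfies \<open>\<phi>\<close> iff
  \<open>\<psi> {i}\<close> fails, and closure under union assembles these \<open>K\<close> to
  \<open>UNIV\<close>. This is the duality of maximal points.\<close>

lemma phi_UNIV_iff: "\<phi> UNIV \<longleftrightarrow> (\<forall>i. \<not> \<psi> {i})"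
proof -
  have eq: "(\<exists>K. i \<in> K \<and> \<phi> K) \<longleftrightarrow> \<not> \<psi> {i}" for i
  proof -
    have "(\<exists>K. i \<in> K \<and> K \<inter> (- insert i {}) = {} \<and> \<psi> K) \<longleftrightarrow> \<psi> {i}"
    proof
      assume "\<exists>K. i \<in> K \<and> K \<inter> (- insert i {}) = {} \<and> \<psi> K"
      then obtain K where K: "i \<in> K" "K \<inter> (- {i}) = {}" "\<psi> K" by auto
      then have "K = {i}" by auto
      then show "\<psi> {i}" using K by simp
    qed auto
    then show ?thesis using dual[of i "{}"] by simp
  qed
  show ?thesis
  proof
    assume "\<forall>i. \<not> \<psi> {i}"
    then have "\<exists>K. i \<in> K \<and> \<phi> K" for i using eq by blast
    then show "\<phi> UNIV" by (intro Un_closed_covering[of \<phi> UNIV] phi_Un) auto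
  qed (use eq in auto)
qed

text \<open>Duality is applied with \<open>A = K - {i}\<close>: a set with \<open>\<phi>\<close>
  through \<open>i\<close> that avoids \<open>A\<close> has at most
  \<open>CARD('n) + 1 - card K\<close> elements and is excluded, so the sets with
  \<open>\<psi>\<close> inside \<open>K\<close> cover \<open>K\<close>. Conversely
  \<open>insert i (- K)\<close> has exactly that many elements.\<close>

lemma empty_small_iff_nonempty_large:
  assumes n: "n \<le> CARD('n)"
  shows "(\<forall>K. K \<noteq> {} \<and> card K \<le> n \<longrightarrow> \<not> \<phi> K) \<longleftrightarrow>
    (\<forall>K. K \<noteq> {} \<and> card K \<ge> CARD('n) + 1 - n \<longrightarrow> \<psi> K)"
proof (intro iffI allI impI; elim conjE)
  fix K :: "'n set"
  assume small: "\<forall>K. K \<noteq> {} \<and> card K \<le> n \<longrightarrow> \<not> \<phi> K"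
    and K: "K \<noteq> {}" "card K \<ge> CARD('n) + 1 - n"
  show "\<psi> K"
  proof (rule Un_closed_covering[of \<psi>])
    show "\<psi> (K \<union> L)" if "\<psi> K" "\<psi> L" for K L using that by (rule psi_Un)
    fix i assume i: "i \<in> K"
    have "\<not> (\<exists>L. i \<in> L \<and> L \<inter> (K - {i}) = {} \<and> \<phi> L)"
    proof
      assume "\<exists>L. i \<in> L \<and> L \<inter> (K - {i}) = {} \<and> \<phi> L"
      then obtain L where L: "i \<in> L" "L \<inter> (K - {i}) = {}" "\<phi> L" by blast
      have "L \<subseteq> insert i (- K)" using L by auto
      then have "card L \<le> card (insert i (- K))" by (intro card_mono) auto
      also have "\<dots> = CARD('n) - card K + 1" using i by (simp add: Compl_eq_Diff_UNIV card_Diff_subset)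
      also have "\<dots> \<le> n" using K(2) n card_mono[of UNIV K] by simp
      finally show False using small L by blast
    qed
    then have "\<exists>L. i \<in> L \<and> L \<inter> (- insert i (K - {i})) = {} \<and> \<psi> L" using dual[of i "K - {i}"] by blast
    moreover have "insert i (K - {i}) = K" using i by auto
    ultimately show "\<exists>L. i \<in> L \<and> L \<subseteq> K \<and> \<psi> L" by (auto simp: disjoint_eq_subset_Compl)
  qed (rule K)
next
  fix K :: "'n set"
  assume large: "\<forall>K. K \<noteq> {} \<and> card K \<ge> CARD('n) + 1 - n \<longrightarrow> \<psi> K"
    and K: "K \<noteq> {}" "card K \<le> n"
  show "\<not> \<phi> K"
  proof
    assume "\<phi> K"
    obtain i where i: "i \<in> K" using K by auto
    have "card (insert i (- K)) = CARD('n) - card K + 1" using i by (simp add: Compl_eq_Diff_UNIV card_Diff_subset)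
    then have "card (insert i (- K)) \<ge> CARD('n) + 1 - n" using K(2) by linarith
    then have "\<psi> (insert i (- K))" using spec[OF large, of "insert i (- K)"] by simp
    moreover have "insert i (- K) \<inter> (- insert i (- K)) = {}" by auto
    ultimately have "\<exists>L. i \<in> L \<and> L \<inter> (- insert i (- K)) = {} \<and> \<psi> L"
      by (intro exI[of _ "insert i (- K)"]) simp
    moreover have "\<exists>L. i \<in> L \<and> L \<inter> (- K) = {} \<and> \<phi> L"
      using \<open>\<phi> K\<close> i by (intro exI[of _ K]) simp
    ultimately show False using dual[of i "- K"] i by simp
  qed
qed

end

text \<open>Replacing \<open>n\<close> by \<open>CARD('n) + 1 - n\<close> exchanges the two sets of
  bounds, hence the maximum of one with the minimum of the other; the vacuous bounds
  \<open>0\<close> and \<open>CARD('n) + 1\<close> correspond.\<close>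

lemma q_number_eq:
  fixes E F :: "(int ^ 'n::finite) set"
  assumes "dual_fibers (\<lambda>K. fiber K E \<alpha> \<noteq> {}) (\<lambda>K. fiber K F \<beta> \<noteq> {})"
  shows "q_number F \<beta> = CARD('n) + 1 - p_number E \<alpha>" "p_number E \<alpha> \<le> CARD('n)"
proof -
  define S where "S = {n \<in> {0..CARD('n)}. \<forall>K. K \<noteq> {} \<and> card K \<le> n \<longrightarrow> fiber K E \<alpha> = {}}"
  define T where "T = {n \<in> {1..CARD('n) + 1}. \<forall>K. K \<noteq> {} \<and> card K \<ge> n \<longrightarrow> fiber K F \<beta> \<noteq> {}}"
  have ST: "n \<in> S \<longleftrightarrow> CARD('n) + 1 - n \<in> T" if "n \<le> CARD('n)" for n
    using dual_fibers.empty_small_iff_nonempty_large[OF assms that] that by (auto simp: S_def T_def)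
  have S: "finite S" "S \<noteq> {}"
  proof -
    have "0 \<in> S" by (auto simp: S_def card_eq_0_iff)
    then show "finite S" "S \<noteq> {}" by (auto simp: S_def)
  qed
  have m: "Max S \<in> S" using S by (rule Max_in)
  have "S \<subseteq> {..CARD('n)}" by (auto simp: S_def)
  then have le: "Max S \<le> CARD('n)" using m by blast
  have p: "p_number E \<alpha> = Max S" by (simp only: p_number_def S_def)
  show "p_number E \<alpha> \<le> CARD('n)" using le by (simp only: p)
  have "Min T = CARD('n) + 1 - Max S"
  proof (rule Min_eqI)
    show "finite T" by (simp add: T_def)
    show "CARD('n) + 1 - Max S \<in> T" using ST[OF le] m by (rule iffD1)
    fix n assume n: "n \<in> T"
    then have "1 \<le> n" "n \<le> CARD('n) + 1" by (auto simp: T_def)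
    then have "CARD('n) + 1 - n \<in> S" using ST[of "CARD('n) + 1 - n"] n by simp
    then have "CARD('n) + 1 - n \<le> Max S" using S by simp
    then show "CARD('n) + 1 - Max S \<le> n" by linarith
  qed
  then show "q_number F \<beta> = CARD('n) + 1 - p_number E \<alpha>"
    by (simp only: p q_number_def T_def)
qed

text \<open>The fiber over \<open>UNIV\<close> is \<open>{\<alpha>}\<close> or empty, so membership
  of \<open>\<alpha>\<close> is also a statement about fibers.\<close>

lemma maximal_point_iff:
  "maximal_point E \<alpha> \<longleftrightarrow> fiber UNIV E \<alpha> \<noteq> {} \<and> (\<forall>i. fiber {i} E \<alpha> = {})"
  by (auto simp: maximal_point_def fibers_def fiber_def vec_eq_iff[symmetric])

lemma maximal_points_dual:
  fixes E F :: "(int ^ 'n::finite) set"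
  assumes D: "dual_fibers (\<lambda>K. fiber K E \<alpha> \<noteq> {}) (\<lambda>K. fiber K F \<beta> \<noteq> {})"
  shows "maximal_point E \<alpha> \<longleftrightarrow> maximal_point F \<beta>"
    "maximal_point_of_type E \<alpha> (p, q) \<longleftrightarrow>
      maximal_point_of_type F \<beta> (int CARD('n) + 1 - q, int CARD('n) + 1 - p)"
proof -
  note D' = dual_fibers.swap[OF D]
  show max: "maximal_point E \<alpha> \<longleftrightarrow> maximal_point F \<beta>"
    unfolding maximal_point_iff
    using dual_fibers.phi_UNIV_iff[OF D] dual_fibers.phi_UNIV_iff[OF D'] by auto
  \<comment> \<open>Duality in both directions determines both numbers, and so exchanges the
    conditions \<open>p \<ge> 1\<close> and \<open>q \<le> CARD('n)\<close>.\<close>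
  have "int (q_number F \<beta>) = int CARD('n) + 1 - int (p_number E \<alpha>)"
    "int (q_number E \<alpha>) = int CARD('n) + 1 - int (p_number F \<beta>)"
    using q_number_eq[OF D] q_number_eq[OF D'] by (simp_all add: of_nat_diff)
  then show "maximal_point_of_type E \<alpha> (p, q) \<longleftrightarrow>
      maximal_point_of_type F \<beta> (int CARD('n) + 1 - q, int CARD('n) + 1 - p)"
    unfolding maximal_point_of_type_def using max by auto
qed

section \<open>The duality between \<open>I\<close> and \<open>J : I\<close>\<close>

context admissible_valuations begin

text \<open>Either alternative of the overview, used with \<open>i\<close> outside \<open>A\<close>.
  It bundles the fibers of all \<open>K\<close> that contain \<open>i\<close> and avoid
  \<open>A\<close>.\<close>

definition partly_attains :: "'a set \<Rightarrow> ('n \<Rightarrow> int) \<Rightarrow> 'n \<Rightarrow> 'n set \<Rightarrow> bool" where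
  "partly_attains N a i A \<longleftrightarrow>
     (\<exists>x\<in>N. veq i (a i) x \<and> (\<forall>j\<in>A. vge j (a j + 1) x) \<and> (\<forall>j. vge j (a j) x))"

lemma partly_attains_iff:
  "partly_attains N a i A \<longleftrightarrow> (\<exists>K. i \<in> K \<and> K \<inter> A = {} \<and> attains N a K)"
proof
  assume "partly_attains N a i A"
  then obtain x where x: "x \<in> N" "veq i (a i) x" "\<forall>j\<in>A. vge j (a j + 1) x" "\<And>j. vge j (a j) x"
    by (auto simp: partly_attains_def)
  have "attains N a {k. veq k (a k) x}"
    unfolding attains_def using x(1,4) by (intro bexI[of _ x]) (auto simp: veq_iff)
  moreover have "{k. veq k (a k) x} \<inter> A = {}" using x(3) by (auto simp: veq_iff)
  ultimately show "\<exists>K. i \<in> K \<and> K \<inter> A = {} \<and> attains N a K"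
    using x(2) by (intro exI[of _ "{k. veq k (a k) x}"]) auto
next
  assume "\<exists>K. i \<in> K \<and> K \<inter> A = {} \<and> attains N a K"
  then obtain K x where K: "i \<in> K" "K \<inter> A = {}" "x \<in> N" "\<forall>k\<in>K. veq k (a k) x"
    "\<forall>i. i \<notin> K \<longrightarrow> vge i (a i + 1) x"
    by (auto simp: attains_def)
  moreover have "vge j (a j) x" for j
    using K(4,5) vge_mono[of j "a j + 1" x "a j"] veq_vge by (cases "j \<in> K") auto
  ultimately show "partly_attains N a i A" unfolding partly_attains_def by blast
qed

text \<open>Such an element would allow lowering the conductor at \<open>i\<close>, against its
  minimality.\<close>

lemma below_conductor:
  assumes N: "rfi N" and x: "x \<in> N" "veq i (conductor (value_set Q v N) $ i - 1) x"
    "\<And>j. j \<noteq> i \<Longrightarrow> vge j (conductor (value_set Q v N) $ j) x"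
  shows False
proof -
  let ?c = "($) (conductor (value_set Q v N))"
  let ?d = "?c(i := ?c i - 1)"
  have "vset ?d \<subseteq> N"
  proof (rule vset_step[OF rfi_submodule[OF N] _ x(1)])
    show "vset (?d(i := ?d i + 1)) \<subseteq> N" using conductor_value_set(1)[OF N] by simp
  qed (use x in auto)
  then have "?c i \<le> ?d i" by (rule conductor_value_set(2)[OF N])
  then show False by simp
qed

text \<open>If \<open>x\<close> had value \<open>m < c_j - a_j\<close> at \<open>j\<close>, choose
  \<open>z\<close> in \<open>V(a)\<close> of value \<open>c_j - 1 - m\<close> at \<open>j\<close>
  and very large elsewhere; then \<open>x z\<close> has the values forbidden by
  \<open>below_conductor\<close>.\<close>

lemma quotient_vset_subset:
  assumes N: "rfi N"
  shows "ideal_quotient Q N (vset a) \<subseteq> vset (\<lambda>i. conductor (value_set Q v N) $ i - a i)"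
proof
  let ?c = "($) (conductor (value_set Q v N))"
  fix x assume "x \<in> ideal_quotient Q N (vset a)"
  then have xc: "x \<in> carrier Q" and xN: "\<And>y. y \<in> vset a \<Longrightarrow> x \<otimes> y \<in> N"
    by (auto simp: ideal_quotient_def)
  have "\<exists>n. vge i n x" for i using xc by (cases rule: v_cases[OF xc, of i]) (auto simp: vge_def)
  then obtain n where n: "\<And>i. vge i (n i) x" by metis
  have "vge j (?c j - a j) x" for j
  proof (rule ccontr)
    assume neg: "\<not> vge j (?c j - a j) x"
    then obtain m where m: "veq j m x" "m < ?c j - a j"
      using xc by (cases rule: v_cases[OF xc, of j]) (auto simp: vge_def veq_def)
    obtain z where z: "veq j (?c j - 1 - m) z" "\<And>i. i \<noteq> j \<Longrightarrow> vge i (max (a i) (?c i - n i)) z"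
      using approximation[of j "?c j - 1 - m" "\<lambda>i. max (a i) (?c i - n i)"] by blast
    have "vge i (a i) z" for i
      using z(2)[of i] vge_mono[of i _ z "a i"] veq_vge_iff[OF z(1), of "a j"] m(2)
      by (cases "i = j") auto
    then have "x \<otimes> z \<in> N" by (intro xN) (simp add: vset_def)
    moreover have "veq j (?c j - 1) (x \<otimes> z)" using veq_mult[OF m(1) z(1)] by simp
    moreover have "vge i (?c i) (x \<otimes> z)" if "i \<noteq> j" for i
      using vge_mult[OF n vge_mono[OF z(2)[OF that], of "?c i - n i"]] by simp
    ultimately show False by (rule below_conductor[OF N])
  qed
  then show "x \<in> vset (\<lambda>i. ?c i - a i)" by (simp add: vset_def)
qed

text \<open>\<open>J : (N + P)\<close> is the intersection of \<open>J : N\<close> and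
  \<open>J : P\<close>, which for the two quotients is \<open>I \<inter> V(a)\<close> by
  reflexivity; applying \<open>J : _\<close> once more and reflexivity of the sum gives the
  equation.\<close>

lemma quotient_Int_vset:
  assumes J: "canonical_ideal Q R J" and I: "rfi I"
  shows "ideal_quotient Q J (I \<inter> vset a) = ideal_quotient Q J I <+>\<^bsub>Q\<^esub> ideal_quotient Q J (vset a)"
proof -
  have Jr: "rfi J" and refl: "\<And>N. rfi N \<Longrightarrow> ideal_quotient Q J (ideal_quotient Q J N) = N"
    using J by (auto simp: canonical_ideal_def)
  let ?N = "ideal_quotient Q J I" and ?P = "ideal_quotient Q J (vset a)"
  have N: "rfi ?N" and P: "rfi ?P" using quotient_rfi[OF Jr I] quotient_rfi[OF Jr vset_rfi] by auto
  note S = submodule_set_add[OF R_carrier(1) rfi_submodule[OF N] rfi_submodule[OF P]]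
  have "ideal_quotient Q J (?N <+>\<^bsub>Q\<^esub> ?P) = I \<inter> vset a"
  proof
    have "ideal_quotient Q J (?N <+>\<^bsub>Q\<^esub> ?P) \<subseteq> ideal_quotient Q J ?N"
      "ideal_quotient Q J (?N <+>\<^bsub>Q\<^esub> ?P) \<subseteq> ideal_quotient Q J ?P"
      using S(2,3) by (auto simp: ideal_quotient_def)
    then show "ideal_quotient Q J (?N <+>\<^bsub>Q\<^esub> ?P) \<subseteq> I \<inter> vset a"
      using refl[OF I] refl[OF vset_rfi] by auto
    show "I \<inter> vset a \<subseteq> ideal_quotient Q J (?N <+>\<^bsub>Q\<^esub> ?P)"
    proof
      fix z assume z: "z \<in> I \<inter> vset a"
      then have zc: "z \<in> carrier Q" using vset_carrier by auto
      have "z \<otimes> w \<in> J" if w: "w \<in> ?N <+>\<^bsub>Q\<^esub> ?P" for w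
      proof -
        obtain x y where xy: "x \<in> ?N" "y \<in> ?P" "w = x \<oplus> y" using w by (auto simp: mem_set_add)
        then have c: "x \<in> carrier Q" "y \<in> carrier Q" and "x \<otimes> z \<in> J" "y \<otimes> z \<in> J"
          using z by (auto simp: ideal_quotient_def)
        then have "x \<otimes> z \<oplus> y \<otimes> z \<in> J" using submodule_overD(3)[OF rfi_submodule[OF Jr]] by blast
        moreover have "z \<otimes> w = x \<otimes> z \<oplus> y \<otimes> z" unfolding xy using c zc by algebra
        ultimately show ?thesis by simp
      qed
      then show "z \<in> ideal_quotient Q J (?N <+>\<^bsub>Q\<^esub> ?P)" using zc by (simp add: ideal_quotient_def)
    qed
  qed
  then show ?thesis using refl[OF rfi_set_add[OF N P]] by simp
qed

text \<open>Both alternatives together would give a product in \<open>J\<close> with values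
  forbidden by \<open>below_conductor\<close>. If the first fails, the elements of
  \<open>I \<inter> V(d)\<close> gain one at \<open>i\<close>, so a \<open>z\<close> with value one
  too small at \<open>i\<close> still multiplies them into \<open>V(c)\<close>, hence into
  \<open>J\<close>; splitting \<open>z\<close> by \<open>quotient_Int_vset\<close> gives the witness
  in \<open>J : I\<close>.\<close>

lemma partly_attains_dual:
  assumes J: "canonical_ideal Q R J" and I: "rfi I" and i: "i \<notin> A"
  shows "partly_attains I a i A \<longleftrightarrow> \<not> partly_attains (ideal_quotient Q J I)
    (\<lambda>j. conductor (value_set Q v J) $ j - 1 - a j) i (- insert i A)"
proof -
  let ?c = "($) (conductor (value_set Q v J))"
  have Jr: "rfi J" using J by (simp add: canonical_ideal_def)
  let ?N = "ideal_quotient Q J I"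
  let ?b = "\<lambda>j. ?c j - 1 - a j"
  have False if both: "partly_attains I a i A" "partly_attains ?N ?b i (- insert i A)"
  proof -
    obtain x where x: "x \<in> I" "veq i (a i) x" "\<forall>j\<in>A. vge j (a j + 1) x" "\<And>j. vge j (a j) x"
      using both(1) by (auto simp: partly_attains_def)
    obtain y where y: "y \<in> ?N" "veq i (?b i) y" "\<forall>j\<in>- insert i A. vge j (?b j + 1) y" "\<And>j. vge j (?b j) y"
      using both(2) by (auto simp: partly_attains_def)
    have "y \<otimes> x \<in> J" using x(1) y(1) by (simp add: ideal_quotient_def)
    moreover have "veq i (?c i - 1) (y \<otimes> x)" using veq_mult[OF y(2) x(2)] by simp
    moreover have "vge j (?c j) (y \<otimes> x)" if "j \<noteq> i" for j
    proof (cases "j \<in> A")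
      case True
      then show ?thesis using vge_mult[OF y(4) bspec[OF x(3)]] by simp
    next
      case False
      then have "vge j (?b j + 1) y" using y(3) that by blast
      then show ?thesis using vge_mult[OF _ x(4)] by fastforce
    qed
    ultimately show False by (rule below_conductor[OF Jr])
  qed
  moreover have "partly_attains ?N ?b i (- insert i A)" if neg: "\<not> partly_attains I a i A"
  proof -
    \<comment> \<open>\<open>d\<close> encodes the inequalities, strict on \<open>A\<close> and weak
      elsewhere. With \<open>b = c - 1 - a\<close>, the vector \<open>c - d\<close> is
      \<open>b\<close> on \<open>A\<close> and \<open>b + 1\<close> off \<open>A\<close>, which are
      the bounds wanted for the dual alternative away from \<open>i\<close>.\<close>
    define d where "d j = (if j \<in> A then a j + 1 else a j)" for j
    have di: "d i = a i" using i by (simp add: d_def)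
    have eq: "I \<inter> vset d \<subseteq> vset (d(i := d i + 1))"
    proof
      fix x assume x: "x \<in> I \<inter> vset d"
      have ge: "vge j (d j) x" for j using x by (simp add: vset_def)
      have "vge j (a j) x" for j using vge_mono[OF ge, of "a j" j] by (simp add: d_def)
      moreover have "\<forall>j\<in>A. vge j (a j + 1) x" using ge by (metis d_def)
      ultimately have "\<not> veq i (a i) x" using neg x unfolding partly_attains_def by blast
      then have "vge i (d i + 1) x" using ge[of i] di by (simp add: veq_iff)
      then show "x \<in> vset (d(i := d i + 1))" using ge by (auto simp: vset_def)
    qed
    obtain z where z: "veq i (?c i - d i - 1) z" "\<And>j. j \<noteq> i \<Longrightarrow> vge j (?c j - d j) z"
      using approximation[of i "?c i - d i - 1" "\<lambda>j. ?c j - d j"] by blast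
    have zc: "z \<in> carrier Q" using z(1) by (rule veq_carrier)
    have "z \<in> ideal_quotient Q J (I \<inter> vset d)"
      unfolding ideal_quotient_def
    proof (intro CollectI conjI ballI zc)
      fix x assume "x \<in> I \<inter> vset d"
      then have "x \<in> vset (d(i := d i + 1))" using eq by blast
      then have x: "vge i (d i + 1) x" "\<And>j. j \<noteq> i \<Longrightarrow> vge j (d j) x" by (auto simp: vset_def split: if_splits)
      have "vge j (?c j) (z \<otimes> x)" for j
      proof (cases "j = i")
        case True
        then show ?thesis using vge_mult[OF veq_vge[OF z(1)] x(1)] by simp
      next
        case False
        then show ?thesis using vge_mult[OF z(2) x(2)] by fastforce
      qed
      then show "z \<otimes> x \<in> J" using conductor_value_set(1)[OF Jr] by (auto simp: vset_def)
    qed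
    then obtain y w where yw: "y \<in> ?N" "w \<in> ideal_quotient Q J (vset d)" "z = y \<oplus> w"
      unfolding quotient_Int_vset[OF J I] mem_set_add by blast
    have w: "vge j (?c j - d j) w" for j
      using quotient_vset_subset[OF Jr] yw(2) by (auto simp: vset_def)
    have c: "y \<in> carrier Q" "w \<in> carrier Q" using yw by (auto simp: ideal_quotient_def)
    have yz: "y = z \<oplus> \<ominus> w" unfolding yw(3) using c by algebra
    \<comment> \<open>The value of \<open>z\<close> at \<open>i\<close> is one below the bound
      \<open>c_i - d_i\<close> for \<open>w\<close>, so subtracting \<open>w\<close> does not
      disturb it.\<close>
    have yi: "veq i (?b i) y" unfolding yz using veq_add[OF z(1)] vge_neg[OF w[of i]] di by (simp add: algebra_simps)
    have ge: "vge j (?c j - d j) y" if "j \<noteq> i" for j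
      unfolding yz using vge_add[OF z(2)[OF that] vge_neg[OF w]] .
    have "vge j (?b j + 1) y" if "j \<in> - insert i A" for j
      using ge[of j] that by (auto simp: d_def)
    moreover have "vge j (?b j) y" for j
    proof (cases "j = i")
      case False
      then show ?thesis using vge_mono[OF ge[OF False], of "?b j"] by (auto simp: d_def)
    qed (use veq_vge[OF yi] in simp)
    ultimately show ?thesis unfolding partly_attains_def using yw(1) yi by blast
  qed
  ultimately show ?thesis by blast
qed

lemma dual_fibers_value_sets:
  assumes J: "canonical_ideal Q R J" and I: "rfi I"
  shows "dual_fibers (\<lambda>K. fiber K (value_set Q v I) \<alpha> \<noteq> {})
    (\<lambda>K. fiber K (value_set Q v (ideal_quotient Q J I)) (frobenius_vector (value_set Q v J) - \<alpha>) \<noteq> {})"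
proof -
  have Jr: "rfi J" using J by (simp add: canonical_ideal_def)
  note N = quotient_rfi[OF Jr I]
  have "($) (frobenius_vector (value_set Q v J) - \<alpha>) = (\<lambda>j. conductor (value_set Q v J) $ j - 1 - \<alpha> $ j)"
    by (simp add: frobenius_vector_def fun_eq_iff)
  then show ?thesis
    unfolding fiber_nonempty_iff[OF I] fiber_nonempty_iff[OF N]
    using attains_Un[OF I] attains_Un[OF N] partly_attains_dual[OF J I] partly_attains_iff
    by unfold_locales auto
qed

end

theorem corollary10:
  fixes Q :: "('a, 'b) ring_scheme"
    and R M J I :: "'a set"
    and v :: "'n::finite \<Rightarrow> 'a \<Rightarrow> int extended"
    and \<alpha> :: "int ^ 'n"
  assumes "admissible_ring Q R M"
    and "associated_valuations Q R v"
    and "canonical_ideal Q R J"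
    and "regular_fractional_ideal Q R I"
  shows
    "(maximal_point (value_set Q v I) \<alpha> \<longleftrightarrow>
       maximal_point (value_set Q v (ideal_quotient Q J I))
         (frobenius_vector (value_set Q v J) - \<alpha>)) \<and>
     (\<forall>p q. maximal_point_of_type (value_set Q v I) \<alpha> (p, q) \<longleftrightarrow>
       maximal_point_of_type (value_set Q v (ideal_quotient Q J I))
         (frobenius_vector (value_set Q v J) - \<alpha>)
         (int CARD('n) + 1 - q, int CARD('n) + 1 - p))"
proof -
  have "cring Q" using assms(1) by (simp add: admissible_ring_def total_ring_of_fractions_def)
  then interpret admissible_valuations Q R M v
    using assms(1,2) by (intro admissible_valuations.intro admissible.intro
        admissible_axioms.intro admissible_valuations_axioms.intro)
  show ?thesis using maximal_points_dual[OF dual_fibers_value_sets[OF assms(3,4)]] by blast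
qed

end
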